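(* Let $\Bbbk$ be a field of characteristic zero, let $U(3)$ be as defined below, and let $M_{(0,0)}=\Bbbk[\partial]u$ be the conformal $U(3)$-module with $v\,{}_\lambda\,u=\partial u$. Then \[ \dim_\Bbbk H^n(U(3),M_{(0,0)})=\begin{cases}1, & n=1,\\ 2, & n=2,\\ 1, & n=3,\\ 0, & n\ge 4.\end{cases} \]
   Context: A conformal algebra over $\Bbbk$ is a $\Bbbk[\partial]$-module $C$ with a bilinear $\lambda$-product $(a\,{}_{\lambda}\,b)=\sum_{n\ge0}\frac{\lambda^n}{n!}(a\,{}_{(n)}\,b)\in C[\lambda]$ satisfying $(\partial a\,{}_\lambda\, b)=-\lambda(a\,{}_\lambda\, b)$ and $(a\,{}_\lambda\,\partial b)=(\partial+\lambda)(a\,{}_\lambda\, b)$; it is associative if $a\,{}_\lambda(b\,{}_\mu c)=(a\,{}_\lambda b)\,{}_{\lambda+\mu} c$. $U(3)$ is the associative conformal algebra generated by one element $v$ subject to $v\,{}_{(n)}\,v=0$ for $n\ge 3$ and $2\,v\,{}_{(1)}\,v-\partial(v\,{}_{(2)}\,v)=2v$. A left conformal module over an associative conformal algebra $C$ is a $\Bbbk[\partial]$-module $M$ with a bilinear map $a\otimes m\mapsto a\,{}_\lambda m\in M[\lambda]$ satisfying $(\partial a)\,{}_\lambda m=-\lambda(a\,{}_\lambda m)$, $a\,{}_\lambda\,\partial m=(\partial+\lambda)(a\,{}_\lambda m)$, $a\,{}_\lambda(b\,{}_\mu m)=(a\,{}_\lambda b)\,{}_{\lambda+\mu}m$. Hochschild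 cohomology: the basic complex $\tilde C^n(C,M)$ ($n\ge1$) consists of maps $\varphi_{\bar\lambda}:C^{\otimes n}\to M[\lambda_1,\dots,\lambda_n]$ with $\varphi_{\bar\lambda}(a_1,\dots,\partial a_i,\dots,a_n)=-\lambda_i\varphi_{\bar\lambda}(a_1,\dots,a_n)$, $\tilde C^0=M$, with differential $(d\varphi)_{\bar\lambda}(a_1,\dots,a_{n+1})=a_1\,{}_{\lambda_1}\varphi_{(\lambda_2,\dots,\lambda_{n+1})}(a_2,\dots,a_{n+1})+\sum_{i=1}^n(-1)^i\varphi_{(\lambda_1,\dots,\lambda_i+\lambda_{i+1},\dots,\lambda_{n+1})}(a_1,\dots,a_i\,{}_{\lambda_i}a_{i+1},\dots,a_{n+1})$ (for $n=0$: $(dm)_\lambda(a)=a\,{}_\lambda m$). $\partial$ acts on $\tilde C^n$ by $(\partial\varphi)_{\bar\lambda}=(\partial+\sum_i\lambda_i)\varphi_{\bar\lambda}$, commuting with $d$; $H^n(C,M)$ is the cohomology of the reduced complex $\tilde C^\bullet(C,M)/\partial\tilde C^\bullet(C,M)$. *)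

theory Defs
  imports Main "HOL-Computational_Algebra.Polynomial" "HOL-Library.Function_Algebras"
begin

text \<open>A lambda-product (a _lambda b) = sum_n lambda^n/n! (a_(n) b) is encoded by its
  n-products pr n a b (finitely many nonzero).  Since the ground field has characteristic
  zero (hence is infinite), a polynomial identity in lambda, mu is equivalent to the
  identity evaluated at all scalars lambda, mu; lam_ev evaluates the lambda-product at a
  scalar.\<close>

definition lam_ev :: "('k::field_char_0 \<Rightarrow> 'c \<Rightarrow> 'c::comm_monoid_add) \<Rightarrow> (nat \<Rightarrow> 'a \<Rightarrow> 'b \<Rightarrow> 'c)
    \<Rightarrow> 'a \<Rightarrow> 'b \<Rightarrow> 'k \<Rightarrow> 'c" where
  "lam_ev sc pr a b l = (\<Sum>n\<in>{n. pr n a b \<noteq> 0}. sc (l ^ n / fact n) (pr n a b))"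

definition assoc_conf_alg :: "'b set \<Rightarrow> ('k::field_char_0 \<Rightarrow> 'b \<Rightarrow> 'b::ab_group_add)
    \<Rightarrow> ('b \<Rightarrow> 'b) \<Rightarrow> (nat \<Rightarrow> 'b \<Rightarrow> 'b \<Rightarrow> 'b) \<Rightarrow> bool" where
  "assoc_conf_alg S sc dd pr \<longleftrightarrow>
     0 \<in> S \<and> (\<forall>x\<in>S. \<forall>y\<in>S. x + y \<in> S) \<and> (\<forall>c. \<forall>x\<in>S. sc c x \<in> S)
   \<and> (\<forall>x\<in>S. dd x \<in> S) \<and> (\<forall>n. \<forall>x\<in>S. \<forall>y\<in>S. pr n x y \<in> S)
   \<and> (\<forall>x\<in>S. \<forall>y\<in>S. \<forall>c. dd (x + y) = dd x + dd y \<and> dd (sc c x) = sc c (dd x))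
   \<and> (\<forall>n. \<forall>x\<in>S. \<forall>y\<in>S. \<forall>z\<in>S. \<forall>c.
         pr n (x + y) z = pr n x z + pr n y z \<and> pr n z (x + y) = pr n z x + pr n z y
       \<and> pr n (sc c x) y = sc c (pr n x y) \<and> pr n x (sc c y) = sc c (pr n x y))
   \<and> (\<forall>a\<in>S. \<forall>b\<in>S. finite {n. pr n a b \<noteq> 0})
   \<and> (\<forall>a\<in>S. \<forall>b\<in>S. \<forall>l. lam_ev sc pr (dd a) b l = - sc l (lam_ev sc pr a b l))
   \<and> (\<forall>a\<in>S. \<forall>b\<in>S. \<forall>l. lam_ev sc pr a (dd b) l = dd (lam_ev sc pr a b l) + sc l (lam_ev sc pr a b l))
   \<and> (\<forall>a\<in>S. \<forall>b\<in>S. \<forall>c\<in>S. \<forall>l m.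
         lam_ev sc pr a (lam_ev sc pr b c m) l = lam_ev sc pr (lam_ev sc pr a b l) c (l + m))"

definition U3_rel :: "('k::field_char_0 \<Rightarrow> 'b \<Rightarrow> 'b::ab_group_add) \<Rightarrow> ('b \<Rightarrow> 'b)
    \<Rightarrow> (nat \<Rightarrow> 'b \<Rightarrow> 'b \<Rightarrow> 'b) \<Rightarrow> 'b \<Rightarrow> bool" where
  "U3_rel sc dd pr v \<longleftrightarrow> (\<forall>n\<ge>3. pr n v v = 0)
      \<and> sc 2 (pr 1 v v) - dd (pr 2 v v) = sc 2 v"

inductive_set generated :: "('k::field_char_0 \<Rightarrow> 'b \<Rightarrow> 'b::ab_group_add) \<Rightarrow> ('b \<Rightarrow> 'b)
    \<Rightarrow> (nat \<Rightarrow> 'b \<Rightarrow> 'b \<Rightarrow> 'b) \<Rightarrow> 'b \<Rightarrow> 'b set"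
  for sc dd pr v where
  gen_v: "v \<in> generated sc dd pr v"
| gen_0: "0 \<in> generated sc dd pr v"
| gen_add: "x \<in> generated sc dd pr v \<Longrightarrow> y \<in> generated sc dd pr v \<Longrightarrow> x + y \<in> generated sc dd pr v"
| gen_sc: "x \<in> generated sc dd pr v \<Longrightarrow> sc c x \<in> generated sc dd pr v"
| gen_dd: "x \<in> generated sc dd pr v \<Longrightarrow> dd x \<in> generated sc dd pr v"
| gen_pr: "x \<in> generated sc dd pr v \<Longrightarrow> y \<in> generated sc dd pr v \<Longrightarrow> pr n x y \<in> generated sc dd pr v"

definition conf_hom :: "'a set \<Rightarrow> ('k::field_char_0 \<Rightarrow> 'a \<Rightarrow> 'a::ab_group_add) \<Rightarrow> ('a \<Rightarrow> 'a) \<Rightarrow> (nat \<Rightarrow> 'a \<Rightarrow> 'a \<Rightarrow> 'a)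
    \<Rightarrow> 'b set \<Rightarrow> ('k \<Rightarrow> 'b \<Rightarrow> 'b::ab_group_add) \<Rightarrow> ('b \<Rightarrow> 'b) \<Rightarrow> (nat \<Rightarrow> 'b \<Rightarrow> 'b \<Rightarrow> 'b)
    \<Rightarrow> ('a \<Rightarrow> 'b) \<Rightarrow> bool" where
  "conf_hom S sc dd pr T sc' dd' pr' f \<longleftrightarrow>
     (\<forall>x\<in>S. f x \<in> T) \<and> (\<forall>x\<in>S. \<forall>y\<in>S. f (x + y) = f x + f y)
   \<and> (\<forall>c. \<forall>x\<in>S. f (sc c x) = sc' c (f x)) \<and> (\<forall>x\<in>S. f (dd x) = dd' (f x))
   \<and> (\<forall>n. \<forall>x\<in>S. \<forall>y\<in>S. f (pr n x y) = pr' n (f x) (f y))"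

text \<open>(UNIV, sc, dd, pr, v) is (a model of) U(3): the associative conformal algebra generated
  by v subject to the U(3) relations, i.e. generated by v and universal among associative
  conformal algebras with an element satisfying the relations.  The test algebras D are
  taken with carrier a subspace of nat => 'k; since a one-generated conformal algebra has
  countable dimension, this loses no generality.\<close>
definition is_U3 :: "('k::field_char_0 \<Rightarrow> 'a \<Rightarrow> 'a::ab_group_add) \<Rightarrow> ('a \<Rightarrow> 'a)
    \<Rightarrow> (nat \<Rightarrow> 'a \<Rightarrow> 'a \<Rightarrow> 'a) \<Rightarrow> 'a \<Rightarrow> bool" where
  "is_U3 sc dd pr v \<longleftrightarrow>
     vector_space sc \<and> assoc_conf_alg UNIV sc dd pr \<and> U3_rel sc dd pr v
   \<and> generated sc dd pr v = UNIV
   \<and> (\<forall>(D :: (nat \<Rightarrow> 'k) set) dd' pr' w.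
        assoc_conf_alg D (\<lambda>c f n. c * f n) dd' pr' \<and> w \<in> D
        \<and> U3_rel (\<lambda>c f n. c * f n) dd' pr' w
        \<longrightarrow> (\<exists>f. conf_hom UNIV sc dd pr D (\<lambda>c f n. c * f n) dd' pr' f \<and> f v = w))"

section \<open>The module M = k[\<partial>]u, realised as 'k poly with \<partial> = multiplication by X, u = 1\<close>

definition dM :: "'k::field_char_0 poly \<Rightarrow> 'k poly" where
  "dM p = [:0, 1:] * p"

definition conf_module :: "('k::field_char_0 \<Rightarrow> 'a \<Rightarrow> 'a::ab_group_add) \<Rightarrow> ('a \<Rightarrow> 'a)
    \<Rightarrow> (nat \<Rightarrow> 'a \<Rightarrow> 'a \<Rightarrow> 'a) \<Rightarrow> (nat \<Rightarrow> 'a \<Rightarrow> 'k poly \<Rightarrow> 'k poly) \<Rightarrow> bool" where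
  "conf_module sc dd pr ma \<longleftrightarrow>
     (\<forall>n x y p q c. ma n (x + y) p = ma n x p + ma n y p \<and> ma n x (p + q) = ma n x p + ma n x q
        \<and> ma n (sc c x) p = smult c (ma n x p) \<and> ma n x (smult c p) = smult c (ma n x p))
   \<and> (\<forall>a m. finite {n. ma n a m \<noteq> 0})
   \<and> (\<forall>a m l. lam_ev smult ma (dd a) m l = - smult l (lam_ev smult ma a m l))
   \<and> (\<forall>a m l. lam_ev smult ma a (dM m) l = dM (lam_ev smult ma a m l) + smult l (lam_ev smult ma a m l))
   \<and> (\<forall>a b m l mu. lam_ev smult ma a (lam_ev smult ma b m mu) l
                   = lam_ev smult ma (lam_ev sc pr a b l) m (l + mu))"

section \<open>Hochschild cochains, evaluated at scalar values of lambda_1..lambda_n\<close>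

type_synonym ('a, 'k) cochain = "'a list \<Rightarrow> 'k list \<Rightarrow> 'k poly"

definition poly_fun :: "nat \<Rightarrow> ('k::field_char_0 list \<Rightarrow> 'k poly) \<Rightarrow> bool" where
  "poly_fun n g \<longleftrightarrow> (\<exists>(K :: nat list set) c. finite K \<and>
      (\<forall>ls. length ls = n \<longrightarrow> g ls = (\<Sum>k\<in>K. smult (\<Prod>i<n. ls ! i ^ (k ! i)) (c k))))"

text \<open>n-cochains (n \<ge> 0): multilinear maps C^n \<rightarrow> M[lambda_1..lambda_n] with the
  sesquilinearity condition; values outside lists of length n are 0.  For n = 0 this is M.\<close>
definition cochain :: "('k::field_char_0 \<Rightarrow> 'a \<Rightarrow> 'a::ab_group_add) \<Rightarrow> ('a \<Rightarrow> 'a) \<Rightarrow> nat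
    \<Rightarrow> ('a, 'k) cochain \<Rightarrow> bool" where
  "cochain sc dd n \<phi> \<longleftrightarrow>
     (\<forall>xs ls. length xs \<noteq> n \<or> length ls \<noteq> n \<longrightarrow> \<phi> xs ls = 0)
   \<and> (\<forall>xs. length xs = n \<longrightarrow> poly_fun n (\<phi> xs))
   \<and> (\<forall>xs ls i. length xs = n \<and> length ls = n \<and> i < n \<longrightarrow>
        (\<forall>x y c. \<phi> (xs[i := x + y]) ls = \<phi> (xs[i := x]) ls + \<phi> (xs[i := y]) ls
               \<and> \<phi> (xs[i := sc c x]) ls = smult c (\<phi> (xs[i := x]) ls))
      \<and> \<phi> (xs[i := dd (xs ! i)]) ls = - smult (ls ! i) (\<phi> xs ls))"

definition hdiff :: "('k::field_char_0 \<Rightarrow> 'a \<Rightarrow> 'a::ab_group_add) \<Rightarrow> (nat \<Rightarrow> 'a \<Rightarrow> 'a \<Rightarrow> 'a)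
    \<Rightarrow> (nat \<Rightarrow> 'a \<Rightarrow> 'k poly \<Rightarrow> 'k poly) \<Rightarrow> nat \<Rightarrow> ('a, 'k) cochain \<Rightarrow> ('a, 'k) cochain" where
  "hdiff sc pr ma n \<phi> xs ls =
     (if length xs = Suc n \<and> length ls = Suc n then
        lam_ev smult ma (xs ! 0) (\<phi> (tl xs) (tl ls)) (ls ! 0)
      + (\<Sum>i\<in>{1..n}. smult ((-1) ^ i)
           (\<phi> (take (i - 1) xs @ [lam_ev sc pr (xs ! (i - 1)) (xs ! i) (ls ! (i - 1))] @ drop (i + 1) xs)
               (take (i - 1) ls @ [ls ! (i - 1) + ls ! i] @ drop (i + 1) ls)))
      else 0)"

definition cdel :: "('a, 'k::field_char_0) cochain \<Rightarrow> ('a, 'k) cochain" where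
  "cdel \<phi> xs ls = dM (\<phi> xs ls) + smult (sum_list ls) (\<phi> xs ls)"

text \<open>Cocycles and coboundaries of the reduced complex C/\<partial>C, lifted to C (n \<ge> 1).\<close>
definition red_cocycles where
  "red_cocycles sc dd pr ma n =
     {\<phi>. cochain sc dd n \<phi> \<and> (\<exists>\<chi>. cochain sc dd (Suc n) \<chi> \<and> hdiff sc pr ma n \<phi> = cdel \<chi>)}"

definition red_coboundaries where
  "red_coboundaries sc dd pr ma n =
     {\<phi>. \<exists>\<psi> \<chi>. cochain sc dd (n - 1) \<psi> \<and> cochain sc dd n \<chi>
            \<and> \<phi> = hdiff sc pr ma (n - 1) \<psi> + cdel \<chi>}"

definition quot_dim_eq :: "('a, 'k::field_char_0) cochain set \<Rightarrow> ('a, 'k) cochain set \<Rightarrow> nat \<Rightarrow> bool" where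
  "quot_dim_eq Z B d \<longleftrightarrow> (\<exists>S. finite S \<and> card S = d \<and> S \<subseteq> Z
     \<and> (\<forall>z\<in>Z. \<exists>f b. b \<in> B \<and> z = (\<Sum>s\<in>S. (\<lambda>xs ls. smult (f s) (s xs ls))) + b)
     \<and> (\<forall>f. (\<Sum>s\<in>S. (\<lambda>xs ls. smult (f s) (s xs ls))) \<in> B \<longrightarrow> (\<forall>s\<in>S. f s = 0)))"

definition dim_H_eq where
  "dim_H_eq sc dd pr ma n d \<longleftrightarrow>
     quot_dim_eq (red_cocycles sc dd pr ma n) (red_coboundaries sc dd pr ma n) d"

end

theory Submission
  imports Defs "HOL-Library.Nat_Bijection"
begin

text \<open>Substituting scalars for \<open>\<partial>\<close> and the \<open>\<lambda>\<^sub>i\<close>, a cochain becomes a polynomial function of the vertices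
  \<open>y\<^sub>0 = \<partial>\<close>, \<open>y\<^sub>i = y\<^sub>i\<^sub>-\<^sub>1 + \<lambda>\<^sub>i\<close>. The universal property, tested against algebras of polynomial
  matrices, identifies \<open>U(3)\<close> with the polynomials \<open>f(x, z, d)\<close> such that \<open>f = x g\<close> at \<open>d = 0\<close> and
  \<open>f = z g\<close> at \<open>d = 1\<close> for some \<open>g(x, z)\<close>. This gives two characters \<open>x g\<close> and \<open>z g\<close>, the first of
  which is the module. Localising the first argument and contracting at the vertex 1 shows
  that, up to coboundaries, every cocycle of degree at least 2 for the first character is the cup
  product of a fixed derivation \<open>\<tau>\<close> with a cocycle \<open>\<chi>\<close> of lower degree for the second one; conversely
  \<open>y\<^sub>0 \<chi>\<close> is a cocycle for the first character, and dividing by \<open>y\<^sub>0\<close> closes the recursion. The basic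
  complex thus has one class \<open>w2\<close> in degree 2, one class \<open>w3\<close> in degree 3 and no other class in
  positive degree. Both become exact after multiplication by the last vertex, that is by \<open>\<partial>\<close>:
  \<open>d u1 = \<partial> w2\<close> and \<open>d u2 = \<partial> w3\<close>. Hence the reduced cohomology has the bases \<open>u1\<close>, \<open>w2, u2\<close> and \<open>w3\<close>.\<close>

section \<open>Polynomial functions of several variables\<close>

text \<open>The obstacle is the vertex 0. Going back from \<open>y0 * \<chi> = d \<psi>\<close> to
  \<open>\<chi>\<close> requires \<open>\<psi>\<close> to be exact already on the hyperplane
  \<open>y0 = 0\<close>; there the character \<open>r0\<close> vanishes, so inserting
  \<open>v\<close> at the base vertex no longer contracts anything. Cocycles on the hyperplane are
  therefore classified separately, with a first-order term in a translation of all vertices as the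
  homotopy. The outcome rests on an asymmetry: \<open>w2\<close> is a multiple of \<open>y0\<close>
  and disappears on the hyperplane, while \<open>w3\<close> stays nontrivial there. This excludes a
  class for \<open>r1\<close> in degree 3 and stops the recursion. The derivations have concrete
  sources. \<open>alpha\<close> is minus the derivative of the polynomial \<open>fp\<close> at
  \<open>d = 1\<close>. \<open>tau\<close> comes from the functional sending \<open>h\<close> to
  \<open>h(1) - y h(0)\<close>, which up to scale is the only one that kills the multiples of
  \<open>d (1 - d)\<close> and the polynomial of \<open>v\<close> from 1 to \<open>y\<close>. The
  last vertex enters because the basic differential has no right action: the term
  \<open>alpha x * r1 x'\<close> of the product rule stays uncancelled, and \<open>r1\<close>
  contains the end vertex as a factor.\<close>

inductive PF :: "nat \<Rightarrow> ('k::field_char_0 list \<Rightarrow> 'k) \<Rightarrow> bool" for n where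
  PF_const: "(\<And>ys. length ys = n \<Longrightarrow> F ys = c) \<Longrightarrow> PF n F"
| PF_nth: "i < n \<Longrightarrow> (\<And>ys. length ys = n \<Longrightarrow> F ys = ys ! i) \<Longrightarrow> PF n F"
| PF_addI: "PF n F \<Longrightarrow> PF n G \<Longrightarrow> (\<And>ys. length ys = n \<Longrightarrow> H ys = F ys + G ys) \<Longrightarrow> PF n H"
| PF_multI: "PF n F \<Longrightarrow> PF n G \<Longrightarrow> (\<And>ys. length ys = n \<Longrightarrow> H ys = F ys * G ys) \<Longrightarrow> PF n H"

text \<open>Every clause of \<open>PF\<close> speaks only of lists of length \<open>n\<close>, so
  values on other lengths are free; adding the constant 0 through \<open>PF_addI\<close> performs
  the change.\<close>

lemma PF_cong:
  assumes "PF n F" "\<And>ys. length ys = n \<Longrightarrow> G ys = F ys"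
  shows "PF n G"
  using assms(1) PF_const[of n "\<lambda>_. 0" 0] by (rule PF_addI) (simp_all add: assms(2))

lemma PF_c [simp, intro]: "PF n (\<lambda>_. c)"
  by (rule PF_const) simp

lemma PF_i [intro]: "i < n \<Longrightarrow> PF n (\<lambda>ys. ys ! i)"
  by (rule PF_nth) simp_all

lemma PF_add: "PF n F \<Longrightarrow> PF n G \<Longrightarrow> PF n (\<lambda>ys. F ys + G ys)"
  by (rule PF_addI) simp_all

lemma PF_mult: "PF n F \<Longrightarrow> PF n G \<Longrightarrow> PF n (\<lambda>ys. F ys * G ys)"
  by (rule PF_multI) simp_all

lemma PF_uminus: "PF n F \<Longrightarrow> PF n (\<lambda>ys. - F ys)"
  using PF_mult[OF PF_c[of n "-1"]] by simp

lemma PF_diff: "PF n F \<Longrightarrow> PF n G \<Longrightarrow> PF n (\<lambda>ys. F ys - G ys)"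
  using PF_add[of n F "\<lambda>ys. - G ys"] PF_uminus[of n G] by simp

lemma PF_sum: "(\<And>i. i \<in> I \<Longrightarrow> PF n (F i)) \<Longrightarrow> PF n (\<lambda>ys. \<Sum>i\<in>I. F i ys)"
  by (induction I rule: infinite_finite_induct) (auto intro: PF_add)

lemma PF_power: "PF n F \<Longrightarrow> PF n (\<lambda>ys. F ys ^ k)"
  by (induction k) (auto intro: PF_mult)

lemma PF_prod: "(\<And>i. i \<in> I \<Longrightarrow> PF n (F i)) \<Longrightarrow> PF n (\<lambda>ys. \<Prod>i\<in>I. F i ys)"
  by (induction I rule: infinite_finite_induct) (auto intro: PF_mult)

lemma PF_subst:
  assumes "PF m F" "\<And>i. i < m \<Longrightarrow> PF n (\<lambda>ys. s ys ! i)" "\<And>ys. length ys = n \<Longrightarrow> length (s ys) = m"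
  shows "PF n (\<lambda>ys. F (s ys))"
  using assms(1)
proof induction
  case (PF_const F c)
  then show ?case using assms(3) by (intro PF.PF_const[where c = c]) auto
next
  case (PF_nth i F)
  then show ?case using PF_cong[OF assms(2)[of i], of "\<lambda>ys. F (s ys)"] assms(3) by auto
next
  case (PF_addI F G H)
  then show ?case using assms(3) by (intro PF.PF_addI[OF PF_addI(4,5)]) auto
next
  case (PF_multI F G H)
  then show ?case using assms(3) by (intro PF.PF_multI[OF PF_multI(4,5)]) auto
qed

definition PL :: "nat \<Rightarrow> nat \<Rightarrow> ('k::field_char_0 list \<Rightarrow> 'k list) \<Rightarrow> bool" where
  "PL n m s \<longleftrightarrow> (\<forall>i<m. PF n (\<lambda>ys. s ys ! i)) \<and> (\<forall>ys. length ys = n \<longrightarrow> length (s ys) = m)"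

lemma PF_PL: "PF m F \<Longrightarrow> PL n m s \<Longrightarrow> PF n (\<lambda>ys. F (s ys))"
  by (rule PF_subst) (auto simp: PL_def)

lemma PL_Nil: "PL n 0 (\<lambda>_. [])"
  by (auto simp: PL_def)

lemma PL_Cons:
  assumes "PF n p" "PL n m s"
  shows "PL n (Suc m) (\<lambda>ys. p ys # s ys)"
proof -
  have "PF n (\<lambda>ys. (p ys # s ys) ! i)" if "i < Suc m" for i
    using that assms by (cases i) (simp_all add: PL_def)
  then show ?thesis using assms(2) by (simp add: PL_def)
qed

lemma PL_id: "PL n n (\<lambda>ys. ys)"
  by (auto simp: PL_def)

lemma PL_drop: "n = k + m \<Longrightarrow> PL n m (drop k)"
proof -
  assume n: "n = k + m"
  have "PF n (\<lambda>ys. drop k ys ! i)" if "i < m" for i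
    using that n by (intro PF_nth[of "k + i"]) auto
  then show ?thesis using n by (auto simp: PL_def)
qed

lemma PL_tl: "PL (Suc n) n (tl :: 'k::field_char_0 list \<Rightarrow> 'k list)"
proof -
  have *: "(tl :: 'k list \<Rightarrow> _) = drop 1" by (auto simp: drop_Suc)
  show ?thesis unfolding * by (rule PL_drop) simp
qed

lemma PL_append:
  assumes s: "PL n m s" and t: "PL n l t"
  shows "PL n (m + l) (\<lambda>ys. s ys @ t ys)"
proof -
  have "PF n (\<lambda>ys. (s ys @ t ys) ! i)" if "i < m + l" for i
  proof (cases "i < m")
    case True
    then have "PF n (\<lambda>ys. s ys ! i)" using s by (simp add: PL_def)
    then show ?thesis using s True by (elim PF_cong) (auto simp: PL_def nth_append)
  next
    case False
    then have "PF n (\<lambda>ys. t ys ! (i - m))" using t that by (simp add: PL_def)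
    then show ?thesis using s False by (elim PF_cong) (auto simp: PL_def nth_append)
  qed
  then show ?thesis using s t by (auto simp: PL_def)
qed

lemma PL_take: "k \<le> n \<Longrightarrow> PL n k (take k)"
proof -
  assume n: "k \<le> n"
  have "PF n (\<lambda>ys. take k ys ! i)" if "i < k" for i
    using that n by (intro PF_nth[of "i"]) auto
  then show ?thesis using n by (auto simp: PL_def)
qed

lemma PL_map:
  assumes "PF (Suc n) (\<lambda>ys. f (tl ys) (hd ys))" "PL n m s"
  shows "PL n m (\<lambda>ys. map (f ys) (s ys))"
proof -
  have "PF n (\<lambda>ys. map (f ys) (s ys) ! i)" if "i < m" for i
  proof -
    have "PF n (\<lambda>ys. s ys ! i)" using assms(2) that by (simp add: PL_def)
    from PF_PL[OF assms(1) PL_Cons[OF this PL_id]]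
    show ?thesis by (rule PF_cong) (use assms(2) that in \<open>auto simp: PL_def\<close>)
  qed
  then show ?thesis using assms(2) by (auto simp: PL_def)
qed

lemma PF_hd: "PF (Suc n) hd"
  by (rule PF_nth[of 0]) (auto simp: length_Suc_conv)

lemma PF_hd_tl: "PF (Suc (Suc n)) (\<lambda>ys. hd (tl ys))"
  by (rule PF_nth[of 1]) (auto simp: length_Suc_conv)

lemma PF_last: "PF (Suc n) last"
  by (rule PF_nth[of n]) (simp_all, metis diff_Suc_1 last_conv_nth length_0_conv nat.distinct(1))

text \<open>A polynomial family of polynomials. The uniform degree bound is what allows the family
  to be regrouped as a polynomial function of one more variable.\<close>

definition PFP :: "nat \<Rightarrow> ('k::field_char_0 list \<Rightarrow> 'k poly) \<Rightarrow> bool" where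
  "PFP n P \<longleftrightarrow> (\<forall>i. PF n (\<lambda>ys. coeff (P ys) i)) \<and> (\<exists>N. \<forall>ys. length ys = n \<longrightarrow> degree (P ys) \<le> N)"

lemma PFP_const [simp]: "PFP n (\<lambda>_. p)"
  by (auto simp: PFP_def)

lemma PFP_PF: "PF n F \<Longrightarrow> PFP n (\<lambda>ys. [:F ys:])"
proof -
  assume "PF n F"
  then have "PF n (\<lambda>ys. coeff [:F ys:] i)" for i
    by (cases i) (auto simp: coeff_pCons)
  then show ?thesis by (auto simp: PFP_def)
qed

lemma PFP_cong:
  assumes "PFP n P" "\<And>ys. length ys = n \<Longrightarrow> Q ys = P ys"
  shows "PFP n Q"
proof -
  have "PF n (\<lambda>ys. coeff (Q ys) i)" for i
    by (rule PF_cong[of n "\<lambda>ys. coeff (P ys) i"]) (use assms in \<open>simp_all add: PFP_def\<close>)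
  moreover have "\<exists>N. \<forall>ys. length ys = n \<longrightarrow> degree (Q ys) \<le> N"
    using assms by (simp add: PFP_def)
  ultimately show ?thesis by (simp add: PFP_def)
qed

lemma PFP_add: "PFP n P \<Longrightarrow> PFP n Q \<Longrightarrow> PFP n (\<lambda>ys. P ys + Q ys)"
proof -
  assume a: "PFP n P" "PFP n Q"
  then obtain N M where "\<forall>ys. length ys = n \<longrightarrow> degree (P ys) \<le> N" "\<forall>ys. length ys = n \<longrightarrow> degree (Q ys) \<le> M"
    by (auto simp: PFP_def)
  then have "\<forall>ys. length ys = n \<longrightarrow> degree (P ys + Q ys) \<le> max N M"
    by (auto intro!: degree_add_le simp: max_def intro: order_trans)
  with a show ?thesis by (auto simp: PFP_def intro: PF_add)
qed

lemma PFP_mult: "PFP n P \<Longrightarrow> PFP n Q \<Longrightarrow> PFP n (\<lambda>ys. P ys * Q ys)"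
proof -
  assume a: "PFP n P" "PFP n Q"
  then obtain N M where NM: "\<And>ys. length ys = n \<Longrightarrow> degree (P ys) \<le> N" "\<And>ys. length ys = n \<Longrightarrow> degree (Q ys) \<le> M"
    by (auto simp: PFP_def)
  have "degree (P ys * Q ys) \<le> N + M" if "length ys = n" for ys
    using degree_mult_le[of "P ys" "Q ys"] NM[OF that] by linarith
  moreover have "PF n (\<lambda>ys. coeff (P ys * Q ys) i)" for i
    unfolding coeff_mult using a by (auto simp: PFP_def intro!: PF_sum PF_mult)
  ultimately show ?thesis by (auto simp: PFP_def)
qed

lemma PFP_smult: "PF n F \<Longrightarrow> PFP n P \<Longrightarrow> PFP n (\<lambda>ys. smult (F ys) (P ys))"
  using PFP_mult[OF PFP_PF[of n F], of P] by simp

lemma PFP_pCons: "PF n F \<Longrightarrow> PFP n P \<Longrightarrow> PFP n (\<lambda>ys. pCons (F ys) (P ys))"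
proof -
  assume a: "PF n F" "PFP n P"
  have "PFP n (\<lambda>ys. [:F ys:] + [:0,1:] * P ys)"
    using PFP_add[OF PFP_PF[OF a(1)] PFP_mult[OF PFP_const a(2)]] .
  then show ?thesis by simp
qed

lemma PFP_PL: "PFP m F \<Longrightarrow> PL n m s \<Longrightarrow> PFP n (\<lambda>ys. F (s ys))"
proof -
  assume a: "PFP m F" "PL n m s"
  then have "PF n (\<lambda>ys. coeff (F (s ys)) i)" for i
    using PF_PL[of m "\<lambda>ys. coeff (F ys) i"] by (simp add: PFP_def)
  moreover from a obtain N where "\<forall>ys. length ys = m \<longrightarrow> degree (F ys) \<le> N" by (auto simp: PFP_def)
  then have "\<forall>ys. length ys = n \<longrightarrow> degree (F (s ys)) \<le> N" using a by (auto simp: PL_def)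
  ultimately show ?thesis unfolding PFP_def by blast
qed

lemma poly_altdef_le: "degree p \<le> N \<Longrightarrow> poly p x = (\<Sum>i\<le>N. coeff p i * x ^ i)"
  for p :: "'k::comm_ring_1 poly"
  unfolding poly_altdef by (rule sum.mono_neutral_left) (auto simp: coeff_eq_0)

lemma PFP_poly: "PFP n P \<Longrightarrow> PF n F \<Longrightarrow> PF n (\<lambda>ys. poly (P ys) (F ys))"
proof -
  assume a: "PFP n P" "PF n F"
  then obtain N where N: "\<And>ys. length ys = n \<Longrightarrow> degree (P ys) \<le> N" by (auto simp: PFP_def)
  have "PF n (\<lambda>ys. \<Sum>i\<le>N. coeff (P ys) i * F ys ^ i)"
    using a by (auto simp: PFP_def intro!: PF_sum PF_mult PF_power)
  then show ?thesis by (rule PF_cong) (auto intro!: poly_altdef_le N)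
qed

text \<open>The first variable is singled out and the others become parameters of its coefficients.
  Inductions on the number of variables and the use of \<open>pfun\<close> on cochains rest on
  this.\<close>

lemma PF_PFP:
  assumes "PF (Suc n) F"
  shows "\<exists>P. PFP n P \<and> (\<forall>t ls. length ls = n \<longrightarrow> F (t # ls) = poly (P ls) t)"
  using assms
proof induction
  case (PF_const F c)
  then show ?case by (intro exI[of _ "\<lambda>_. [:c:]"]) auto
next
  case (PF_nth i F)
  show ?case
  proof (cases i)
    case 0
    then show ?thesis using PF_nth by (intro exI[of _ "\<lambda>_. [:0,1:]"]) auto
  next
    case (Suc j)
    then show ?thesis using PF_nth by (intro exI[of _ "\<lambda>ls. [:ls ! j:]"]) (auto intro: PFP_PF)
  qed
next
  case (PF_addI F G H)
  then obtain P Q where "PFP n P" "PFP n Q" "\<forall>t ls. length ls = n \<longrightarrow> F (t # ls) = poly (P ls) t"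
    "\<forall>t ls. length ls = n \<longrightarrow> G (t # ls) = poly (Q ls) t" by blast
  then show ?case using PF_addI by (intro exI[of _ "\<lambda>ls. P ls + Q ls"]) (auto intro: PFP_add)
next
  case (PF_multI F G H)
  then obtain P Q where "PFP n P" "PFP n Q" "\<forall>t ls. length ls = n \<longrightarrow> F (t # ls) = poly (P ls) t"
    "\<forall>t ls. length ls = n \<longrightarrow> G (t # ls) = poly (Q ls) t" by blast
  then show ?case using PF_multI by (intro exI[of _ "\<lambda>ls. P ls * Q ls"]) (auto intro: PFP_mult)
qed

section \<open>Polynomial functions of one variable and their polynomials\<close>

definition pfun :: "('k::field_char_0 \<Rightarrow> 'k) \<Rightarrow> 'k poly" where
  "pfun h = (THE p. \<forall>t. poly p t = h t)"

lemma pfun_eqI: "(\<And>t. poly p t = h t) \<Longrightarrow> pfun h = p"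
  unfolding pfun_def by (rule the_equality) (auto simp flip: poly_eq_poly_eq_iff)

lemma pfun_poly [simp]: "pfun (poly p) = p"
  by (rule pfun_eqI) simp

definition is_pfun :: "('k::field_char_0 \<Rightarrow> 'k) \<Rightarrow> bool" where
  "is_pfun h \<longleftrightarrow> (\<exists>p. h = poly p)"

lemma poly_pfun: "is_pfun h \<Longrightarrow> poly (pfun h) t = h t"
  by (auto simp: is_pfun_def)

lemma is_pfun_PF: "PF n F \<Longrightarrow> PL 1 n s \<Longrightarrow> is_pfun (\<lambda>t. F (s [t]))"
proof -
  assume a: "PF n F" "PL 1 n s"
  from PF_PFP[OF PF_PL[OF this, unfolded One_nat_def]] obtain P where "\<forall>t ls. length ls = 0 \<longrightarrow> F (s (t # ls)) = poly (P ls) t"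
    by blast
  then have "(\<lambda>t. F (s [t])) = poly (P [])" by auto
  then show ?thesis unfolding is_pfun_def by (rule exI)
qed

lemma PFP_pfun: "PF (Suc n) F \<Longrightarrow> PFP n (\<lambda>ls. pfun (\<lambda>t. F (t # ls)))"
proof -
  assume "PF (Suc n) F"
  then obtain P where P: "PFP n P" "\<And>t ls. length ls = n \<Longrightarrow> F (t # ls) = poly (P ls) t"
    using PF_PFP by blast
  then show ?thesis by (intro PFP_cong[OF P(1)] pfun_eqI) simp
qed

lemma poly_pfun_PF: "PF (Suc n) F \<Longrightarrow> length ls = n \<Longrightarrow> poly (pfun (\<lambda>t. F (t # ls))) t = F (t # ls)"
proof -
  assume "PF (Suc n) F" and l: "length ls = n"
  then obtain P where P: "\<And>t ls. length ls = n \<Longrightarrow> F (t # ls) = poly (P ls) t"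
    using PF_PFP by blast
  then have "(\<lambda>t. F (t # ls)) = poly (P ls)" using l by auto
  then show ?thesis using P l by simp
qed

lemma poly_eq_infinite:
  fixes p q :: "'k::field_char_0 poly"
  assumes "infinite {t. poly p t = poly q t}"
  shows "p = q"
  using assms poly_roots_finite[of "p - q"] by (auto simp: algebra_simps)

lemma poly_eq_of_nat:
  fixes p q :: "'k::field_char_0 poly"
  assumes "\<And>m. poly p (of_nat m) = poly q (of_nat m)"
  shows "p = q"
proof (rule poly_eq_infinite)
  have "range (of_nat :: nat \<Rightarrow> 'k) \<subseteq> {t. poly p t = poly q t}" using assms by auto
  moreover have "infinite (range (of_nat :: nat \<Rightarrow> 'k))"
    by (rule range_inj_infinite) (auto intro: injI)
  ultimately show "infinite {t. poly p t = poly q t}" by (rule infinite_super)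
qed

lemma poly_eq_off:
  fixes p q :: "'k::field_char_0 poly"
  assumes "finite A" "\<And>t. t \<notin> A \<Longrightarrow> poly p t = poly q t"
  shows "p = q"
proof (rule poly_eq_infinite)
  have "infinite (UNIV :: 'k set)" by (rule infinite_UNIV_char_0)
  then have "infinite (UNIV - A)" using assms(1) by simp
  moreover have "UNIV - A \<subseteq> {t. poly p t = poly q t}" using assms(2) by auto
  ultimately show "infinite {t. poly p t = poly q t}" using infinite_super by blast
qed

text \<open>In characteristic zero the natural numbers are infinitely many points, so variables can
  be stripped one by one. This is why a table of values at natural arguments loses nothing.\<close>

lemma PF_ext_nat:
  assumes "PF n F" "\<And>ns. length ns = n \<Longrightarrow> F (map of_nat ns) = 0" "length ys = n"
  shows "F ys = 0"
  using assms
proof (induction n arbitrary: F ys)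
  case 0
  then show ?case by (metis length_0_conv list.simps(8))
next
  case (Suc n)
  obtain P where P: "PFP n P" "\<And>t ls. length ls = n \<Longrightarrow> F (t # ls) = poly (P ls) t"
    using PF_PFP[OF Suc.prems(1)] by blast
  have "P (map of_nat ns) = 0" if "length ns = n" for ns
    by (rule poly_eq_of_nat) (use P(2)[of "map of_nat ns"] Suc.prems(2)[of "_ # ns"] that in simp)
  then have "coeff (P ls) i = 0" if "length ls = n" for ls i
    using Suc.IH[of "\<lambda>ls. coeff (P ls) i"] P(1) that by (simp add: PFP_def)
  then have "P ls = 0" if "length ls = n" for ls
    using that by (simp add: poly_eq_iff)
  then show ?case using P(2) Suc.prems(3) by (metis length_Suc_conv poly_0)
qed

lemma PF_eq_nat:
  assumes "PF n F" "PF n G" "\<And>ns. length ns = n \<Longrightarrow> F (map of_nat ns) = G (map of_nat ns)" "length ys = n"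
  shows "F ys = G ys"
  using PF_ext_nat[OF PF_diff[OF assms(1,2)] _ assms(4)] assms(3) by simp

lemma is_pfun_eq_off:
  assumes "is_pfun f" "is_pfun g" "finite A" "\<And>t. t \<notin> A \<Longrightarrow> f t = g t"
  shows "f t = g t"
proof -
  obtain p q where pq: "f = poly p" "g = poly q" using assms(1,2) by (auto simp: is_pfun_def)
  then have "p = q" using poly_eq_off[OF assms(3), of p q] assms(4) by auto
  then show ?thesis using pq by simp
qed

section \<open>Polynomial matrix units as test algebras\<close>

definition P3 :: "('k::field_char_0 \<Rightarrow> 'k \<Rightarrow> 'k \<Rightarrow> 'k) \<Rightarrow> bool" where
  "P3 f \<longleftrightarrow> PF 3 (\<lambda>ys. f (ys ! 0) (ys ! 1) (ys ! 2))"

text \<open>The test carriers in \<open>is_U3\<close> consist of functions on \<open>nat\<close>, so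
  a polynomial is stored as its values at natural triples, indexed through
  \<open>list_decode\<close>; codes of lists of other lengths get 0.\<close>

definition res3 :: "('k::field_char_0 \<Rightarrow> 'k \<Rightarrow> 'k \<Rightarrow> 'k) \<Rightarrow> nat \<Rightarrow> 'k" where
  "res3 f n = (let ns = map of_nat (list_decode n)
     in if length ns = 3 then f (ns ! 0) (ns ! 1) (ns ! 2) else 0)"

definition test_alg :: "(nat \<Rightarrow> 'k::field_char_0) set" where
  "test_alg = res3 ` Collect P3"

definition ev3 :: "(nat \<Rightarrow> 'k::field_char_0) \<Rightarrow> 'k \<Rightarrow> 'k \<Rightarrow> 'k \<Rightarrow> 'k" where
  "ev3 F = (SOME f. P3 f \<and> res3 f = F)"

lemma P3_PF:
  assumes "P3 f" "PF n a" "PF n b" "PF n c"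
  shows "PF n (\<lambda>ys. f (a ys) (b ys) (c ys))"
proof -
  have "PL n 3 (\<lambda>ys. [a ys, b ys, c ys])"
    unfolding numeral_3_eq_3 by (intro PL_Cons PL_Nil assms)
  from PF_PL[OF assms(1)[unfolded P3_def] this] show ?thesis by simp
qed

lemma res3_inj:
  assumes "P3 f" "P3 g" "res3 f = res3 g"
  shows "f = g"
proof (intro ext)
  fix d x z
  have "(\<lambda>ys. f (ys ! 0) (ys ! 1) (ys ! 2)) [d,x,z] = (\<lambda>ys. g (ys ! 0) (ys ! 1) (ys ! 2)) [d,x,z]"
  proof (rule PF_eq_nat[OF assms(1,2)[unfolded P3_def]])
    fix ns :: "nat list" assume l: "length ns = 3"
    have "res3 f (list_encode ns) = res3 g (list_encode ns)" using assms(3) by simp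
    then show "f (map of_nat ns ! 0) (map of_nat ns ! 1) (map of_nat ns ! 2) =
      g (map of_nat ns ! 0) (map of_nat ns ! 1) (map of_nat ns ! 2)"
      using l by (simp add: res3_def Let_def)
  qed simp
  then show "f d x z = g d x z" by simp
qed

lemma ev3_res3 [simp]: "P3 f \<Longrightarrow> ev3 (res3 f) = f"
  unfolding ev3_def by (rule some_equality) (auto intro: res3_inj)

lemma res3_test_alg [intro]: "P3 f \<Longrightarrow> res3 f \<in> test_alg"
  by (auto simp: test_alg_def)

lemma test_alg_P3: "F \<in> test_alg \<Longrightarrow> P3 (ev3 F)"
  by (auto simp: test_alg_def)

lemma P3_c: "P3 (\<lambda>d x z. c)" and P3_d: "P3 (\<lambda>d x z. d)" and P3_x: "P3 (\<lambda>d x z. x)" and P3_z: "P3 (\<lambda>d x z. z)"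
  by (simp_all add: P3_def PF_i)

lemma P3_add: "P3 f \<Longrightarrow> P3 g \<Longrightarrow> P3 (\<lambda>d x z. f d x z + g d x z)"
  and P3_diff: "P3 f \<Longrightarrow> P3 g \<Longrightarrow> P3 (\<lambda>d x z. f d x z - g d x z)"
  and P3_mult: "P3 f \<Longrightarrow> P3 g \<Longrightarrow> P3 (\<lambda>d x z. f d x z * g d x z)"
  by (simp_all add: P3_def PF_add PF_diff PF_mult)

lemmas P3_arith = P3_c P3_d P3_x P3_z P3_add P3_diff P3_mult

lemma res3_zero [simp]: "res3 (\<lambda>_ _ _. 0) = 0"
  by (auto simp: res3_def Let_def)

lemma res3_add: "res3 f + res3 g = res3 (\<lambda>d x z. f d x z + g d x z)"
  by (auto simp: res3_def Let_def)

lemma res3_diff: "res3 f - res3 g = res3 (\<lambda>d x z. f d x z - g d x z)"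
  by (auto simp: res3_def Let_def)

lemma res3_uminus: "- res3 f = res3 (\<lambda>d x z. - f d x z)"
  by (auto simp: res3_def Let_def)

lemma res3_scale: "(\<lambda>n. c * res3 f n) = res3 (\<lambda>d x z. c * f d x z)"
  by (auto simp: res3_def Let_def)

lemma res3_sum: "(\<Sum>i\<in>I. res3 (f i)) = res3 (\<lambda>d x z. \<Sum>i\<in>I. f i d x z)"
  by (induction I rule: infinite_finite_induct) (simp_all add: res3_add)

lemma test_alg_add: "F \<in> test_alg \<Longrightarrow> G \<in> test_alg \<Longrightarrow> F + G \<in> test_alg \<and> ev3 (F + G) = (\<lambda>d x z. ev3 F d x z + ev3 G d x z)"
  by (auto simp: test_alg_def res3_add P3_add)

lemma test_alg_scale: "F \<in> test_alg \<Longrightarrow> (\<lambda>n. c * F n) \<in> test_alg \<and> ev3 (\<lambda>n. c * F n) = (\<lambda>d x z. c * ev3 F d x z)"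
  by (auto simp: test_alg_def res3_scale P3_mult P3_c)

text \<open>An element is a family of polynomials \<open>f d x z\<close>, read as the entry of a matrix from
  \<open>x\<close> to \<open>z\<close> with \<open>\<partial> = x - z\<close>; the \<open>\<lambda>\<close>-product is the matrix product through the vertex
  \<open>x + \<lambda>\<close>, weighted by \<open>W\<close>. Only the values at natural arguments are stored, which embeds the
  algebra into \<open>nat \<Rightarrow> 'k\<close>.\<close>

definition tprod :: "'k::field_char_0 poly \<Rightarrow> ('k \<Rightarrow> 'k \<Rightarrow> 'k \<Rightarrow> 'k) \<Rightarrow> ('k \<Rightarrow> 'k \<Rightarrow> 'k \<Rightarrow> 'k)
    \<Rightarrow> 'k \<Rightarrow> 'k \<Rightarrow> 'k \<Rightarrow> 'k \<Rightarrow> 'k" where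
  "tprod W f g l d x z = f d x (x + l) * poly W (x + l) * g d (x + l) z"

definition tco :: "'k::field_char_0 poly \<Rightarrow> nat \<Rightarrow> ('k \<Rightarrow> 'k \<Rightarrow> 'k \<Rightarrow> 'k) \<Rightarrow> ('k \<Rightarrow> 'k \<Rightarrow> 'k \<Rightarrow> 'k)
    \<Rightarrow> 'k \<Rightarrow> 'k \<Rightarrow> 'k \<Rightarrow> 'k" where
  "tco W n f g d x z = fact n * coeff (pfun (\<lambda>l. tprod W f g l d x z)) n"

definition tpr :: "'k::field_char_0 poly \<Rightarrow> nat \<Rightarrow> (nat \<Rightarrow> 'k) \<Rightarrow> (nat \<Rightarrow> 'k) \<Rightarrow> nat \<Rightarrow> 'k" where
  "tpr W n F G = res3 (tco W n (ev3 F) (ev3 G))"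

definition tdd :: "(nat \<Rightarrow> 'k::field_char_0) \<Rightarrow> nat \<Rightarrow> 'k" where
  "tdd F = res3 (\<lambda>d x z. (x - z) * ev3 F d x z)"

lemma tprod_PF:
  assumes "P3 f" "P3 g" "PF n a" "PF n b" "PF n c" "PF n l"
  shows "PF n (\<lambda>ys. tprod W f g (l ys) (a ys) (b ys) (c ys))"
  unfolding tprod_def
  by (intro PF_mult P3_PF[OF assms(1)] P3_PF[OF assms(2)] PFP_poly PFP_const PF_add assms)

lemma P3_tprod: "P3 f \<Longrightarrow> P3 g \<Longrightarrow> P3 (tprod W f g l)"
  unfolding P3_def[of "tprod W f g l"] by (rule tprod_PF) (auto simp: PF_i)

lemma tprod_PFP:
  assumes "P3 f" "P3 g"
  shows "PFP 3 (\<lambda>ys. pfun (\<lambda>l. tprod W f g l (ys ! 0) (ys ! 1) (ys ! 2)))" (is "PFP 3 ?P")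
    and "poly (pfun (\<lambda>l. tprod W f g l d x z)) l = tprod W f g l d x z"
proof -
  have *: "PF (Suc 3) (\<lambda>ys. tprod W f g (ys ! 0) (ys ! 1) (ys ! 2) (ys ! 3))"
    by (rule tprod_PF[OF assms]) (auto intro: PF_i)
  from PFP_pfun[OF this] show "PFP 3 ?P" by (simp add: numeral_3_eq_3 numeral_2_eq_2)
  from poly_pfun_PF[OF *, of "[d, x, z]" l] show "poly (pfun (\<lambda>l. tprod W f g l d x z)) l = tprod W f g l d x z"
    by (simp add: numeral_3_eq_3 numeral_2_eq_2)
qed

lemma P3_tco: "P3 f \<Longrightarrow> P3 g \<Longrightarrow> P3 (tco W n f g)"
  using tprod_PFP(1)[of f g W] by (simp add: P3_def tco_def PFP_def PF_mult)

lemma tco_bound: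
  assumes "P3 f" "P3 g"
  obtains N where "\<And>n d x z. n > N \<Longrightarrow> tco W n f g d x z = 0"
    "\<And>d x z. degree (pfun (\<lambda>l. tprod W f g l d x z)) \<le> N"
proof -
  obtain N where N: "\<And>ys. length ys = 3 \<Longrightarrow> degree (pfun (\<lambda>l. tprod W f g l (ys ! 0) (ys ! 1) (ys ! 2))) \<le> N"
    using tprod_PFP(1)[OF assms, of W] by (auto simp: PFP_def)
  have D: "degree (pfun (\<lambda>l. tprod W f g l d x z)) \<le> N" for d x z
    using N[of "[d,x,z]"] by simp
  have "tco W n f g d x z = 0" if "n > N" for n d x z
    unfolding tco_def using coeff_eq_0[OF le_less_trans[OF D that]] by simp
  then show ?thesis using that D by blast
qed

lemma tco_sum:
  assumes "P3 f" "P3 g" "\<And>n. n > N \<Longrightarrow> tco W n f g d x z = 0"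
  shows "(\<Sum>n\<le>N. l ^ n / fact n * tco W n f g d x z) = tprod W f g l d x z"
proof -
  let ?p = "pfun (\<lambda>l. tprod W f g l d x z)"
  have "degree ?p \<le> N"
    using assms(3) by (intro degree_le) (auto simp: tco_def)
  then have "tprod W f g l d x z = (\<Sum>n\<le>N. coeff ?p n * l ^ n)"
    using tprod_PFP(2)[OF assms(1,2), of W d x z l] by (metis poly_altdef_le)
  then show ?thesis by (simp add: tco_def field_simps)
qed

lemma tco_lin:
  assumes "P3 f" "P3 g" "P3 h"
  shows "tco W n (\<lambda>d x z. f d x z + g d x z) h = (\<lambda>d x z. tco W n f h d x z + tco W n g h d x z)"
    "tco W n h (\<lambda>d x z. f d x z + g d x z) = (\<lambda>d x z. tco W n h f d x z + tco W n h g d x z)"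
    "tco W n (\<lambda>d x z. c * f d x z) h = (\<lambda>d x z. c * tco W n f h d x z)"
    "tco W n h (\<lambda>d x z. c * f d x z) = (\<lambda>d x z. c * tco W n h f d x z)"
proof -
  have 1: "pfun (\<lambda>l. tprod W (\<lambda>d x z. f d x z + g d x z) h l d x z)
    = pfun (\<lambda>l. tprod W f h l d x z) + pfun (\<lambda>l. tprod W g h l d x z)" for d x z
    by (rule pfun_eqI) (simp add: tprod_PFP(2) assms, simp add: tprod_def algebra_simps)
  have 2: "pfun (\<lambda>l. tprod W h (\<lambda>d x z. f d x z + g d x z) l d x z)
    = pfun (\<lambda>l. tprod W h f l d x z) + pfun (\<lambda>l. tprod W h g l d x z)" for d x z
    by (rule pfun_eqI) (simp add: tprod_PFP(2) assms, simp add: tprod_def algebra_simps)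
  have 3: "pfun (\<lambda>l. tprod W (\<lambda>d x z. c * f d x z) h l d x z)
    = smult c (pfun (\<lambda>l. tprod W f h l d x z))" for d x z
    by (rule pfun_eqI) (simp add: tprod_PFP(2) assms, simp add: tprod_def algebra_simps)
  have 4: "pfun (\<lambda>l. tprod W h (\<lambda>d x z. c * f d x z) l d x z)
    = smult c (pfun (\<lambda>l. tprod W h f l d x z))" for d x z
    by (rule pfun_eqI) (simp add: tprod_PFP(2) assms, simp add: tprod_def algebra_simps)
  show "tco W n (\<lambda>d x z. f d x z + g d x z) h = (\<lambda>d x z. tco W n f h d x z + tco W n g h d x z)"
    "tco W n h (\<lambda>d x z. f d x z + g d x z) = (\<lambda>d x z. tco W n h f d x z + tco W n h g d x z)"
    "tco W n (\<lambda>d x z. c * f d x z) h = (\<lambda>d x z. c * tco W n f h d x z)"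
    "tco W n h (\<lambda>d x z. c * f d x z) = (\<lambda>d x z. c * tco W n h f d x z)"
    unfolding tco_def 1 2 3 4 by (simp_all add: algebra_simps)
qed

lemma tpr_test_alg: "F \<in> test_alg \<Longrightarrow> G \<in> test_alg \<Longrightarrow> tpr W n F G \<in> test_alg"
  by (auto simp: tpr_def intro!: P3_tco test_alg_P3)

lemma tpr_finite:
  assumes "F \<in> test_alg" "G \<in> test_alg"
  shows "\<exists>N. \<forall>n>N. tpr W n F G = 0"
proof -
  obtain N where "\<And>n d x z. n > N \<Longrightarrow> tco W n (ev3 F) (ev3 G) d x z = 0"
    using tco_bound[OF test_alg_P3[OF assms(1)] test_alg_P3[OF assms(2)]] by metis
  then have "tco W n (ev3 F) (ev3 G) = (\<lambda>_ _ _. 0)" if "n > N" for n using that by (intro ext)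
  then have "\<forall>n>N. tpr W n F G = 0" by (simp add: tpr_def)
  then show ?thesis ..
qed

lemma lam_tpr:
  assumes "F \<in> test_alg" "G \<in> test_alg"
  shows "lam_ev (\<lambda>c f n. c * f n) (tpr W) F G l = res3 (tprod W (ev3 F) (ev3 G) l)"
proof -
  note P = test_alg_P3[OF assms(1)] test_alg_P3[OF assms(2)]
  obtain N where N: "\<And>n d x z. n > N \<Longrightarrow> tco W n (ev3 F) (ev3 G) d x z = 0"
    using tco_bound[OF P] by metis
  have "{n. tpr W n F G \<noteq> 0} \<subseteq> {..N}"
  proof
    fix n assume "n \<in> {n. tpr W n F G \<noteq> 0}"
    moreover have "tpr W n F G = 0" if "n > N"
      using N[OF that] unfolding tpr_def by (metis (no_types, lifting) ext res3_zero)
    ultimately show "n \<in> {..N}" by (cases "n > N") auto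
  qed
  then have "lam_ev (\<lambda>c f n. c * f n) (tpr W) F G l = (\<Sum>n\<le>N. (\<lambda>k. l ^ n / fact n * tpr W n F G k))"
    unfolding lam_ev_def by (intro sum.mono_neutral_left) auto
  also have "\<dots> = (\<Sum>n\<le>N. res3 (\<lambda>d x z. l ^ n / fact n * tco W n (ev3 F) (ev3 G) d x z))"
    unfolding tpr_def res3_scale ..
  also have "\<dots> = res3 (tprod W (ev3 F) (ev3 G) l)"
    unfolding res3_sum using tco_sum[OF P N] by (intro arg_cong[where f = res3] ext) auto
  finally show ?thesis .
qed

lemma tdd_test_alg: "F \<in> test_alg \<Longrightarrow> tdd F \<in> test_alg" and ev3_tdd: "F \<in> test_alg \<Longrightarrow> ev3 (tdd F) = (\<lambda>d x z. (x - z) * ev3 F d x z)"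
  by (auto simp: tdd_def intro!: res3_test_alg P3_mult P3_diff P3_x P3_z test_alg_P3 ev3_res3)

text \<open>Both bracketings are the sum-free matrix product along the path \<open>x\<close>,
  \<open>x + l\<close>, \<open>x + l + m\<close>, \<open>z\<close>. For sesquilinearity,
  \<open>\<partial>\<close> on the left entry is \<open>x - (x + l) = - l\<close>, and on the right
  entry it is \<open>x + l - z = (x - z) + l\<close>.\<close>

lemma assoc_conf_alg_test_alg: "assoc_conf_alg test_alg (\<lambda>c (f::nat \<Rightarrow> 'k::field_char_0) n. c * f n) tdd (tpr W)"
proof -
  have z: "0 \<in> (test_alg :: (nat \<Rightarrow> 'k) set)" using res3_test_alg[OF P3_c[of 0]] by simp
  have fin: "finite {n. tpr W n F G \<noteq> 0}" if FG: "F \<in> test_alg" "G \<in> test_alg" for F G :: "nat \<Rightarrow> 'k"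
  proof -
    obtain N where "\<forall>n>N. tpr W n F G = 0" using tpr_finite[OF FG, of W] by blast
    then have "{n. tpr W n F G \<noteq> 0} \<subseteq> {..N}" by (auto simp: not_less[symmetric])
    then show ?thesis by (rule finite_subset) simp
  qed
  have lin: "tpr W n (F + G) H = tpr W n F H + tpr W n G H" "tpr W n H (F + G) = tpr W n H F + tpr W n H G"
    "tpr W n (\<lambda>k. c * F k) H = (\<lambda>k. c * tpr W n F H k)" "tpr W n H (\<lambda>k. c * F k) = (\<lambda>k. c * tpr W n H F k)"
    if "F \<in> test_alg" "G \<in> test_alg" "H \<in> test_alg" for F G H :: "nat \<Rightarrow> 'k" and n c
    using that tco_lin[OF test_alg_P3 test_alg_P3 test_alg_P3, of F G H]
    by (simp_all add: tpr_def test_alg_add test_alg_scale res3_add res3_scale)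
  have dd: "tdd (F + G) = tdd F + tdd G" "tdd (\<lambda>k. c * F k) = (\<lambda>k. c * tdd F k)"
    if "F \<in> test_alg" "G \<in> test_alg" for F G :: "nat \<Rightarrow> 'k" and c
    using that by (simp_all add: tdd_def test_alg_add test_alg_scale res3_add res3_scale algebra_simps)
  have Pt: "P3 (tprod W (ev3 F) (ev3 G) l)" if "F \<in> test_alg" "G \<in> test_alg" for F G :: "nat \<Rightarrow> 'k" and l
    by (intro P3_tprod test_alg_P3 that)
  have sesq1: "lam_ev (\<lambda>c f n. c * f n) (tpr W) (tdd F) G l = - (\<lambda>n. l * lam_ev (\<lambda>c f n. c * f n) (tpr W) F G l n)"
    if "F \<in> test_alg" "G \<in> test_alg" for F G :: "nat \<Rightarrow> 'k" and l
    using that by (simp add: lam_tpr tdd_test_alg ev3_tdd res3_scale res3_uminus)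
      (intro arg_cong[where f = res3] ext, simp add: tprod_def)
  have sesq2: "lam_ev (\<lambda>c f n. c * f n) (tpr W) F (tdd G) l = tdd (lam_ev (\<lambda>c f n. c * f n) (tpr W) F G l)
      + (\<lambda>n. l * lam_ev (\<lambda>c f n. c * f n) (tpr W) F G l n)"
    if "F \<in> test_alg" "G \<in> test_alg" for F G :: "nat \<Rightarrow> 'k" and l
    using that Pt[OF that] by (simp add: lam_tpr tdd_test_alg ev3_tdd res3_scale tdd_def[of "res3 _"] res3_add)
      (intro arg_cong[where f = res3] ext, simp add: tprod_def algebra_simps)
  have ass: "lam_ev (\<lambda>c f n. c * f n) (tpr W) F (lam_ev (\<lambda>c f n. c * f n) (tpr W) G H m) l
     = lam_ev (\<lambda>c f n. c * f n) (tpr W) (lam_ev (\<lambda>c f n. c * f n) (tpr W) F G l) H (l + m)"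
    if "F \<in> test_alg" "G \<in> test_alg" "H \<in> test_alg" for F G H :: "nat \<Rightarrow> 'k" and l m
    using that Pt[OF that(1,2)] Pt[OF that(2,3)] by (simp add: lam_tpr res3_test_alg)
      (intro arg_cong[where f = res3] ext, simp add: tprod_def algebra_simps)
  show ?thesis unfolding assoc_conf_alg_def
    by (intro conjI ballI allI z fin lin dd tdd_test_alg tpr_test_alg sesq1 sesq2 ass)
      (auto simp: test_alg_add test_alg_scale)
qed

text \<open>With \<open>w = x (1 - d) + z d\<close> the product is
  \<open>(x + l d) (w + l (1 - d))\<close>. Its \<open>l^2\<close> coefficient is
  \<open>d (1 - d)\<close> and its \<open>l\<close> coefficient is
  \<open>w + (x - z) d (1 - d)\<close>, which is the defining relation.\<close>

lemma U3_rel_test_alg_1: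
  "U3_rel (\<lambda>c (f::nat \<Rightarrow> 'k::field_char_0) n. c * f n) tdd (tpr 1) (res3 (\<lambda>d x z. x * (1 - d) + z * d))"
proof -
  let ?w = "\<lambda>d x z::'k. x * (1 - d) + z * d"
  have P: "P3 ?w" by (intro P3_arith)
  have "pfun (\<lambda>l. tprod 1 ?w ?w l d x z) = [:x, d:] * [:x * (1 - d) + z * d, 1 - d:]" for d x z
    by (rule pfun_eqI) (simp add: tprod_def algebra_simps)
  then have co: "tco 1 n ?w ?w = (\<lambda>d x z. fact n * coeff ([:x, d:] * [:x * (1 - d) + z * d, 1 - d:]) n)" for n
    by (intro ext) (simp only: tco_def)
  have P2: "P3 (\<lambda>d x z. d * (1 - d) :: 'k)" by (intro P3_arith)
  show ?thesis unfolding U3_rel_def tpr_def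
  proof (intro conjI allI impI)
    fix n :: nat assume "3 \<le> n"
    then have "coeff ([:x, d:] * [:x * (1 - d) + z * d, 1 - d:]) n = 0" for d x z :: 'k
      by (intro coeff_eq_0 le_less_trans[OF degree_mult_le]) (simp add: degree_pCons_eq_if)
    then show "res3 (tco 1 n (ev3 (res3 ?w)) (ev3 (res3 ?w))) = 0" by (simp add: P co)
  next
    have c2: "tco 1 2 ?w ?w = (\<lambda>d x z. 2 * (d * (1 - d)))"
      by (simp add: co fun_eq_iff coeff_pCons numeral_2_eq_2)
    have P2': "P3 (\<lambda>d x z. 2 * (d * (1 - d)) :: 'k)" by (intro P3_arith)
    show "(\<lambda>n. 2 * res3 (tco 1 1 (ev3 (res3 ?w)) (ev3 (res3 ?w))) n) -
      tdd (res3 (tco 1 2 (ev3 (res3 ?w)) (ev3 (res3 ?w)))) = (\<lambda>n. 2 * res3 ?w n)"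
      unfolding ev3_res3[OF P] c2 unfolding tdd_def ev3_res3[OF P2'] res3_scale res3_diff
      by (intro arg_cong[where f = res3] ext, unfold co) (simp add: coeff_pCons algebra_simps)
  qed
qed

text \<open>For the constant entry 1 the product is the bare weight \<open>x + l\<close>: the second
  product of the generator with itself is 0 and the first is the generator.\<close>

lemma U3_rel_test_alg_X:
  "U3_rel (\<lambda>c (f::nat \<Rightarrow> 'k::field_char_0) n. c * f n) tdd (tpr [:0, 1:]) (res3 (\<lambda>d x z. 1))"
proof -
  have P: "P3 (\<lambda>d x z::'k. 1::'k)" by (intro P3_arith)
  have P0: "P3 (\<lambda>d x z::'k. 0::'k)" by (intro P3_arith)
  have "pfun (\<lambda>l. tprod [:0, 1:] (\<lambda>d x z. 1) (\<lambda>d x z. 1) l d x z) = [:x, 1:]" for d x z :: 'k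
    by (rule pfun_eqI) (simp add: tprod_def)
  then have co: "tco [:0, 1:] n (\<lambda>d x z. 1) (\<lambda>d x z. 1) = (\<lambda>d x z::'k. fact n * coeff [:x, 1:] n)" for n
    by (intro ext) (simp only: tco_def)
  show ?thesis unfolding U3_rel_def tpr_def
  proof (intro conjI allI impI)
    fix n :: nat assume "3 \<le> n"
    then have "coeff [:x, 1:] n = 0" for x :: 'k
      by (intro coeff_eq_0) simp
    then show "res3 (tco [:0, 1:] n (ev3 (res3 (\<lambda>d x z. 1))) (ev3 (res3 (\<lambda>d x z. 1::'k)))) = 0"
      by (simp only: ev3_res3[OF P] co) simp
  next
    have c2: "tco [:0, 1:] 2 (\<lambda>d x z. 1) (\<lambda>d x z. 1) = (\<lambda>d x z::'k. 0)"
      by (simp add: co fun_eq_iff coeff_pCons numeral_2_eq_2)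
    show "(\<lambda>n. 2 * res3 (tco [:0, 1:] 1 (ev3 (res3 (\<lambda>d x z. 1))) (ev3 (res3 (\<lambda>d x z. 1::'k)))) n) -
      tdd (res3 (tco [:0, 1:] 2 (ev3 (res3 (\<lambda>d x z. 1))) (ev3 (res3 (\<lambda>d x z. 1))))) = (\<lambda>n. 2 * res3 (\<lambda>d x z. 1) n)"
      unfolding ev3_res3[OF P] c2 unfolding tdd_def ev3_res3[OF P0] res3_scale res3_diff
      by (intro arg_cong[where f = res3] ext) (simp add: co coeff_pCons)
  qed
qed

section \<open>The structure of U(3)\<close>

locale u3 =
  fixes sc :: "'k::field_char_0 \<Rightarrow> 'a \<Rightarrow> 'a::ab_group_add"
    and dd :: "'a \<Rightarrow> 'a" and pr :: "nat \<Rightarrow> 'a \<Rightarrow> 'a \<Rightarrow> 'a" and v :: 'a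
  assumes U3: "is_U3 sc dd pr v"
begin

sublocale vs: vector_space sc
  using U3 by (simp add: is_U3_def)

definition mul :: "'k \<Rightarrow> 'a \<Rightarrow> 'a \<Rightarrow> 'a" where
  "mul l a b = lam_ev sc pr a b l"

lemma conf_alg: "assoc_conf_alg UNIV sc dd pr"
  using U3 by (simp add: is_U3_def)

lemma dd_add [simp]: "dd (a + b) = dd a + dd b" and dd_sc [simp]: "dd (sc c a) = sc c (dd a)"
  using conf_alg by (simp_all add: assoc_conf_alg_def)

lemma pr_add: "pr n (a + b) c = pr n a c + pr n b c" "pr n c (a + b) = pr n c a + pr n c b"
  and pr_sc: "pr n (sc k a) b = sc k (pr n a b)" "pr n a (sc k b) = sc k (pr n a b)"
  and pr_fin: "finite {n. pr n a b \<noteq> 0}"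
  using conf_alg by (simp_all add: assoc_conf_alg_def)

lemma mul_dd_left: "mul l (dd a) b = - sc l (mul l a b)"
  and mul_dd_right: "mul l a (dd b) = dd (mul l a b) + sc l (mul l a b)"
  and mul_assoc: "mul l a (mul m b c) = mul (l + m) (mul l a b) c"
  using conf_alg by (simp_all add: assoc_conf_alg_def mul_def)

lemma dd_0 [simp]: "dd 0 = 0"
  using dd_sc[of 0 0] by simp

lemma mul_sum: "finite S \<Longrightarrow> {n. pr n a b \<noteq> 0} \<subseteq> S \<Longrightarrow> mul l a b = (\<Sum>n\<in>S. sc (l ^ n / fact n) (pr n a b))"
  unfolding mul_def lam_ev_def by (rule sum.mono_neutral_left) auto

lemma mul_add_left: "mul l (a + b) c = mul l a c + mul l b c"
proof -
  let ?S = "{n. pr n a c \<noteq> 0} \<union> {n. pr n b c \<noteq> 0}"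
  have "finite ?S" using pr_fin by simp
  moreover have "{n. pr n (a + b) c \<noteq> 0} \<subseteq> ?S" by (auto simp: pr_add)
  ultimately show ?thesis
    by (simp add: mul_sum[of ?S] pr_add vs.scale_right_distrib sum.distrib)
qed

lemma mul_add_right: "mul l c (a + b) = mul l c a + mul l c b"
proof -
  let ?S = "{n. pr n c a \<noteq> 0} \<union> {n. pr n c b \<noteq> 0}"
  have "finite ?S" using pr_fin by simp
  moreover have "{n. pr n c (a + b) \<noteq> 0} \<subseteq> ?S" by (auto simp: pr_add)
  ultimately show ?thesis
    by (simp add: mul_sum[of ?S] pr_add vs.scale_right_distrib sum.distrib)
qed

lemma mul_sc_left: "mul l (sc k a) b = sc k (mul l a b)"
proof -
  let ?S = "{n. pr n a b \<noteq> 0}"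
  have "{n. pr n (sc k a) b \<noteq> 0} \<subseteq> ?S" by (auto simp: pr_sc)
  then show ?thesis
    by (simp add: mul_sum[of ?S] pr_fin pr_sc vs.scale_sum_right mult.commute)
qed

lemma mul_sc_right: "mul l a (sc k b) = sc k (mul l a b)"
proof -
  let ?S = "{n. pr n a b \<noteq> 0}"
  have "{n. pr n a (sc k b) \<noteq> 0} \<subseteq> ?S" by (auto simp: pr_sc)
  then show ?thesis
    by (simp add: mul_sum[of ?S] pr_fin pr_sc vs.scale_sum_right mult.commute)
qed

lemma mul_0 [simp]: "mul l 0 b = 0" "mul l a 0 = 0"
  using mul_sc_left[of l 0 0 b] mul_sc_right[of l a 0 0] by simp_all

lemma mul_diff_right: "mul l c (a - b) = mul l c a - mul l c b"
  using mul_add_right[of l c "a - b" b] by (simp add: algebra_simps)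

lemma mul_at_0: "mul 0 a b = pr 0 a b"
proof -
  have "finite (insert 0 {n. pr n a b \<noteq> 0})" by (simp add: pr_fin)
  then have "mul 0 a b = (\<Sum>n\<in>insert 0 {n. pr n a b \<noteq> 0}. sc (0 ^ n / fact n) (pr n a b))"
    by (rule mul_sum) auto
  also have "\<dots> = (\<Sum>n\<in>{0}. sc (0 ^ n / fact n) (pr n a b))"
    by (rule sum.mono_neutral_right) (auto simp: pr_fin)
  finally show ?thesis by simp
qed

text \<open>In both evaluations constructed below this operator becomes multiplication by the first
  vertex \<open>x\<close>.\<close>

definition X :: "'a \<Rightarrow> 'a" where "X a = mul 0 v a"

text \<open>\<open>mul l v (E j)\<close> turns out to be affine in \<open>l\<close> with constant
  term \<open>X (E j)\<close>; the difference of its values at 1 and 0 then isolates the linear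
  coefficient.\<close>

primrec E :: "nat \<Rightarrow> 'a" where
  "E 0 = sc (1 / 2) (pr 2 v v)"
| "E (Suc j) = mul 1 v (E j) - X (E j)"

declare E.simps [simp del]

lemma X_add [simp]: "X (a + b) = X a + X b" and X_sc [simp]: "X (sc c a) = sc c (X a)"
  and X_diff [simp]: "X (a - b) = X a - X b" and X_dd: "X (dd a) = dd (X a)" and X_0 [simp]: "X 0 = 0"
  by (simp_all add: X_def mul_add_right mul_sc_right mul_diff_right mul_dd_right)

lemma mul_X_left: "mul l (X a) b = X (mul l a b)"
  by (simp add: X_def mul_assoc)

lemma mul_vv: "mul l v v = X v + sc l (v + dd (E 0)) + sc (l ^ 2) (E 0)"
proof -
  have rel: "\<forall>n\<ge>3. pr n v v = 0" "sc 2 (pr 1 v v) - dd (pr 2 v v) = sc 2 v"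
    using U3 by (simp_all add: is_U3_def U3_rel_def)
  have "{n. pr n v v \<noteq> 0} \<subseteq> {..<3}" using rel(1) by (auto simp: not_le[symmetric])
  then have "mul l v v = (\<Sum>n<3. sc (l ^ n / fact n) (pr n v v))" by (rule mul_sum[rotated]) simp
  also have "\<dots> = pr 0 v v + sc l (pr 1 v v) + sc (l ^ 2 / 2) (pr 2 v v)"
    by (simp add: numeral_3_eq_3 numeral_2_eq_2)
  also have "pr 1 v v = v + dd (E 0)"
  proof -
    have "sc 2 (pr 1 v v) = sc 2 v + dd (pr 2 v v)" using rel(2) by (simp add: algebra_simps)
    then have "sc (1/2) (sc 2 (pr 1 v v)) = sc (1/2) (sc 2 v + dd (pr 2 v v))" by simp
    then show ?thesis by (simp add: vs.scale_right_distrib E.simps(1))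
  qed
  also have "sc (l ^ 2 / 2) (pr 2 v v) = sc (l ^ 2) (E 0)" by (simp add: E.simps(1))
  finally show ?thesis by (simp add: X_def mul_at_0)
qed

text \<open>On the left of a product with parameter \<open>l + m\<close>, \<open>dd\<close> becomes
  \<open>- (l + m)\<close>; together with the term \<open>l^2\<close> this leaves only
  \<open>- l * m\<close> in front of \<open>E 0\<close>.\<close>

lemma mul_vv_left: "mul (l + m) (mul l v v) a = X (mul (l + m) v a) + sc l (mul (l + m) v a)
    - sc (l * m) (mul (l + m) (E 0) a)"
  by (simp add: mul_vv mul_add_left mul_sc_left mul_dd_left mul_X_left vs.scale_right_distrib
      vs.scale_right_diff_distrib vs.scale_left_distrib algebra_simps power2_eq_square)

lemma mul_v_X: "mul l v (X a) = X (mul l v a) + sc l (mul l v a)"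
  using mul_vv_left[of l 0 a] mul_assoc[of l v 0 v a] by (simp add: X_def)

lemma scale_expand: "sc (a * b) x = sc a (sc b x)" "sc (a ^ 2) x = sc a (sc a x)"
  by (simp_all add: power2_eq_square)

lemmas scale_normalize = scale_expand vs.scale_left_commute vs.scale_right_distrib
  vs.scale_right_diff_distrib vs.scale_left_distrib vs.scale_left_diff_distrib

text \<open>Comparing coefficients of \<open>m\<close> in \<open>v\<^sub>l (v\<^sub>m v) = (v\<^sub>l v)\<^sub>l\<^sub>+\<^sub>m v\<close>.\<close>

lemma mul_vE_aux:
  assumes "m \<noteq> 0"
  shows "dd (mul l v (E 0)) + sc (l + m) (mul l v (E 0)) + sc l (mul (l + m) (E 0) v)
    = X (dd (E 0)) + sc l (X (E 0)) + sc (l + m) (X (E 0)) + sc (l * (l + m)) (E 0)"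
proof -
  have "mul l v (mul m v v) = mul (l + m) (mul l v v) v" by (rule mul_assoc)
  then have "sc m (dd (mul l v (E 0)) + sc (l + m) (mul l v (E 0)) + sc l (mul (l + m) (E 0) v))
    = sc m (X (dd (E 0)) + sc l (X (E 0)) + sc (l + m) (X (E 0)) + sc (l * (l + m)) (E 0))"
    unfolding mul_vv_left unfolding mul_vv
    by (simp add: mul_add_right mul_sc_right mul_dd_right mul_v_X mul_vv X_dd scale_normalize
        algebra_simps del: vs.scale_scale vs.scale_cancel_left)
  then show ?thesis using assms by simp
qed

lemma dd_shift_eq:
  assumes "dd a + sc s a = dd b + sc s b" "dd a + sc t a = dd b + sc t b" "s \<noteq> t"
  shows "a = b"
proof -
  have "(dd a + sc s a) - (dd a + sc t a) = (dd b + sc s b) - (dd b + sc t b)" using assms(1,2) by simp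
  then have "sc (s - t) a = sc (s - t) b" by (simp add: vs.scale_left_diff_distrib)
  then show ?thesis using assms(3) by simp
qed

text \<open>\<open>Y l\<close> is the difference quotient of \<open>mul l v (E 0)\<close> at 0. In
  the identity from associativity, written with the total parameter \<open>m\<close>, only
  \<open>dd (Y l) + sc m (Y l)\<close> still involves \<open>l\<close>. Two values of
  \<open>m\<close> then force \<open>Y l\<close> to be constant.\<close>

lemma mul_vE0: "mul l v (E 0) = X (E 0) + sc l (E 1)"
  and mul_E0_v: "mul m (E 0) v = X (E 0) + sc m (E 0) - (dd (E 1) + sc m (E 1))"
proof -
  define Y where "Y l = sc (1 / l) (mul l v (E 0) - X (E 0))" for l
  have Y: "mul l v (E 0) = X (E 0) + sc l (Y l)" if "l \<noteq> 0" for l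
    using that by (simp add: Y_def)
  have eq: "dd (Y l) + sc m (Y l) + mul m (E 0) v = X (E 0) + sc m (E 0)" if "l \<noteq> 0" "m \<noteq> l" for l m
  proof -
    have "sc l (dd (Y l) + sc m (Y l) + mul m (E 0) v) = sc l (X (E 0) + sc m (E 0))"
      using mul_vE_aux[of "m - l" l] that unfolding Y[OF that(1)]
      by (simp add: X_dd scale_normalize algebra_simps del: vs.scale_scale vs.scale_cancel_left)
    then show ?thesis using that by simp
  qed
  have Y1: "Y l = Y 1" if "l \<noteq> 0" for l
  proof -
    obtain s where s: "s \<notin> {1, l}" using ex_new_if_finite[OF infinite_UNIV_char_0, of "{1, l}"] by auto
    obtain t where t: "t \<notin> {1, l, s}" using ex_new_if_finite[OF infinite_UNIV_char_0, of "{1, l, s}"] by auto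
    have Q: "dd (Y l) + sc m (Y l) = dd (Y 1) + sc m (Y 1)" if "m \<notin> {1, l}" for m
    proof -
      have n: "l \<noteq> 0" "m \<noteq> l" "1 \<noteq> (0::'k)" "m \<noteq> 1" using that \<open>l \<noteq> 0\<close> by simp_all
      have "dd (Y l) + sc m (Y l) + mul m (E 0) v = dd (Y 1) + sc m (Y 1) + mul m (E 0) v"
        using eq[OF n(1,2)] eq[OF n(3,4)] by (rule trans[OF _ sym])
      then show ?thesis by (rule add_right_imp_eq)
    qed
    have st: "s \<notin> {1, l}" "t \<notin> {1, l}" "s \<noteq> t" using s t by auto
    show ?thesis by (rule dd_shift_eq[OF Q[OF st(1)] Q[OF st(2)] st(3)])
  qed
  have E1: "E 1 = Y 1" by (simp add: E.simps Y_def)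
  show *: "mul l v (E 0) = X (E 0) + sc l (E 1)" for l
    using Y[of l] Y1[of l] E1 by (cases "l = 0") (simp_all add: X_def)
  obtain l where "l \<noteq> 0" "m \<noteq> l" using ex_new_if_finite[OF infinite_UNIV_char_0, of "{0, m}"] by auto
  then have "dd (E 1) + sc m (E 1) + mul m (E 0) v = X (E 0) + sc m (E 0)"
    using eq[of l m] Y1[of l] E1 by simp
  then show "mul m (E 0) v = X (E 0) + sc m (E 0) - (dd (E 1) + sc m (E 1))"
    by (simp add: algebra_simps)
qed

text \<open>Associativity for \<open>v\<close>, \<open>v\<close>, \<open>a\<close>, divided by
  \<open>m\<close>, expresses \<open>mul l v a'\<close> through \<open>mul (l + m) (E 0) a\<close>.
  The left side is free of \<open>m\<close>, hence so is that product, and the affine form passes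
  from \<open>a\<close> to \<open>a'\<close>.\<close>

lemma mul_vE_step:
  assumes a: "\<And>l. mul l v a = X a + sc l a'"
  shows "\<exists>b. (\<forall>m. mul m (E 0) a = b) \<and> (\<forall>l. mul l v a' = X a' + sc l (a' - b))"
proof -
  have *: "mul l v a' = X a' + sc l (a' - mul (l + m) (E 0) a)" if "m \<noteq> 0" for l m
  proof -
    have "mul l v (mul m v a) = mul (l + m) (mul l v v) a" by (rule mul_assoc)
    then have "sc m (mul l v a') = sc m (X a' + sc l (a' - mul (l + m) (E 0) a))"
      unfolding mul_vv_left
      by (simp add: a mul_add_right mul_sc_right mul_v_X scale_normalize
        algebra_simps del: vs.scale_scale vs.scale_cancel_left)
    then show ?thesis using that by simp
  qed
  have eq: "mul s (E 0) a = mul t (E 0) a" if "l \<noteq> 0" "s \<noteq> l" "t \<noteq> l" for l s t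
    using *[of "s - l" l] *[of "t - l" l] that by simp
  have "mul m (E 0) a = mul 0 (E 0) a" for m
    using eq[of 1 m 0] eq[of "-1" m 0] by (cases "m = 1") auto
  moreover have "mul l v a' = X a' + sc l (a' - mul 0 (E 0) a)" for l
    using *[of 1 l] calculation[of "l + 1"] by simp
  ultimately show ?thesis by blast
qed

lemma mul_vE: "mul l v (E j) = X (E j) + sc l (E (Suc j))"
proof -
  have "\<forall>l. mul l v (E j) = X (E j) + sc l (E (Suc j))"
  proof (induction j)
    case 0 show ?case using mul_vE0 by simp
  next
    case (Suc j)
    then obtain b where b: "\<And>l. mul l v (E (Suc j)) = X (E (Suc j)) + sc l (E (Suc j) - b)"
      using mul_vE_step by blast
    from b[of 1] have "E (Suc (Suc j)) = E (Suc j) - b" by (simp add: E.simps(2)[of "Suc j"])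
    then show ?case using b by simp
  qed
  then show ?thesis by blast
qed

lemma mul_E0_E: "mul m (E 0) (E j) = mul 0 (E 0) (E j)"
  using mul_vE_step[of "E j" "E (Suc j)"] mul_vE by metis

text \<open>Subtracting \<open>2^(N+1)\<close> times the value at \<open>l\<close> from the value at
  \<open>2 l\<close> removes the top coefficient and multiplies the others by nonzero
  constants.\<close>

lemma coeffs_in_subspace:
  assumes V: "vs.subspace V" and P: "\<And>l. (\<Sum>n\<le>N. sc (l ^ n) (c n)) \<in> V" and n: "n \<le> N"
  shows "c n \<in> V"
  using P n
proof (induction N arbitrary: c n)
  case 0
  then show ?case using "0.prems"(1)[of 1] by simp
next
  case (Suc N)
  define c' where "c' n = sc (2 ^ n - 2 ^ Suc N) (c n)" for n
  have "(\<Sum>n\<le>N. sc (l ^ n) (c' n)) \<in> V" for l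
  proof -
    have "(\<Sum>n\<le>Suc N. sc ((2 * l) ^ n) (c n)) - sc (2 ^ Suc N) (\<Sum>n\<le>Suc N. sc (l ^ n) (c n)) \<in> V"
      by (intro vs.subspace_diff[OF V] vs.subspace_scale[OF V] Suc.prems)
    moreover have "(\<Sum>n\<le>Suc N. sc ((2 * l) ^ n) (c n)) - sc (2 ^ Suc N) (\<Sum>n\<le>Suc N. sc (l ^ n) (c n))
       = (\<Sum>n\<le>N. sc (l ^ n) (c' n))"
      unfolding vs.scale_sum_right sum_subtractf[symmetric]
      by (simp add: c'_def power_mult_distrib vs.scale_left_diff_distrib vs.scale_right_diff_distrib algebra_simps)
    ultimately show ?thesis by simp
  qed
  then have c': "c' n \<in> V" if "n \<le> N" for n using Suc.IH that by blast
  have le: "c n \<in> V" if "n \<le> N" for n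
  proof -
    \<comment> \<open>The field carries no order, so the powers of 2 are compared as integers and
      transported by \<open>of_int\<close>.\<close>
    have "(2::int) ^ n < 2 ^ Suc N" using that by (intro power_strict_increasing) auto
    then have "of_int (2 ^ n - 2 ^ Suc N) \<noteq> (0::'k)" by (simp only: of_int_eq_0_iff)
    moreover have "of_int (2 ^ n - 2 ^ Suc N) = (2::'k) ^ n - 2 ^ Suc N" by simp
    ultimately have "c n = sc (1 / (2 ^ n - 2 ^ Suc N)) (c' n)" by (simp add: c'_def)
    then show ?thesis using vs.subspace_scale[OF V c'[OF that]] by metis
  qed
  have "(\<Sum>n\<le>Suc N. sc (1 ^ n) (c n)) - (\<Sum>n\<le>N. sc (1 ^ n) (c n)) \<in> V"
    by (intro vs.subspace_diff[OF V] vs.subspace_sum[OF V] vs.subspace_scale[OF V] Suc.prems le) auto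
  then have "c (Suc N) \<in> V" by simp
  then show ?case using le Suc.prems(2) by (cases "n = Suc N") auto
qed

lemma mul_sum_atMost:
  obtains N where "\<And>l. mul l a b = (\<Sum>n\<le>N. sc (l ^ n) (sc (1 / fact n) (pr n a b)))" "\<And>n. n > N \<Longrightarrow> pr n a b = 0"
proof -
  obtain N where N: "{n. pr n a b \<noteq> 0} \<subseteq> {..N}"
    using pr_fin[of a b] by (metis finite_nat_iff_bounded_le)
  then have "mul l a b = (\<Sum>n\<le>N. sc (l ^ n) (sc (1 / fact n) (pr n a b)))" for l
    by (subst mul_sum[of "{..N}"]) simp_all
  moreover have "pr n a b = 0" if "n > N" for n using N that by force
  ultimately show ?thesis using that by blast
qed

lemma pr_in_subspace:
  assumes "vs.subspace V" "\<And>l. mul l a b \<in> V"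
  shows "pr n a b \<in> V"
proof -
  obtain N where N: "\<And>l. mul l a b = (\<Sum>n\<le>N. sc (l ^ n) (sc (1 / fact n) (pr n a b)))" "\<And>n. n > N \<Longrightarrow> pr n a b = 0"
    by (rule mul_sum_atMost[of a b], rule that)
  show ?thesis
  proof (cases "n \<le> N")
    case True
    have "(\<Sum>n\<le>N. sc (l ^ n) (sc (1 / fact n) (pr n a b))) \<in> V" for l using assms(2)[of l] by (simp only: N(1))
    from coeffs_in_subspace[OF assms(1) this True] have "sc (fact n) (sc (1 / fact n) (pr n a b)) \<in> V"
      by (rule vs.subspace_scale[OF assms(1)])
    then show ?thesis by simp
  next
    case False
    then show ?thesis using N(2) vs.subspace_0[OF assms(1)] by simp
  qed
qed

section \<open>Normal forms: every element arises from \<open>v\<close> and the \<open>E j\<close>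
  by \<open>X\<close>, \<open>dd\<close> and linear operations\<close>

inductive_set nf :: "'a set" where
  nf_v: "v \<in> nf"
| nf_E: "E j \<in> nf"
| nf_X: "a \<in> nf \<Longrightarrow> X a \<in> nf"
| nf_dd: "a \<in> nf \<Longrightarrow> dd a \<in> nf"
| nf_add: "a \<in> nf \<Longrightarrow> b \<in> nf \<Longrightarrow> a + b \<in> nf"
| nf_sc: "a \<in> nf \<Longrightarrow> sc c a \<in> nf"

lemma nf_subspace: "vs.subspace nf"
  using nf_sc[OF nf_v, of 0] by (auto simp: vs.subspace_def intro: nf_add nf_sc)

lemma mul_v_nf: "a \<in> nf \<Longrightarrow> mul l v a \<in> nf"
proof (induction rule: nf.induct)
  case nf_v
  then show ?case unfolding mul_vv by (intro nf.intros)
next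
  case (nf_E j)
  then show ?case unfolding mul_vE by (intro nf.intros)
next
  case (nf_X a)
  then show ?case unfolding mul_v_X by (intro nf.intros)
next
  case (nf_dd a)
  then show ?case unfolding mul_dd_right by (intro nf.intros)
next
  case (nf_add a b)
  then show ?case unfolding mul_add_right by (intro nf.intros)
next
  case (nf_sc a c)
  then show ?case unfolding mul_sc_right by (intro nf.intros)
qed

text \<open>The right factor ranges over all normal forms, so that a product on the left can be
  resolved by associativity: \<open>x\<close> acts on the result of \<open>y\<close> acting on
  \<open>c\<close>. Passing from the product at all scalars to a single n-product uses
  \<open>pr_in_subspace\<close>.\<close>

lemma mul_generated_nf: "a \<in> generated sc dd pr v \<Longrightarrow> c \<in> nf \<Longrightarrow> mul l a c \<in> nf"
proof (induction arbitrary: c l rule: generated.induct)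
  case gen_v
  then show ?case by (rule mul_v_nf)
next
  case gen_0
  then show ?case using vs.subspace_0[OF nf_subspace] by simp
next
  case (gen_add x y)
  then show ?case by (simp add: mul_add_left nf_add)
next
  case (gen_sc x k)
  then show ?case by (simp add: mul_sc_left nf_sc)
next
  case (gen_dd x)
  then show ?case by (simp add: mul_dd_left vs.subspace_neg[OF nf_subspace] nf_sc)
next
  case (gen_pr x y n)
  have V: "vs.subspace {a. mul l a c \<in> nf}"
    using nf_subspace by (auto simp: vs.subspace_def mul_add_left mul_sc_left)
  have "mul m x y \<in> {a. mul l a c \<in> nf}" for m
    using gen_pr.IH(1)[OF gen_pr.IH(2)[OF gen_pr.prems, of "l - m"], of m] by (simp add: mul_assoc)
  from pr_in_subspace[OF V this] show ?case by simp
qed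

lemma in_nf: "a \<in> nf"
proof -
  have "a \<in> generated sc dd pr v" using U3 by (simp add: is_U3_def)
  then show ?thesis
  proof (induction rule: generated.induct)
    case (gen_pr x y n)
    then show ?case by (intro pr_in_subspace[OF nf_subspace] mul_generated_nf)
  qed (auto intro: nf.intros vs.subspace_0[OF nf_subspace])
qed

lemma u3_induct [case_names v E X dd add sc]:
  assumes "P v" "\<And>j. P (E j)" "\<And>a. P a \<Longrightarrow> P (X a)" "\<And>a. P a \<Longrightarrow> P (dd a)"
    "\<And>a b. P a \<Longrightarrow> P b \<Longrightarrow> P (a + b)" "\<And>a c. P a \<Longrightarrow> P (sc c a)"
  shows "P a"
  using in_nf[of a] by induction (blast intro: assms)+

section \<open>The evaluations supplied by the universal property\<close>

definition good_eval :: "'k poly \<Rightarrow> ('k \<Rightarrow> 'k \<Rightarrow> 'k \<Rightarrow> 'k) \<Rightarrow> ('a \<Rightarrow> 'k \<Rightarrow> 'k \<Rightarrow> 'k \<Rightarrow> 'k) \<Rightarrow> bool" where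
  "good_eval W w e \<longleftrightarrow> e v = w \<and> (\<forall>a. P3 (e a)) \<and> (\<forall>a b d x z. e (a + b) d x z = e a d x z + e b d x z)
    \<and> (\<forall>c a d x z. e (sc c a) d x z = c * e a d x z) \<and> (\<forall>a d x z. e (dd a) d x z = (x - z) * e a d x z)
    \<and> (\<forall>a b l d x z. e (mul l a b) d x z = e a d x (x + l) * poly W (x + l) * e b d (x + l) z)"

lemma good_eval_exists:
  assumes rel: "U3_rel (\<lambda>c f n. c * f n) tdd (tpr W) (res3 w)" and w: "P3 w"
  shows "\<exists>e. good_eval W w e"
proof -
  have "\<exists>f. conf_hom UNIV sc dd pr test_alg (\<lambda>c f n. c * f n) tdd (tpr W) f \<and> f v = res3 w"
    using U3 rel assoc_conf_alg_test_alg[of W] res3_test_alg[OF w] unfolding is_U3_def by blast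
  then obtain f where f: "conf_hom UNIV sc dd pr test_alg (\<lambda>c f n. c * f n) tdd (tpr W) f" and fv: "f v = res3 w"
    by blast
  have test_alg: "f a \<in> test_alg" and fadd: "f (a + b) = f a + f b" and fsc: "f (sc c a) = (\<lambda>n. c * f a n)"
    and fdd: "f (dd a) = tdd (f a)" and fpr: "f (pr n a b) = tpr W n (f a) (f b)" for a b c n
    using f by (auto simp: conf_hom_def)
  have f0: "f 0 = 0" using fadd[of 0 0] by simp
  have fsum: "f (\<Sum>i\<in>I. g i) = (\<Sum>i\<in>I. f (g i))" for I :: "nat set" and g
    by (induction I rule: infinite_finite_induct) (simp_all add: f0 fadd)
  have fmul: "f (mul l a b) = res3 (tprod W (ev3 (f a)) (ev3 (f b)) l)" for l a b
  proof -
    have "f (mul l a b) = (\<Sum>n | pr n a b \<noteq> 0. (\<lambda>k. l ^ n / fact n * tpr W n (f a) (f b) k))"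
      unfolding mul_def lam_ev_def fsum fsc fpr ..
    also have "\<dots> = lam_ev (\<lambda>c f n. c * f n) (tpr W) (f a) (f b) l"
      unfolding lam_ev_def
    proof (rule sum.mono_neutral_right)
      show "{n. tpr W n (f a) (f b) \<noteq> 0} \<subseteq> {n. pr n a b \<noteq> 0}"
        using f0 by (auto simp flip: fpr)
    qed (auto simp: pr_fin zero_fun_def)
    finally show ?thesis using lam_tpr[OF test_alg test_alg] by simp
  qed
  have "good_eval W w (\<lambda>a. ev3 (f a))"
    unfolding good_eval_def
    by (intro conjI allI test_alg_P3 test_alg)
      (simp_all add: fv w fadd fsc fdd test_alg test_alg_add test_alg_scale ev3_tdd fmul P3_tprod test_alg_P3, simp add: tprod_def)
  then show ?thesis by blast
qed

text \<open>The universal property provides two evaluations. The first sends \<open>v\<close> to \<open>x (1 - d) + z d\<close> with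
  weight 1, the second sends \<open>v\<close> to 1 with weight the middle vertex. By \<open>fp_eq\<close> below,
  \<open>fp a x z = g (x (1 - d) + z d) + d (1 - d) r\<close> with \<open>g = gev a x z\<close> and \<open>r = rp a x z\<close>, and
  \<open>E j\<close> corresponds to \<open>d (1 - d) d^j\<close>.\<close>

definition fe :: "'a \<Rightarrow> 'k \<Rightarrow> 'k \<Rightarrow> 'k \<Rightarrow> 'k" where
  "fe = (SOME e. good_eval 1 (\<lambda>d x z. x * (1 - d) + z * d) e)"

definition ge :: "'a \<Rightarrow> 'k \<Rightarrow> 'k \<Rightarrow> 'k \<Rightarrow> 'k" where
  "ge = (SOME e. good_eval [:0, 1:] (\<lambda>d x z. 1) e)"

lemma good_fe: "good_eval 1 (\<lambda>d x z. x * (1 - d) + z * d) fe"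
  unfolding fe_def by (rule someI_ex[OF good_eval_exists[OF U3_rel_test_alg_1]]) (intro P3_arith)

lemma good_ge: "good_eval [:0, 1:] (\<lambda>d x z. 1) ge"
  unfolding ge_def by (rule someI_ex[OF good_eval_exists[OF U3_rel_test_alg_X]]) (intro P3_arith)

definition fp :: "'a \<Rightarrow> 'k \<Rightarrow> 'k \<Rightarrow> 'k poly" where
  "fp a x z = pfun (\<lambda>d. fe a d x z)"

definition gev :: "'a \<Rightarrow> 'k \<Rightarrow> 'k \<Rightarrow> 'k" where
  "gev a x z = ge a 0 x z"

lemma poly_fp: "poly (fp a x z) d = fe a d x z"
proof -
  have "P3 (fe a)" using good_fe by (simp add: good_eval_def)
  then have "is_pfun (\<lambda>d. (\<lambda>ys. fe a (ys ! 0) (ys ! 1) (ys ! 2)) [d, x, z])"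
    unfolding P3_def by (rule is_pfun_PF[where s = "\<lambda>ys. [hd ys, x, z]" for x z, simplified])
      (unfold numeral_3_eq_3, intro PL_Cons PL_Nil PF_hd PF_c)
  then show ?thesis unfolding fp_def by (subst poly_pfun) simp_all
qed

lemma fp_eqI: "(\<And>d. fe a d x z = poly p d) \<Longrightarrow> fp a x z = p"
  unfolding fp_def by (rule pfun_eqI) simp

lemma fp_add: "fp (a + b) x z = fp a x z + fp b x z"
  and fp_sc: "fp (sc c a) x z = smult c (fp a x z)"
  and fp_dd: "fp (dd a) x z = smult (x - z) (fp a x z)"
  and fp_mul: "fp (mul (y - x) a b) x z = fp a x y * fp b y z"
  and fp_v: "fp v x z = [:x, z - x:]"
  using good_fe by (auto intro!: fp_eqI simp: poly_fp good_eval_def algebra_simps)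

lemma gev_add: "gev (a + b) x z = gev a x z + gev b x z"
  and gev_sc: "gev (sc c a) x z = c * gev a x z"
  and gev_dd: "gev (dd a) x z = (x - z) * gev a x z"
  and gev_mul: "gev (mul (y - x) a b) x z = y * gev a x y * gev b y z"
  and gev_v: "gev v x z = 1"
  using good_ge by (simp_all add: good_eval_def gev_def)

lemma fp_X: "fp (X a) x z = smult x (fp a x z)" and gev_X: "gev (X a) x z = x * gev a x z"
  using fp_mul[of x x v a z] gev_mul[of x x v a z] by (simp_all add: X_def fp_v gev_v)

abbreviation ee :: "'k poly" where "ee \<equiv> [:0, 1, -1:]"

text \<open>In the evaluation of \<open>mul_vv\<close> the total coefficient of \<open>E 0\<close>
  is \<open>l (x - z) + l^2\<close>, and \<open>l\<close> is chosen to make it nonzero.\<close>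

lemma fp_E0: "fp (E 0) x z = ee"
proof -
  obtain l where l: "l \<noteq> 0" "l - (z - x) \<noteq> 0"
    using ex_new_if_finite[OF infinite_UNIV_char_0, of "{0, z - x}"] by auto
  have *: "mul ((x + l) - x) v v = X v + sc l (v + dd (E 0)) + sc (l ^ 2) (E 0)"
    by (simp add: mul_vv)
  have h: "fp v x (x + l) * fp v (x + l) z = fp (X v + sc l (v + dd (E 0)) + sc (l ^ 2) (E 0)) x z"
    unfolding *[symmetric] fp_mul ..
  have "poly (fp (E 0) x z) d = poly ee d" for d
  proof -
    have "l * (l - (z - x)) * poly (fp (E 0) x z) d = l * (l - (z - x)) * poly ee d"
      using arg_cong[OF h, of "\<lambda>p. poly p d"]
      by (simp add: fp_add fp_sc fp_dd fp_X fp_v algebra_simps power2_eq_square)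
    then show ?thesis using l by simp
  qed
  then show ?thesis by (simp flip: poly_eq_poly_eq_iff add: fun_eq_iff)
qed

lemma gev_E0: "gev (E 0) x z = 0"
proof -
  obtain l where l: "l \<noteq> 0" "l - (z - x) \<noteq> 0"
    using ex_new_if_finite[OF infinite_UNIV_char_0, of "{0, z - x}"] by auto
  have "gev (mul ((x + l) - x) v v) x z = gev (X v + sc l (v + dd (E 0)) + sc (l ^ 2) (E 0)) x z"
    by (simp add: mul_vv)
  then have "l * (l - (z - x)) * gev (E 0) x z = 0"
    by (subst (asm) gev_mul) (simp add: gev_add gev_sc gev_dd gev_X gev_v algebra_simps power2_eq_square)
  then show ?thesis using l by simp
qed

lemma fp_E_gev_E: "fp (E j) x z = ee * monom 1 j \<and> gev (E j) x z = 0"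
proof (induction j arbitrary: x z)
  case 0
  then show ?case by (simp add: fp_E0 gev_E0 monom_0)
next
  case (Suc j)
  have *: "mul ((x + 1) - x) v (E j) = X (E j) + sc 1 (E (Suc j))"
    by (simp add: mul_vE)
  have "fp v x (x + 1) * fp (E j) (x + 1) z = fp (X (E j) + sc 1 (E (Suc j))) x z"
    unfolding *[symmetric] fp_mul ..
  then have "fp (E (Suc j)) x z = [:x, 1:] * (ee * monom 1 j) - smult x (ee * monom 1 j)"
    by (simp only: fp_add fp_sc fp_X fp_v Suc) (simp add: algebra_simps)
  also have "\<dots> = ([:x, 1:] - [:x:]) * (ee * monom 1 j)" by (simp only: left_diff_distrib) simp
  also have "\<dots> = ee * monom 1 (Suc j)" by (simp add: monom_Suc)
  moreover have "gev (E (Suc j)) x z = 0"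
    using arg_cong[OF *, of "\<lambda>a. gev a x z"] unfolding gev_mul by (simp add: gev_add gev_sc gev_X Suc)
  ultimately show ?case by simp
qed

lemmas fp_E = fp_E_gev_E[THEN conjunct1] and gev_E = fp_E_gev_E[THEN conjunct2]

definition rp :: "'a \<Rightarrow> 'k \<Rightarrow> 'k \<Rightarrow> 'k poly" where
  "rp a x z = (fp a x z - smult (gev a x z) [:x, z - x:]) div ee"

lemma rp_eqI: "fp a x z = smult (gev a x z) [:x, z - x:] + ee * r \<Longrightarrow> rp a x z = r"
  unfolding rp_def by (simp only: add_diff_cancel_left') (rule nonzero_mult_div_cancel_left, simp)

lemma fp_eq: "fp a x z = smult (gev a x z) [:x, z - x:] + ee * rp a x z"
proof -
  have "\<exists>r. fp a x z = smult (gev a x z) [:x, z - x:] + ee * r"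
  proof (induction a rule: u3_induct)
    case v show ?case by (rule exI[of _ 0]) (simp add: fp_v gev_v)
  next
    case (E j) show ?case by (rule exI[of _ "monom 1 j"]) (simp add: fp_E gev_E)
  next
    case (X a)
    then obtain r where "fp a x z = smult (gev a x z) [:x, z - x:] + ee * r" by blast
    then show ?case by (intro exI[of _ "smult x r"]) (simp only: fp_X gev_X smult_add_right mult_smult_right smult_smult)
  next
    case (dd a)
    then obtain r where "fp a x z = smult (gev a x z) [:x, z - x:] + ee * r" by blast
    then show ?case by (intro exI[of _ "smult (x - z) r"]) (simp only: fp_dd gev_dd smult_add_right mult_smult_right smult_smult)
  next
    case (add a b)
    then obtain r s where "fp a x z = smult (gev a x z) [:x, z - x:] + ee * r"
      "fp b x z = smult (gev b x z) [:x, z - x:] + ee * s" by blast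
    then show ?case by (intro exI[of _ "r + s"]) (simp only: fp_add gev_add smult_add_left distrib_left, simp only: ac_simps)
  next
    case (sc a c)
    then obtain r where "fp a x z = smult (gev a x z) [:x, z - x:] + ee * r" by blast
    then show ?case by (intro exI[of _ "smult c r"]) (simp only: fp_sc gev_sc smult_add_right mult_smult_right smult_smult)
  qed
  then show ?thesis using rp_eqI by metis
qed

lemma rp_v: "rp v x z = 0"
  by (rule rp_eqI) (simp add: fp_v gev_v)

lemma rp_E: "rp (E j) x z = monom 1 j"
  by (rule rp_eqI) (simp add: fp_E gev_E)

lemma rp_add: "rp (a + b) x z = rp a x z + rp b x z"
  by (rule rp_eqI) (simp only: fp_add gev_add fp_eq[of a] fp_eq[of b] smult_add_left distrib_left, simp only: ac_simps)

lemma rp_sc: "rp (sc c a) x z = smult c (rp a x z)"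
  by (rule rp_eqI) (simp only: fp_sc gev_sc fp_eq[of a] smult_add_right mult_smult_right smult_smult)

lemma rp_X: "rp (X a) x z = smult x (rp a x z)"
  by (rule rp_eqI) (simp only: fp_X gev_X fp_eq[of a] smult_add_right mult_smult_right smult_smult)

lemma rp_dd: "rp (dd a) x z = smult (x - z) (rp a x z)"
  by (rule rp_eqI) (simp only: fp_dd gev_dd fp_eq[of a] smult_add_right mult_smult_right smult_smult)

lemma gev_PF:
  assumes "PF n y" "PF n z"
  shows "PF n (\<lambda>ys. gev a (y ys) (z ys))"
proof -
  have "P3 (ge a)" using good_ge by (simp add: good_eval_def)
  from P3_PF[OF this PF_c assms] show ?thesis unfolding gev_def .
qed

lemma rp_PFP:
  assumes "PF n y" "PF n z"
  shows "PFP n (\<lambda>ys. rp a (y ys) (z ys))"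
proof (induction a rule: u3_induct)
  case v show ?case unfolding rp_v by (rule PFP_const)
next
  case (E j) show ?case unfolding rp_E by (rule PFP_const)
next
  case (dd a)
  then show ?case unfolding rp_dd by (rule PFP_smult[OF PF_diff[OF assms]])
next
  case (X a)
  then show ?case unfolding rp_X by (rule PFP_smult[OF assms(1)])
next
  case (add a b)
  then show ?case unfolding rp_add by (rule PFP_add)
next
  case (sc a c)
  then show ?case unfolding rp_sc by (rule PFP_smult[OF PF_c])
qed

lemma fp_PFP:
  assumes "PF n y" "PF n z"
  shows "PFP n (\<lambda>ys. fp a (y ys) (z ys))"
  unfolding fp_eq
  by (rule PFP_add[OF PFP_smult[OF gev_PF[OF assms] PFP_pCons[OF assms(1) PFP_PF[OF PF_diff[OF assms(2,1)]]]]
        PFP_mult[OF PFP_const rp_PFP[OF assms]]])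

text \<open>At both ends \<open>d = 0\<close> and \<open>d = 1\<close> the term with
  \<open>ee\<close> drops out and the representation collapses to a character; these are the later
  \<open>r0\<close> and \<open>r1\<close>.\<close>

lemma poly_fp_0: "poly (fp a x z) 0 = x * gev a x z" and poly_fp_1: "poly (fp a x z) 1 = z * gev a x z"
  by (simp_all add: fp_eq algebra_simps)

end

lemma poly_coeffs_zero:
  fixes a :: "nat \<Rightarrow> 'k::field_char_0"
  assumes "\<And>x. (\<Sum>i\<le>N. a i * x ^ i) = 0" "i \<le> N"
  shows "a i = 0"
proof -
  let ?p = "\<Sum>i\<le>N. monom (a i) i"
  have "poly ?p x = poly 0 x" for x using assms(1)[of x] by (simp add: poly_sum poly_monom)
  then have "?p = 0" by (simp flip: poly_eq_poly_eq_iff add: fun_eq_iff)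
  then have "coeff ?p i = 0" by simp
  then show ?thesis using assms(2) by (simp add: coeff_sum sum.delta)
qed

text \<open>The linear functional with value \<open>f j\<close> on the monomial of degree
  \<open>j\<close>. Recording only these values keeps the dependence on further parameters
  polynomial, see \<open>PF_psum\<close>.\<close>

definition psum :: "'k::field_char_0 poly \<Rightarrow> (nat \<Rightarrow> 'k) \<Rightarrow> 'k" where
  "psum p f = (\<Sum>j\<le>degree p. coeff p j * f j)"

lemma psum_le: "degree p \<le> N \<Longrightarrow> psum p f = (\<Sum>j\<le>N. coeff p j * f j)"
  unfolding psum_def by (rule sum.mono_neutral_left) (auto simp: coeff_eq_0)

lemma psum_add: "psum (p + q) f = psum p f + psum q f"
  using degree_add_le_max[of p q]
  by (simp add: psum_le[of _ "max (degree p) (degree q)"] sum.distrib distrib_right)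

lemma psum_smult: "psum (smult c p) f = c * psum p f"
  using degree_smult_le[of c p] by (simp add: psum_le[of _ "degree p"] sum_distrib_left mult.assoc)

lemma psum_monom: "psum (monom 1 j) f = f j"
  by (simp add: psum_le[of _ j] degree_monom_le if_distrib[of "\<lambda>x. x * _"] sum.delta cong: if_cong)

lemma psum_0: "psum 0 f = 0"
  by (simp add: psum_def)

lemma PF_psum:
  assumes "PFP n P" "\<And>j. PF n (f j)"
  shows "PF n (\<lambda>ys. psum (P ys) (\<lambda>j. f j ys))"
proof -
  obtain N where N: "\<And>ys. length ys = n \<Longrightarrow> degree (P ys) \<le> N"
    using assms(1) by (auto simp: PFP_def)
  have "PF n (\<lambda>ys. coeff (P ys) j)" for j using assms(1) by (simp add: PFP_def)
  then have "PF n (\<lambda>ys. \<Sum>j\<le>N. coeff (P ys) j * f j ys)"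
    by (rule PF_sum[OF PF_mult[OF _ assms(2)]])
  then show ?thesis by (rule PF_cong) (simp add: psum_le N)
qed

definition poly_lin :: "('k::field_char_0 poly \<Rightarrow> 'k) \<Rightarrow> bool" where
  "poly_lin L \<longleftrightarrow> (\<forall>p q. L (p + q) = L p + L q) \<and> (\<forall>c p. L (smult c p) = c * L p)"

lemma poly_lin_psum: "poly_lin L \<Longrightarrow> L p = psum p (\<lambda>j. L (monom 1 j))"
proof -
  assume L: "poly_lin L"
  then have L0: "L 0 = 0" unfolding poly_lin_def by (metis add_cancel_right_right)
  have sum: "L (\<Sum>i\<in>I. f i) = (\<Sum>i\<in>I. L (f i))" for I :: "nat set" and f
    using L by (induction I rule: infinite_finite_induct) (auto simp: L0 poly_lin_def)
  have "L p = L (\<Sum>j\<le>degree p. smult (coeff p j) (monom 1 j))"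
    by (simp add: smult_monom poly_as_sum_of_monoms)
  then show ?thesis using L unfolding sum psum_def by (simp add: poly_lin_def)
qed

context u3
begin

text \<open>Coordinates in which \<open>X\<close> and \<open>dd\<close> are multiplication by \<open>x\<close> and \<open>w\<close>, and the basis
  \<open>v, E 0, E 1, \<dots>\<close> becomes \<open>1, d, d^2, \<dots>\<close>.\<close>

definition hv :: "'a \<Rightarrow> 'k \<Rightarrow> 'k \<Rightarrow> 'k \<Rightarrow> 'k" where
  "hv a x w d = gev a x (x - w) + d * poly (rp a x (x - w)) d"

lemma hv_simps: "hv (a + b) x w d = hv a x w d + hv b x w d" "hv (sc c a) x w d = c * hv a x w d"
  "hv (X a) x w d = x * hv a x w d" "hv (dd a) x w d = w * hv a x w d" "hv v x w d = 1"
  "hv (E j) x w d = d ^ Suc j"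
  by (simp_all add: hv_def gev_add rp_add gev_sc rp_sc gev_X rp_X gev_dd rp_dd gev_v rp_v gev_E rp_E
      algebra_simps poly_monom)

lemma hv_is_pfun: "is_pfun (\<lambda>x. hv a x w d)"
proof -
  have "PF 1 (\<lambda>ys. hv a (ys ! 0) w d)"
    unfolding hv_def
    by (rule PF_add[OF gev_PF PF_mult[OF PF_c PFP_poly[OF rp_PFP PF_c]]]) (auto intro!: PF_diff)
  from is_pfun_PF[OF this PL_id] show ?thesis by simp
qed

definition gen :: "nat \<Rightarrow> 'a" where
  "gen l = (case l of 0 \<Rightarrow> v | Suc j \<Rightarrow> E j)"

definition mon :: "nat \<times> nat \<times> nat \<Rightarrow> 'a" where
  "mon = (\<lambda>(i, j, l). (X ^^ i) ((dd ^^ j) (gen l)))"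

lemma hv_mon: "hv (mon (i, j, l)) x w d = x ^ i * w ^ j * d ^ l"
proof -
  have "hv (gen l) x w d = d ^ l" by (cases l) (simp_all add: gen_def hv_simps)
  moreover have "hv ((dd ^^ j) a) x w d = w ^ j * hv a x w d" for a by (induction j) (simp_all add: hv_simps)
  moreover have "hv ((X ^^ i) a) x w d = x ^ i * hv a x w d" for a by (induction i) (simp_all add: hv_simps)
  ultimately show ?thesis by (simp add: mon_def)
qed

lemma span_mon: "a \<in> vs.span (range mon)"
proof -
  have X: "X b \<in> vs.span (range mon)" if "b \<in> vs.span (range mon)" for b
  proof -
    have "vs.span (range mon) \<subseteq> {b. X b \<in> vs.span (range mon)}"
    proof (rule vs.span_minimal)
      show "vs.subspace {b. X b \<in> vs.span (range mon)}"
        by (auto simp: vs.subspace_def vs.span_zero vs.span_add vs.span_scale)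
      have "X (mon (i, j, l)) = mon (Suc i, j, l)" for i j l by (simp add: mon_def)
      then show "range mon \<subseteq> {b. X b \<in> vs.span (range mon)}"
        by (auto intro: vs.span_base)
    qed
    then show ?thesis using that by blast
  qed
  have XX: "(X ^^ i) (dd b) = dd ((X ^^ i) b)" for i b by (induction i) (simp_all add: X_dd)
  have dd: "dd b \<in> vs.span (range mon)" if "b \<in> vs.span (range mon)" for b
  proof -
    have "vs.span (range mon) \<subseteq> {b. dd b \<in> vs.span (range mon)}"
    proof (rule vs.span_minimal)
      show "vs.subspace {b. dd b \<in> vs.span (range mon)}"
        by (auto simp: vs.subspace_def vs.span_zero vs.span_add vs.span_scale)
      have "dd (mon (i, j, l)) = mon (i, Suc j, l)" for i j l by (simp add: mon_def XX)
      then show "range mon \<subseteq> {b. dd b \<in> vs.span (range mon)}"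
        by (auto intro: vs.span_base)
    qed
    then show ?thesis using that by blast
  qed
  have "v = mon (0, 0, 0)" "E j = mon (0, 0, Suc j)" for j by (simp_all add: mon_def gen_def)
  then have "v \<in> range mon" "E j \<in> range mon" for j by (metis rangeI)+
  then show ?thesis
    by (induction a rule: u3_induct) (simp_all add: X dd vs.span_add vs.span_scale vs.span_base)
qed

text \<open>Freeness over \<open>X\<close> and \<open>dd\<close>: an element is a finite combination
  of monomials whose coordinates are \<open>x^i w^j d^l\<close>, and the coefficients are shown to
  vanish by stripping \<open>x\<close>, \<open>w\<close> and \<open>d\<close> in turn.\<close>

lemma hv_inj:
  assumes "\<And>x w d. hv a x w d = 0"
  shows "a = 0"
proof -
  obtain t r where t: "finite t" "t \<subseteq> range mon" "a = (\<Sum>b\<in>t. sc (r b) b)"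
    using span_mon[of a] unfolding vs.span_explicit by blast
  obtain K where K: "t = mon ` K" "inj_on mon K"
    using t(2) by (meson subset_image_inj)
  have fK: "finite K" using t(1) K finite_imageD by blast
  define s where "s k = (if k \<in> K then r (mon k) else 0)" for k
  obtain N where N: "K \<subseteq> {..N} \<times> {..N} \<times> {..N}"
  proof -
    have "finite (fst ` K \<union> fst ` snd ` K \<union> snd ` snd ` K)" using fK by simp
    then obtain N where N: "fst ` K \<union> fst ` snd ` K \<union> snd ` snd ` K \<subseteq> {..N}"
      using finite_nat_iff_bounded_le by blast
    have "K \<subseteq> {..N} \<times> {..N} \<times> {..N}"
    proof
      fix k assume "k \<in> K"
      then have i: "fst k \<in> fst ` K" "fst (snd k) \<in> fst ` snd ` K" "snd (snd k) \<in> snd ` snd ` K"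
        using imageI[of k K fst] imageI[of "snd k" "snd ` K" fst] imageI[of "snd k" "snd ` K" snd] by simp_all
      have "fst k \<in> {..N}" by (rule subsetD[OF N UnI1[OF UnI1[OF i(1)]]])
      moreover have "fst (snd k) \<in> {..N}" by (rule subsetD[OF N UnI1[OF UnI2[OF i(2)]]])
      moreover have "snd (snd k) \<in> {..N}" by (rule subsetD[OF N UnI2[OF i(3)]])
      ultimately show "k \<in> {..N} \<times> {..N} \<times> {..N}" by (cases k) auto
    qed
    then show ?thesis using that by blast
  qed
  have "a = (\<Sum>k\<in>K. sc (s k) (mon k))"
    unfolding t(3) K(1) by (simp add: sum.reindex[OF K(2)] s_def)
  also have "\<dots> = (\<Sum>k\<in>{..N} \<times> {..N} \<times> {..N}. sc (s k) (mon k))"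
    by (rule sum.mono_neutral_left) (use N in \<open>auto simp: s_def\<close>)
  finally have a: "a = (\<Sum>k\<in>{..N} \<times> {..N} \<times> {..N}. sc (s k) (mon k))" .
  have hs: "hv (\<Sum>k\<in>I. f k) x w d = (\<Sum>k\<in>I. hv (f k) x w d)" for I :: "(nat \<times> nat \<times> nat) set" and f x w d
    using hv_simps(2)[of 0 0] by (induction I rule: infinite_finite_induct) (simp_all add: hv_simps)
  have "(\<Sum>i\<le>N. (\<Sum>j\<le>N. (\<Sum>l\<le>N. s (i, j, l) * d ^ l) * w ^ j) * x ^ i) = 0" for x w d
  proof -
    have "(\<Sum>i\<le>N. \<Sum>j\<le>N. \<Sum>l\<le>N. s (i, j, l) * hv (mon (i, j, l)) x w d)
      = (\<Sum>k\<in>{..N} \<times> {..N} \<times> {..N}. s k * hv (mon k) x w d)"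
      unfolding sum.cartesian_product by (intro sum.cong) auto
    also have "\<dots> = 0" using assms[of x w d] unfolding a hs by (simp only: hv_simps)
    finally show ?thesis by (simp add: hv_mon sum_distrib_right sum_distrib_left ac_simps)
  qed
  note s0 = this
  have split_htp: "(\<Sum>j\<le>N. (\<Sum>l\<le>N. s (i, j, l) * d ^ l) * w ^ j) = 0" if "i \<le> N" for i w d
    by (rule poly_coeffs_zero[where a = "\<lambda>i. \<Sum>j\<le>N. (\<Sum>l\<le>N. s (i, j, l) * d ^ l) * w ^ j", OF s0 that])
  have s2: "(\<Sum>l\<le>N. s (i, j, l) * d ^ l) = 0" if "i \<le> N" "j \<le> N" for i j d
    by (rule poly_coeffs_zero[where a = "\<lambda>j. \<Sum>l\<le>N. s (i, j, l) * d ^ l", OF split_htp[OF that(1)] that(2)])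
  have "s (i, j, l) = 0" if "i \<le> N" "j \<le> N" "l \<le> N" for i j l
    by (rule poly_coeffs_zero[where a = "\<lambda>l. s (i, j, l)", OF s2[OF that(1,2)] that(3)])
  then show "a = 0" unfolding a by (intro sum.neutral) auto
qed

lemma hv_diff: "hv (a - b) x w d = hv a x w d - hv b x w d"
  using hv_simps(1)[of "a - b" b] by simp

text \<open>The quotient of \<open>a\<close> by \<open>x - y\<close> with respect to the free basis \<open>v, E 0, E 1, \<dots>\<close>.\<close>

definition quo :: "'k \<Rightarrow> 'a \<Rightarrow> 'a" where
  "quo y a = (THE b. \<forall>x w d. hv b x w d * (x - y) = hv a x w d - hv a y w d)"

lemma quo_unique:
  assumes "\<And>x w d. hv b x w d * (x - y) = hv a x w d - hv a y w d"
  shows "quo y a = b"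
  unfolding quo_def
proof (rule the_equality)
  fix c assume c: "\<forall>x w d. hv c x w d * (x - y) = hv a x w d - hv a y w d"
  have "hv c x w d = hv b x w d" for x w d
  proof (rule is_pfun_eq_off[OF hv_is_pfun hv_is_pfun, of "{y}"])
    fix t assume "t \<notin> {y}"
    moreover have "hv c t w d * (t - y) = hv b t w d * (t - y)" using c assms by simp
    ultimately show "hv c t w d = hv b t w d" by simp
  qed simp
  then have "c - b = 0" by (intro hv_inj) (simp add: hv_diff)
  then show "c = b" by simp
qed (use assms in blast)

lemma quo_eq: "hv (quo y a) x w d * (x - y) = hv a x w d - hv a y w d"
proof -
  have "\<exists>b. \<forall>x w d. hv b x w d * (x - y) = hv a x w d - hv a y w d"
  proof (induction a rule: u3_induct)
    case (X a)
    then obtain b where "\<forall>x w d. hv b x w d * (x - y) = hv a x w d - hv a y w d" by blast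
    then have b: "hv b x w d * (x - y) = hv a x w d - hv a y w d" for x w d by blast
    have "hv (a + sc y b) x w d * (x - y) = hv (X a) x w d - hv (X a) y w d" for x w d
    proof -
      have "hv (a + sc y b) x w d * (x - y) = hv a x w d * (x - y) + y * (hv b x w d * (x - y))"
        by (simp add: hv_simps algebra_simps)
      then show ?thesis unfolding b by (simp add: hv_simps algebra_simps)
    qed
    then show ?case by blast
  next
    case (dd a)
    then obtain b where "\<forall>x w d. hv b x w d * (x - y) = hv a x w d - hv a y w d" by blast
    then have "hv (dd b) x w d * (x - y) = hv (dd a) x w d - hv (dd a) y w d" for x w d
      by (simp only: hv_simps mult.assoc, simp only: right_diff_distrib)
    then show ?case by blast
  next
    case (add a b)
    then obtain a' b' where "\<forall>x w d. hv a' x w d * (x - y) = hv a x w d - hv a y w d"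
      "\<forall>x w d. hv b' x w d * (x - y) = hv b x w d - hv b y w d" by blast
    then show ?case by (intro exI[of _ "a' + b'"]) (simp add: hv_simps algebra_simps)
  next
    case (sc a c)
    then obtain b where "\<forall>x w d. hv b x w d * (x - y) = hv a x w d - hv a y w d" by blast
    then have "hv (sc c b) x w d * (x - y) = hv (sc c a) x w d - hv (sc c a) y w d" for x w d
      by (simp only: hv_simps mult.assoc, simp only: right_diff_distrib)
    then show ?case by blast
  qed (rule exI[of _ 0], use hv_diff[of 0 0] in \<open>simp add: hv_simps\<close>)+
  then show ?thesis using quo_unique by blast
qed

lemma quo_X: "quo y (X a) = a + sc y (quo y a)"
proof (rule quo_unique)
  fix x w d
  have "hv (a + sc y (quo y a)) x w d * (x - y) = hv a x w d * (x - y) + y * (hv (quo y a) x w d * (x - y))"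
    by (simp add: hv_simps algebra_simps)
  also have "\<dots> = hv (X a) x w d - hv (X a) y w d"
    unfolding quo_eq by (simp add: hv_simps algebra_simps)
  finally show "hv (a + sc y (quo y a)) x w d * (x - y) = hv (X a) x w d - hv (X a) y w d" .
qed

lemma quo_add: "quo y (a + b) = quo y a + quo y b"
  by (rule quo_unique) (simp add: hv_simps distrib_right quo_eq)

lemma quo_sc: "quo y (sc c a) = sc c (quo y a)"
  by (rule quo_unique) (simp only: hv_simps mult.assoc quo_eq, simp only: right_diff_distrib)

lemma quo_dd: "quo y (dd a) = dd (quo y a)"
  by (rule quo_unique) (simp only: hv_simps mult.assoc quo_eq, simp only: right_diff_distrib)

lemma quo_v: "quo y v = 0" and quo_E: "quo y (E j) = 0"
  using hv_diff[of 0 0] by (auto intro!: quo_unique simp: hv_simps)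

section \<open>Functionals on the algebra depending polynomially on parameters\<close>

definition lin :: "('a \<Rightarrow> 'k) \<Rightarrow> bool" where
  "lin L \<longleftrightarrow> (\<forall>a b. L (a + b) = L a + L b) \<and> (\<forall>c a. L (sc c a) = c * L a)"

lemma lin_0: "lin L \<Longrightarrow> L 0 = 0"
  unfolding lin_def by (metis add_cancel_right_right)

lemma lin_sum: "lin L \<Longrightarrow> L (\<Sum>i\<in>I. f i) = (\<Sum>i\<in>I. L (f i))"
  by (induction I rule: infinite_finite_induct) (auto simp: lin_0, auto simp: lin_def)

lemma lin_dd: "lin L \<Longrightarrow> lin (\<lambda>a. L (dd a))"
  by (simp add: lin_def)

text \<open>The base point of the quotient will itself be a vertex, so joint polynomiality is
  required. Recursion on \<open>a\<close> unwinds \<open>quo\<close>; \<open>L\<close> is arbitrary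
  because the case of \<open>dd\<close> moves \<open>dd\<close> into the functional.\<close>

lemma PF_quo:
  assumes "PF n y" "\<And>ys. length ys = n \<Longrightarrow> lin (L ys)" "\<And>a. PF n (\<lambda>ys. L ys a)"
  shows "PF n (\<lambda>ys. L ys (quo (y ys) a))"
  using assms(2,3)
proof (induction a arbitrary: L rule: u3_induct)
  case v
  then show ?case by (intro PF_const[of _ _ 0]) (simp add: quo_v lin_0)
next
  case (E j)
  then show ?case by (intro PF_const[of _ _ 0]) (simp add: quo_E lin_0)
next
  case (X a)
  have "PF n (\<lambda>ys. L ys a + y ys * L ys (quo (y ys) a))"
    by (rule PF_add[OF X.prems(2) PF_mult[OF assms(1) X.IH[OF X.prems]]])
  then show ?case by (rule PF_cong) (use X.prems(1) in \<open>simp add: quo_X lin_def\<close>)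
next
  case (dd a)
  show ?case unfolding quo_dd by (rule dd.IH[of "\<lambda>ys a. L ys (dd a)", OF lin_dd[OF dd.prems(1)] dd.prems(2)])
next
  case (add a b)
  have "PF n (\<lambda>ys. L ys (quo (y ys) a) + L ys (quo (y ys) b))"
    by (rule PF_add[OF add.IH(1)[OF add.prems] add.IH(2)[OF add.prems]])
  then show ?case by (rule PF_cong) (use add.prems(1) in \<open>simp add: quo_add lin_def\<close>)
next
  case (sc a c)
  have "PF n (\<lambda>ys. c * L ys (quo (y ys) a))"
    by (rule PF_mult[OF PF_c sc.IH[OF sc.prems]])
  then show ?case by (rule PF_cong) (use sc.prems(1) in \<open>simp add: quo_sc lin_def\<close>)
qed

lemma PF_mul:
  assumes "PF n l" "\<And>ys. length ys = n \<Longrightarrow> lin (L ys)" "\<And>a. PF n (\<lambda>ys. L ys a)"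
  shows "PF n (\<lambda>ys. L ys (mul (l ys) a b))"
proof -
  obtain N where N: "\<And>l. mul l a b = (\<Sum>n\<le>N. sc (l ^ n) (sc (1 / fact n) (pr n a b)))"
    by (rule mul_sum_atMost[of a b], rule that)
  have "PF n (\<lambda>ys. \<Sum>i\<le>N. l ys ^ i * L ys (sc (1 / fact i) (pr i a b)))"
    by (rule PF_sum[OF PF_mult[OF PF_power[OF assms(1)] assms(3)]])
  then show ?thesis
    by (rule PF_cong) (use assms(2) in \<open>simp add: N lin_sum, simp add: lin_def\<close>)
qed

text \<open>The rule for an argument sitting on the edge from \<open>y\<close> to \<open>z\<close>:
  its parameter is \<open>\<lambda> = z - y\<close>, so \<open>dd\<close> acts as
  \<open>- \<lambda> = y - z\<close>.\<close>

definition slot :: "'k \<Rightarrow> 'k \<Rightarrow> ('a \<Rightarrow> 'k) \<Rightarrow> bool" where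
  "slot y z L \<longleftrightarrow> lin L \<and> (\<forall>a. L (dd a) = (y - z) * L a)"

lemma slotD: "slot y z L \<Longrightarrow> L (a + b) = L a + L b" "slot y z L \<Longrightarrow> L (sc c a) = c * L a"
  "slot y z L \<Longrightarrow> L (dd a) = (y - z) * L a" "slot y z L \<Longrightarrow> lin L"
  by (simp_all add: slot_def lin_def)

lemma slotI: "(\<And>a b. L (a + b) = L a + L b) \<Longrightarrow> (\<And>c a. L (sc c a) = c * L a) \<Longrightarrow>
    (\<And>a. L (dd a) = (y - z) * L a) \<Longrightarrow> slot y z L"
  by (simp add: slot_def lin_def)

text \<open>Once \<open>X\<close> and \<open>dd\<close> both act by scalars, the functional is
  determined by its values on \<open>v\<close> and the \<open>E j\<close>, and \<open>gev\<close>
  and \<open>rp\<close> are the coordinates with respect to these.\<close>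

lemma slot_expand:
  assumes L: "slot y z L" and X: "\<And>a. L (X a) = y * L a"
  shows "L a = gev a y z * L v + psum (rp a y z) (\<lambda>j. L (E j))"
proof (induction a rule: u3_induct)
  case v show ?case by (simp add: gev_v rp_v psum_0)
next
  case (E j) show ?case by (simp add: gev_E rp_E psum_monom)
next
  case (X a) then show ?case by (simp add: gev_X rp_X psum_smult assms(2) algebra_simps)
next
  case (dd a) then show ?case by (simp add: gev_dd rp_dd psum_smult slotD[OF L] algebra_simps)
next
  case (add a b) then show ?case by (simp add: gev_add rp_add psum_add slotD[OF L] algebra_simps)
next
  case (sc a c) then show ?case by (simp add: gev_sc rp_sc psum_smult slotD[OF L] algebra_simps)
qed

end

section \<open>Cochains in vertex coordinates\<close>

text \<open>A cochain of degree \<open>n\<close> is a function of \<open>n\<close> elements and \<open>n + 1\<close> vertices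
  \<open>y\<^sub>0, y\<^sub>1 = y\<^sub>0 + \<lambda>\<^sub>1, y\<^sub>2 = y\<^sub>1 + \<lambda>\<^sub>2, \<dots>\<close>, where \<open>y\<^sub>0\<close> is the value substituted for \<open>\<partial>\<close>
  in the module. The \<open>\<lambda>\<close>-product then merges two adjacent elements and drops the vertex
  between them, and \<open>\<partial>\<close> acts on cochains as multiplication by the last vertex. The differential
  \<open>dm r\<close> belongs to the character \<open>r\<close>; the module \<open>M\<^sub>(\<^sub>0\<^sub>,\<^sub>0\<^sub>)\<close> has the character \<open>r0\<close>.\<close>

context u3
begin

abbreviation sl :: "('a list \<Rightarrow> 'k list \<Rightarrow> 'k) \<Rightarrow> 'a \<Rightarrow> 'k \<Rightarrow> 'a list \<Rightarrow> 'k list \<Rightarrow> 'k" where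
  "sl \<Phi> x y \<equiv> \<lambda>xs ys. \<Phi> (x # xs) (y # ys)"

text \<open>The condition is stated for the first edge and passed on by freezing the first element
  and vertex, in step with the recursion of \<open>dl\<close>; \<open>mlin_iff\<close> gives the
  symmetric form.\<close>

primrec mlin :: "nat \<Rightarrow> ('a list \<Rightarrow> 'k list \<Rightarrow> 'k) \<Rightarrow> bool" where
  "mlin 0 \<Phi> = True"
| "mlin (Suc n) \<Phi> = ((\<forall>xs ys y z. length xs = n \<longrightarrow> length ys = n \<longrightarrow> slot y z (\<lambda>x. \<Phi> (x # xs) (y # z # ys)))
     \<and> (\<forall>x y. mlin n (sl \<Phi> x y)))"

definition CC :: "nat \<Rightarrow> ('a list \<Rightarrow> 'k list \<Rightarrow> 'k) \<Rightarrow> bool" where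
  "CC n \<Phi> \<longleftrightarrow> mlin n \<Phi> \<and> (\<forall>xs. length xs = n \<longrightarrow> PF (Suc n) (\<Phi> xs))"

text \<open>The Hochschild differential without its action term: the first merge has sign -1, and
  the later ones are those of the cochain with its first element and vertex frozen, again with
  opposite sign. With fewer than two elements there is nothing to merge and the value is 0.\<close>

fun dl :: "('a list \<Rightarrow> 'k list \<Rightarrow> 'k) \<Rightarrow> 'a list \<Rightarrow> 'k list \<Rightarrow> 'k" where
  "dl \<Phi> (x # x' # xs) (y # z # ys) = - \<Phi> (mul (z - y) x x' # xs) (y # ys) - dl (sl \<Phi> x y) (x' # xs) (z # ys)"
| "dl \<Phi> [] ys = 0"
| "dl \<Phi> [x] ys = 0"
| "dl \<Phi> xs [] = 0"
| "dl \<Phi> xs [y] = 0"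

definition cup :: "('a \<Rightarrow> 'k \<Rightarrow> 'k \<Rightarrow> 'k) \<Rightarrow> ('a list \<Rightarrow> 'k list \<Rightarrow> 'k) \<Rightarrow> 'a list \<Rightarrow> 'k list \<Rightarrow> 'k" where
  "cup r \<Phi> xs ys = r (hd xs) (hd ys) (hd (tl ys)) * \<Phi> (tl xs) (tl ys)"

lemma cup_Cons [simp]: "cup r \<Phi> (x # xs) (y # z # ys) = r x y z * \<Phi> xs (z # ys)"
  by (simp add: cup_def)

definition dm :: "('a \<Rightarrow> 'k \<Rightarrow> 'k \<Rightarrow> 'k) \<Rightarrow> ('a list \<Rightarrow> 'k list \<Rightarrow> 'k) \<Rightarrow> 'a list \<Rightarrow> 'k list \<Rightarrow> 'k" where
  "dm r \<Phi> xs ys = cup r \<Phi> xs ys + dl \<Phi> xs ys"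

text \<open>Here \<open>\<Phi>\<close> is a cochain with values in functionals on polynomials in
  \<open>d\<close>, and \<open>h\<close> is the test polynomial. An element acts on such functionals
  through multiplication of \<open>h\<close> by \<open>fp\<close>.\<close>

definition coeff_cup :: "('k poly \<Rightarrow> 'a list \<Rightarrow> 'k list \<Rightarrow> 'k) \<Rightarrow> 'k poly \<Rightarrow> 'a list \<Rightarrow> 'k list \<Rightarrow> 'k" where
  "coeff_cup \<Phi> h xs ys = \<Phi> (h * fp (hd xs) (hd ys) (hd (tl ys))) (tl xs) (tl ys)"

lemma coeff_cup_Cons [simp]: "coeff_cup \<Phi> h (x # xs) (y # z # ys) = \<Phi> (h * fp x y z) xs (z # ys)"
  by (simp add: coeff_cup_def)

definition coeff_diff :: "('k poly \<Rightarrow> 'a list \<Rightarrow> 'k list \<Rightarrow> 'k) \<Rightarrow> 'k poly \<Rightarrow> 'a list \<Rightarrow> 'k list \<Rightarrow> 'k" where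
  "coeff_diff \<Phi> h xs ys = coeff_cup \<Phi> h xs ys + dl (\<Phi> h) xs ys"

definition r0 :: "'a \<Rightarrow> 'k \<Rightarrow> 'k \<Rightarrow> 'k" where "r0 x y z = y * gev x y z"
definition r1 :: "'a \<Rightarrow> 'k \<Rightarrow> 'k \<Rightarrow> 'k" where "r1 x y z = z * gev x y z"

definition char :: "('a \<Rightarrow> 'k \<Rightarrow> 'k \<Rightarrow> 'k) \<Rightarrow> bool" where
  "char r \<longleftrightarrow> (\<forall>y z. slot y z (\<lambda>x. r x y z)) \<and> (\<forall>x. PF 2 (\<lambda>ys. r x (ys ! 0) (ys ! 1)))"

definition multiplicative :: "('a \<Rightarrow> 'k \<Rightarrow> 'k \<Rightarrow> 'k) \<Rightarrow> bool" where
  "multiplicative r \<longleftrightarrow> (\<forall>x x' y z w. r (mul (z - y) x x') y w = r x y z * r x' z w)"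

lemma slot_gev: "slot y z (\<lambda>x. gev x y z)"
  by (rule slotI) (simp_all add: gev_add gev_sc gev_dd)

lemma slot_scale: "slot y z L \<Longrightarrow> slot y z (\<lambda>x. c * L x)"
  by (rule slotI) (simp_all add: slotD algebra_simps)

lemma slot_add: "slot y z L \<Longrightarrow> slot y z M \<Longrightarrow> slot y z (\<lambda>x. L x + M x)"
  by (rule slotI) (simp_all add: slotD algebra_simps)

lemma slot_uminus: "slot y z L \<Longrightarrow> slot y z (\<lambda>x. - L x)"
  by (rule slotI) (simp_all add: slotD algebra_simps)

lemma slot_diff: "slot y z L \<Longrightarrow> slot y z M \<Longrightarrow> slot y z (\<lambda>x. L x - M x)"
  by (rule slotI) (simp_all add: slotD algebra_simps)

lemma slot_mult: "slot y z L \<Longrightarrow> slot y z (\<lambda>x. L x * c)"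
  by (rule slotI) (simp_all add: slotD algebra_simps)

lemma slot_poly_rp: "slot y z (\<lambda>x. poly (rp x y z) d)"
  by (rule slotI) (simp_all add: rp_add rp_sc rp_dd)

lemma slot_poly_lin_fp: "poly_lin L \<Longrightarrow> slot y z (\<lambda>x. L (h * fp x y z))"
  by (rule slotI) (simp_all add: fp_add fp_sc fp_dd poly_lin_def distrib_left)

lemma char_r0: "char r0" and char_r1: "char r1"
proof -
  have g: "PF 2 (\<lambda>ys. gev x (ys ! 0) (ys ! 1))" for x
    by (rule gev_PF[OF PF_i PF_i]) simp_all
  show "char r0" "char r1" unfolding char_def r0_def r1_def
    using PF_mult[OF PF_i[of 0 2] g] PF_mult[OF PF_i[of 1 2] g] by (simp_all add: slot_scale slot_gev)
qed

lemma multiplicative_r0: "multiplicative r0"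
  by (simp add: multiplicative_def r0_def gev_mul)

section \<open>Algebra of the differentials; their squares vanish\<close>

lemma dl_cong:
  assumes "length ys = Suc (length xs)"
    "\<And>as bs. Suc (length as) = length xs \<Longrightarrow> length bs = Suc (length as) \<Longrightarrow> hd bs = hd ys \<Longrightarrow> \<Phi> as bs = \<Psi> as bs"
  shows "dl \<Phi> xs ys = dl \<Psi> xs ys"
  using assms
proof (induction \<Phi> xs ys arbitrary: \<Psi> rule: dl.induct)
  case (1 \<Phi> x x' xs y z ys)
  have "dl (sl \<Phi> x y) (x' # xs) (z # ys) = dl (sl \<Psi> x y) (x' # xs) (z # ys)"
    by (rule "1.IH") (use "1.prems" in auto)
  then show ?case using "1.prems"(2)[of "mul (z - y) x x' # xs" "y # ys"] "1.prems"(1) by simp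
qed auto

lemma dl_add: "dl (\<lambda>xs ys. \<Phi> xs ys + \<Psi> xs ys) xs ys = dl \<Phi> xs ys + dl \<Psi> xs ys"
  by (induction \<Phi> xs ys arbitrary: \<Psi> rule: dl.induct) auto

lemma dl_scale: "dl (\<lambda>xs ys. c * \<Phi> xs ys) xs ys = c * dl \<Phi> xs ys"
  by (induction \<Phi> xs ys rule: dl.induct) (auto simp: algebra_simps)

lemma dl_uminus: "dl (\<lambda>xs ys. - \<Phi> xs ys) xs ys = - dl \<Phi> xs ys"
  using dl_scale[of "-1" \<Phi> xs ys] by simp

lemma dl_diff: "dl (\<lambda>xs ys. \<Phi> xs ys - \<Psi> xs ys) xs ys = dl \<Phi> xs ys - dl \<Psi> xs ys"
  using dl_add[of \<Phi> "\<lambda>xs ys. - \<Psi> xs ys"] by (simp add: dl_uminus)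

lemma dl_zero: "dl (\<lambda>xs ys. 0) xs ys = 0"
  using dl_scale[of 0 "\<lambda>_ _. 0"] by simp

lemma dl_sum: "dl (\<lambda>xs ys. \<Sum>i\<in>I. \<Phi> i xs ys) xs ys = (\<Sum>i\<in>I. dl (\<Phi> i) xs ys)"
  by (induction I rule: infinite_finite_induct) (simp_all add: dl_zero dl_add)

lemma dl_psum: "dl (\<lambda>xs ys. psum p (\<lambda>j. \<Phi> j xs ys)) xs ys = psum p (\<lambda>j. dl (\<Phi> j) xs ys)"
  by (simp add: psum_def dl_sum dl_scale)

text \<open>No merge ever drops the first vertex, so a parameter depending on it may be frozen. The
  same holds for the last vertex in \<open>dl_scale_last\<close>.\<close>

lemma dl_hd: "length ys = Suc (length xs) \<Longrightarrow> dl (\<lambda>as bs. \<Phi> (hd bs) as bs) xs ys = dl (\<Phi> (hd ys)) xs ys"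
  by (rule dl_cong) auto

lemma dl_scale_hd: "length ys = Suc (length xs) \<Longrightarrow> dl (\<lambda>as bs. c (hd bs) * \<Phi> as bs) xs ys = c (hd ys) * dl \<Phi> xs ys"
  using dl_hd[where \<Phi> = "\<lambda>t as bs. c t * \<Phi> as bs"] by (simp add: dl_scale)

lemma dl_scale_last:
  "length ys = Suc (length xs) \<Longrightarrow> dl (\<lambda>as bs. last bs * \<Phi> as bs) xs ys = last ys * dl \<Phi> xs ys"
proof (induction \<Phi> xs ys rule: dl.induct)
  case (1 \<Phi> x x' xs y z ys)
  have "dl (\<lambda>as bs. last (y # bs) * \<Phi> (x # as) (y # bs)) (x' # xs) (z # ys)
      = dl (\<lambda>as bs. last bs * \<Phi> (x # as) (y # bs)) (x' # xs) (z # ys)"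
    by (rule dl_cong) (use 1 in auto)
  then show ?case using 1 by (auto simp: algebra_simps)
qed auto

text \<open>Merges of disjoint pairs cancel by sign, and the two ways of merging three neighbours
  agree by \<open>mul_assoc\<close>.\<close>

lemma dl_dl: "length ys = Suc (length xs) \<Longrightarrow> dl (dl \<Phi>) xs ys = 0"
proof (induction xs arbitrary: \<Phi> ys)
  case (Cons x xs)
  show ?case
  proof (cases xs)
    case Nil then show ?thesis by simp
  next
    case (Cons x' xs')
    obtain y z ys' where ys: "ys = y # z # ys'" "length ys' = length xs"
      using Cons.prems Cons by (auto simp: length_Suc_conv)
    define \<Omega> where "\<Omega> = (\<lambda>as bs. case as of [] \<Rightarrow> 0 | a # as' \<Rightarrow> - \<Phi> (mul (hd bs - y) x a # as') (y # tl bs))"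
    have sl: "sl (dl \<Phi>) x y as bs = \<Omega> as bs - dl (sl \<Phi> x y) as bs" if "length bs = Suc (length as)" for as bs
      using that by (cases as; cases bs) (auto simp: \<Omega>_def length_Suc_conv)
    have "dl (sl (dl \<Phi>) x y) xs (z # ys') = dl (\<lambda>as bs. \<Omega> as bs - dl (sl \<Phi> x y) as bs) xs (z # ys')"
      by (rule dl_cong) (use ys sl in auto)
    also have "\<dots> = dl \<Omega> xs (z # ys')"
      using Cons.IH[of "z # ys'" "sl \<Phi> x y"] ys by (simp add: dl_diff)
    finally have 1: "dl (sl (dl \<Phi>) x y) xs (z # ys') = dl \<Omega> xs (z # ys')" .
    show ?thesis
    proof (cases xs')
      case Nil
      then show ?thesis using 1 ys Cons by simp
    next
      case Cons2: (Cons x'' xs'')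
      obtain w ys'' where ys': "ys' = w # ys''" "length ys'' = length xs'"
        using ys Cons Cons2 by (auto simp: length_Suc_conv)
      have "dl (sl \<Omega> x' z) xs' ys' = dl (\<lambda>as bs. - sl \<Phi> (mul (z - y) x x') y as bs) xs' ys'"
        by (rule dl_cong) (use ys' ys Cons Cons2 in \<open>auto simp: \<Omega>_def\<close>)
      then have "dl \<Omega> xs (z # ys') = \<Phi> (mul (z - y) x (mul (w - z) x' x'') # xs'') (y # ys'')
          + dl (sl \<Phi> (mul (z - y) x x') y) xs' ys'"
        using Cons Cons2 ys' by (simp add: \<Omega>_def dl_uminus)
      moreover have "mul (z - y) x (mul (w - z) x' x'') = mul (w - y) (mul (z - y) x x') x''"
        by (simp add: mul_assoc)
      moreover have "dl (dl \<Phi>) (x # xs) ys = - dl \<Phi> (mul (z - y) x x' # xs') (y # ys') - dl (sl (dl \<Phi>) x y) xs (z # ys')"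
        unfolding ys(1) Cons dl.simps(1) ..
      moreover have "dl \<Phi> (mul (z - y) x x' # xs') (y # ys')
          = - \<Phi> (mul (w - y) (mul (z - y) x x') x'' # xs'') (y # ys'') - dl (sl \<Phi> (mul (z - y) x x') y) xs' ys'"
        unfolding ys'(1) Cons2 dl.simps(1) ..
      ultimately show ?thesis unfolding 1 by simp
    qed
  qed
qed simp

lemma dm_cong:
  assumes "length ys = Suc (length xs)" "xs \<noteq> []"
    "\<And>as bs. Suc (length as) = length xs \<Longrightarrow> length bs = Suc (length as) \<Longrightarrow> \<Phi> as bs = \<Psi> as bs"
  shows "dm r \<Phi> xs ys = dm r \<Psi> xs ys"
  unfolding dm_def cup_def using assms dl_cong[of ys xs \<Phi> \<Psi>] by (cases xs; cases ys) auto

lemma dm_lin: "dm r (\<lambda>xs ys. \<Phi> xs ys + \<Psi> xs ys) xs ys = dm r \<Phi> xs ys + dm r \<Psi> xs ys"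
  "dm r (\<lambda>xs ys. \<Phi> xs ys - \<Psi> xs ys) xs ys = dm r \<Phi> xs ys - dm r \<Psi> xs ys"
  "dm r (\<lambda>xs ys. - \<Phi> xs ys) xs ys = - dm r \<Phi> xs ys"
  "dm r (\<lambda>xs ys. c * \<Phi> xs ys) xs ys = c * dm r \<Phi> xs ys"
  by (simp_all add: dm_def cup_def dl_add dl_diff dl_uminus dl_scale algebra_simps)

lemma dm_scale_last:
  assumes "length ys = Suc (length xs)" "xs \<noteq> []"
  shows "dm r (\<lambda>as bs. last bs * \<Phi> as bs) xs ys = last ys * dm r \<Phi> xs ys"
  using assms by (cases xs; cases ys; cases "tl ys") (auto simp: dm_def cup_def dl_scale_last algebra_simps)

lemma dm_dm:
  assumes r: "multiplicative r" and l: "length ys = Suc (length xs)" "length xs \<ge> 2"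
  shows "dm r (dm r \<Phi>) xs ys = 0"
proof -
  obtain x x' xs' where xs: "xs = x # x' # xs'" using l(2) by (cases xs; cases "tl xs") auto
  then obtain y z w ys' where ys: "ys = y # z # w # ys'" "length ys' = length xs'"
    using l by (auto simp: length_Suc_conv)
  have "dl (sl (cup r \<Phi>) x y) (x' # xs') (z # w # ys') = dl (\<lambda>as bs. r x y z * \<Phi> as bs) (x' # xs') (z # w # ys')"
    by (rule dl_cong) (use ys in \<open>auto simp: cup_def\<close>)
  then have "dl (cup r \<Phi>) xs ys = - (r x y z * (r x' z w * \<Phi> xs' (w # ys'))) - r x y z * dl \<Phi> (x' # xs') (z # w # ys')"
    using r unfolding xs ys by (simp add: dl_scale multiplicative_def)
  moreover have "dl (dm r \<Phi>) xs ys = dl (cup r \<Phi>) xs ys + dl (dl \<Phi>) xs ys"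
    unfolding dm_def[abs_def] by (rule dl_add)
  ultimately show ?thesis using dl_dl[OF l(1)] unfolding xs ys
    by (simp add: dm_def[of r "dm r \<Phi>"], simp add: dm_def algebra_simps)
qed

lemma coeff_diff_coeff_diff:
  assumes l: "length ys = Suc (length xs)" "length xs \<ge> 2"
  shows "coeff_diff (coeff_diff \<Phi>) h xs ys = 0"
proof -
  obtain x x' xs' where xs: "xs = x # x' # xs'" using l(2) by (cases xs; cases "tl xs") auto
  then obtain y z w ys' where ys: "ys = y # z # w # ys'" "length ys' = length xs'"
    using l by (auto simp: length_Suc_conv)
  have "dl (sl (coeff_cup \<Phi> h) x y) (x' # xs') (z # w # ys') = dl (\<Phi> (h * fp x y z)) (x' # xs') (z # w # ys')"
    by (rule dl_cong) (use ys in \<open>auto simp: coeff_cup_def\<close>)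
  then have "dl (coeff_cup \<Phi> h) xs ys = - \<Phi> (h * fp x y z * fp x' z w) xs' (w # ys') - dl (\<Phi> (h * fp x y z)) (x' # xs') (z # w # ys')"
    unfolding xs ys by (simp add: fp_mul mult.assoc)
  moreover have "dl (coeff_diff \<Phi> h) xs ys = dl (coeff_cup \<Phi> h) xs ys + dl (dl (\<Phi> h)) xs ys"
    unfolding coeff_diff_def[abs_def] by (rule dl_add)
  ultimately show ?thesis using dl_dl[OF l(1)] unfolding xs ys
    by (simp add: coeff_diff_def[of "coeff_diff \<Phi>"], simp add: coeff_diff_def)
qed

section \<open>Closure of cochains under the differentials\<close>

lemma mlin_add: "mlin n \<Phi> \<Longrightarrow> mlin n \<Psi> \<Longrightarrow> mlin n (\<lambda>xs ys. \<Phi> xs ys + \<Psi> xs ys)"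
  by (induction n arbitrary: \<Phi> \<Psi>) (auto intro: slot_add)

lemma mlin_scale: "mlin n \<Phi> \<Longrightarrow> mlin n (\<lambda>xs ys. c ys * \<Phi> xs ys)"
  by (induction n arbitrary: \<Phi> c) (auto intro: slot_scale)

lemma mlin_uminus: "mlin n \<Phi> \<Longrightarrow> mlin n (\<lambda>xs ys. - \<Phi> xs ys)"
  using mlin_scale[of n \<Phi> "\<lambda>_. -1"] by simp

lemma mlin_diff: "mlin n \<Phi> \<Longrightarrow> mlin n \<Psi> \<Longrightarrow> mlin n (\<lambda>xs ys. \<Phi> xs ys - \<Psi> xs ys)"
  using mlin_add[of n \<Phi> "\<lambda>xs ys. - \<Psi> xs ys"] by (simp add: mlin_uminus)

lemma mlin_zero: "mlin n (\<lambda>_ _. 0)"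
  by (induction n) (auto intro: slotI)

lemma mlin_hd: "(\<And>t. mlin n (\<Phi> t)) \<Longrightarrow> mlin n (\<lambda>xs ys. \<Phi> (hd ys) xs ys)"
  by (cases n) auto

lemma mlin_cong:
  assumes "mlin n \<Phi>" "\<And>xs ys. length xs = n \<Longrightarrow> length ys = Suc n \<Longrightarrow> \<Psi> xs ys = \<Phi> xs ys"
  shows "mlin n \<Psi>"
  using assms
proof (induction n arbitrary: \<Phi> \<Psi>)
  case (Suc n)
  have "mlin n (sl \<Psi> x y)" for x y
    by (rule Suc.IH[of "sl \<Phi> x y"]) (use Suc.prems in auto)
  then show ?case using Suc.prems by simp
qed simp

lemma lin_neg: "lin L \<Longrightarrow> L (- a) = - L a"
proof -
  assume L: "lin L"
  have "L (a + - a) = L a + L (- a)" using L unfolding lin_def by blast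
  then show ?thesis using lin_0[OF L] by (simp add: eq_neg_iff_add_eq_0 add.commute)
qed

lemma slot_mul_left:
  assumes L: "slot y w L"
  shows "slot y z (\<lambda>a. L (mul (z - y) a b))"
proof (rule slotI)
  show "L (mul (z - y) (dd a) b) = (y - z) * L (mul (z - y) a b)" for a
    unfolding mul_dd_left lin_neg[OF slotD(4)[OF L]] slotD(2)[OF L] by (simp add: left_diff_distrib)
qed (simp_all add: mul_add_left mul_sc_left slotD[OF L])

lemma slot_mul_right:
  assumes L: "slot y w L"
  shows "slot z w (\<lambda>b. L (mul (z - y) a b))"
proof (rule slotI)
  show "L (mul (z - y) a (dd b)) = (z - w) * L (mul (z - y) a b)" for b
    unfolding mul_dd_right slotD(1,2,3)[OF L] by (simp add: left_diff_distrib)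
qed (simp_all add: mul_add_right mul_sc_right slotD[OF L])

lemma mlin_dl: "mlin n \<Phi> \<Longrightarrow> mlin (Suc n) (dl \<Phi>)"
proof (induction n arbitrary: \<Phi>)
  case 0
  then show ?case by (auto intro: slotI)
next
  case (Suc n)
  have sl: "slot y z (\<lambda>x. \<Phi> (x # xs) (y # z # ys))" if "length xs = n" "length ys = n" for xs ys y z
    using Suc.prems that by simp
  have 1: "slot y z (\<lambda>x. dl \<Phi> (x # xs) (y # z # ys))" if l: "length xs = Suc n" "length ys = Suc n" for xs ys y z
  proof -
    obtain x' xs' w ys' where xs: "xs = x' # xs'" "length xs' = n" and ys: "ys = w # ys'" "length ys' = n"
      using l by (auto simp: length_Suc_conv)
    have sl': "slot y z (\<lambda>x. sl \<Phi> x y as bs)"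
      if ab: "Suc (length as) = length xs" "length bs = Suc (length as)" "hd bs = hd (z # ys)" for as bs
    proof -
      have "bs = z # tl bs" using ab by (cases bs) auto
      then show ?thesis using sl[of as "tl bs" y z] ab l by (metis Suc_inject length_tl diff_Suc_1)
    qed
    have "slot y z (\<lambda>x. dl (sl \<Phi> x y) xs (z # ys))"
    proof (rule slotI)
      show "dl (sl \<Phi> (a + b) y) xs (z # ys) = dl (sl \<Phi> a y) xs (z # ys) + dl (sl \<Phi> b y) xs (z # ys)" for a b
        unfolding dl_add[symmetric] by (rule dl_cong) (use l slotD[OF sl'] in auto)
      show "dl (sl \<Phi> (sc c a) y) xs (z # ys) = c * dl (sl \<Phi> a y) xs (z # ys)" for a c
        unfolding dl_scale[symmetric] by (rule dl_cong) (use l slotD[OF sl'] in auto)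
      show "dl (sl \<Phi> (dd a) y) xs (z # ys) = (y - z) * dl (sl \<Phi> a y) xs (z # ys)" for a
        unfolding dl_scale[symmetric] by (rule dl_cong) (use l slotD[OF sl'] in auto)
    qed
    moreover have "slot y z (\<lambda>x. \<Phi> (mul (z - y) x x' # xs') (y # w # ys'))"
      by (rule slot_mul_left[OF sl]) (use xs ys in auto)
    ultimately show ?thesis unfolding xs(1) ys(1) dl.simps(1) by (intro slot_diff slot_uminus)
  qed
  have 2: "mlin (Suc n) (sl (dl \<Phi>) x y)" for x y
  proof -
    define G where "G = (\<lambda>as bs. \<Phi> (mul (hd bs - y) x (hd as) # tl as) (y # tl bs))"
    have "mlin (Suc n) G"
      unfolding mlin.simps
    proof (intro conjI allI impI)
      fix as bs z w assume "length (as :: 'a list) = n" "length (bs :: 'k list) = n"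
      from slot_mul_right[OF sl[OF this]] show "slot z w (\<lambda>b. G (b # as) (z # w # bs))"
        by (simp add: G_def)
    next
      fix b z
      have "mlin n (sl \<Phi> (mul (z - y) x b) y)" using Suc.prems by simp
      then show "mlin n (sl G b z)" by (simp add: G_def)
    qed
    moreover have "mlin (Suc n) (dl (sl \<Phi> x y))" using Suc.prems by (intro Suc.IH) simp
    ultimately have "mlin (Suc n) (\<lambda>as bs. - G as bs - dl (sl \<Phi> x y) as bs)"
      by (intro mlin_diff mlin_uminus)
    then show ?thesis by (rule mlin_cong) (auto simp: G_def length_Suc_conv)
  qed
  show ?case using 1 2 by simp
qed

text \<open>\<open>dl\<close> freezes one vertex per step, but polynomiality has to be joint in all
  vertices. The family \<open>\<Psi>\<close> therefore depends on the \<open>k\<close> vertices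
  frozen so far, and \<open>k\<close> grows along the recursion.\<close>

lemma PF_dl_aux:
  assumes "\<And>ps. length ps = k \<Longrightarrow> mlin n (\<Psi> ps)"
    "\<And>xs. length xs = n \<Longrightarrow> PF (k + Suc n) (\<lambda>zs. \<Psi> (take k zs) xs (drop k zs))"
    "length xs = Suc n"
  shows "PF (k + Suc (Suc n)) (\<lambda>zs. dl (\<Psi> (take k zs)) xs (drop k zs))"
  using assms
proof (induction n arbitrary: k \<Psi> xs)
  case 0
  then show ?case by (intro PF_const[of _ _ 0]) (auto simp: length_Suc_conv)
next
  case (Suc n)
  let ?N = "k + Suc (Suc (Suc n))"
  obtain x x' xs' where xs: "xs = x # x' # xs'" "length xs' = n" using Suc.prems(3) by (auto simp: length_Suc_conv)
  have dk: "drop k zs = zs ! k # zs ! Suc k # drop (Suc (Suc k)) zs" if "length zs = ?N" for zs :: "'k list"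
    using that by (metis Cons_nth_drop_Suc Suc_le_eq add_Suc_right le_add1 le_imp_less_Suc less_SucI)
  have A: "PF ?N (\<lambda>zs. \<Psi> (take k zs) (a # xs') (zs ! k # drop (Suc (Suc k)) zs))" for a
  proof -
    have "PL ?N (k + Suc (Suc n)) (\<lambda>zs. take k zs @ (zs ! k # drop (Suc (Suc k)) zs))"
      by (rule PL_append[OF PL_take PL_Cons[OF PF_i PL_drop]]) simp_all
    from PF_PL[OF Suc.prems(2)[of "a # xs'"] this] xs(2)
    show ?thesis by (auto elim!: PF_cong)
  qed
  have L: "lin (\<lambda>a. \<Psi> (take k zs) (a # xs') (zs ! k # drop (Suc (Suc k)) zs))" if "length zs = ?N" for zs
  proof -
    have "length (take k zs) = k" using that by simp
    have "length (drop (Suc (Suc k)) zs) = Suc n" using that by simp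
    then obtain w ws where "drop (Suc (Suc k)) zs = w # ws" "length ws = n"
      unfolding length_Suc_conv by blast
    then show ?thesis using Suc.prems(1)[OF \<open>length (take k zs) = k\<close>] xs(2) by (auto simp: slot_def)
  qed
  have 1: "PF ?N (\<lambda>zs. \<Psi> (take k zs) (mul (zs ! Suc k - zs ! k) x x' # xs') (zs ! k # drop (Suc (Suc k)) zs))"
    by (rule PF_mul[OF PF_diff[OF PF_i PF_i] L A]) simp_all
  have "PF (Suc k + Suc (Suc n)) (\<lambda>zs. dl ((\<lambda>ps. sl (\<Psi> (take k ps)) x (ps ! k)) (take (Suc k) zs)) (x' # xs') (drop (Suc k) zs))"
  proof (rule Suc.IH)
    show "mlin n (sl (\<Psi> (take k ps)) x (ps ! k))" if "length ps = Suc k" for ps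
      using Suc.prems(1)[of "take k ps"] that by simp
    fix as :: "'a list" assume l: "length as = n"
    have "PF (k + Suc (Suc n)) (\<lambda>zs. \<Psi> (take k zs) (x # as) (drop k zs))" using Suc.prems(2)[of "x # as"] l by simp
    then show "PF (Suc k + Suc n) (\<lambda>zs. sl (\<Psi> (take k (take (Suc k) zs))) x (take (Suc k) zs ! k) as (drop (Suc k) zs))"
      unfolding add_Suc_right add_Suc by (rule PF_cong) (simp add: Cons_nth_drop_Suc min_def)
  qed (use xs in simp)
  then have 2: "PF ?N (\<lambda>zs. dl (sl (\<Psi> (take k zs)) x (zs ! k)) (x' # xs') (zs ! Suc k # drop (Suc (Suc k)) zs))"
    unfolding add_Suc_right add_Suc by (rule PF_cong) (simp add: dk min_def Cons_nth_drop_Suc)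
  show ?case
    by (rule PF_cong[OF PF_diff[OF PF_uminus[OF 1] 2]]) (simp add: dk xs)
qed

lemma CC_dl: "CC n \<Phi> \<Longrightarrow> CC (Suc n) (dl \<Phi>)"
  unfolding CC_def using mlin_dl[of n \<Phi>] PF_dl_aux[of 0 n "\<lambda>_. \<Phi>"] by simp

lemma CC_add: "CC n \<Phi> \<Longrightarrow> CC n \<Psi> \<Longrightarrow> CC n (\<lambda>xs ys. \<Phi> xs ys + \<Psi> xs ys)"
  unfolding CC_def by (simp add: mlin_add PF_add)

lemma CC_scale: "CC n \<Phi> \<Longrightarrow> PF (Suc n) c \<Longrightarrow> CC n (\<lambda>xs ys. c ys * \<Phi> xs ys)"
  unfolding CC_def by (simp add: mlin_scale PF_mult)

lemma CC_cmult: "CC n \<Phi> \<Longrightarrow> CC n (\<lambda>xs ys. c * \<Phi> xs ys)"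
  by (rule CC_scale) simp_all

lemma CC_uminus: "CC n \<Phi> \<Longrightarrow> CC n (\<lambda>xs ys. - \<Phi> xs ys)"
  unfolding CC_def by (simp add: mlin_uminus PF_uminus)

lemma CC_diff: "CC n \<Phi> \<Longrightarrow> CC n \<Psi> \<Longrightarrow> CC n (\<lambda>xs ys. \<Phi> xs ys - \<Psi> xs ys)"
  unfolding CC_def by (simp add: mlin_diff PF_diff)

lemma CC_zero: "CC n (\<lambda>_ _. 0)"
  by (simp add: CC_def mlin_zero)

lemma CC_sl: "CC (Suc n) \<Phi> \<Longrightarrow> CC n (sl \<Phi> x c)"
proof -
  assume a: "CC (Suc n) \<Phi>"
  have "PF (Suc n) (\<lambda>ys. \<Phi> (x # xs) (c # ys))" if "length xs = n" for xs
    using a that PF_PL[OF _ PL_Cons[OF PF_c PL_id], of "Suc n" "\<Phi> (x # xs)" c] by (simp add: CC_def)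
  then show ?thesis using a by (simp add: CC_def)
qed

lemma CC_last: "CC n \<Phi> \<Longrightarrow> CC n (\<lambda>xs ys. last ys * \<Phi> xs ys)"
  by (rule CC_scale[OF _ PF_last])

lemma CC_cup:
  assumes "char r" "CC n \<Phi>"
  shows "CC (Suc n) (cup r \<Phi>)"
proof -
  have "mlin (Suc n) (cup r \<Phi>)"
    unfolding mlin.simps
  proof (intro conjI allI impI)
    fix xs ys y z
    show "slot y z (\<lambda>x. cup r \<Phi> (x # xs) (y # z # ys))"
      using assms(1) by (simp add: char_def slot_mult)
  next
    fix x y
    have "mlin n (\<lambda>xs ys. r x y (hd ys) * \<Phi> xs ys)" using assms(2) by (intro mlin_scale) (simp add: CC_def)
    then show "mlin n (sl (cup r \<Phi>) x y)" by (simp add: cup_def)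
  qed
  moreover have "PF (Suc (Suc n)) (cup r \<Phi> xs)" if l: "length xs = Suc n" for xs
  proof -
    have "PF 2 (\<lambda>ys. r (hd xs) (ys ! 0) (ys ! 1))" using assms(1) by (simp add: char_def)
    moreover have "PL (Suc (Suc n)) 2 (\<lambda>ys. [hd ys, hd (tl ys)])"
      unfolding numeral_2_eq_2 by (rule PL_Cons[OF PF_hd PL_Cons[OF PF_hd_tl PL_Nil]])
    ultimately have "PF (Suc (Suc n)) (\<lambda>ys. (\<lambda>ys. r (hd xs) (ys ! 0) (ys ! 1)) [hd ys, hd (tl ys)])"
      by (rule PF_PL)
    then have "PF (Suc (Suc n)) (\<lambda>ys. r (hd xs) (hd ys) (hd (tl ys)))" by simp
    moreover have "PF (Suc (Suc n)) (\<lambda>ys. \<Phi> (tl xs) (tl ys))"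
    proof -
      have "PF (Suc n) (\<Phi> (tl xs))" using assms(2) l by (simp add: CC_def)
      from PF_PL[OF this PL_tl] show ?thesis .
    qed
    ultimately show ?thesis unfolding cup_def[abs_def] by (rule PF_mult)
  qed
  ultimately show ?thesis by (simp add: CC_def)
qed

lemma CC_dm: "char r \<Longrightarrow> CC n \<Phi> \<Longrightarrow> CC (Suc n) (dm r \<Phi>)"
  unfolding dm_def[abs_def] by (rule CC_add[OF CC_cup CC_dl])

section \<open>Cochains with values in functionals on polynomials\<close>

definition coeff_cochain :: "nat \<Rightarrow> ('k poly \<Rightarrow> 'a list \<Rightarrow> 'k list \<Rightarrow> 'k) \<Rightarrow> bool" where
  "coeff_cochain n \<Phi> \<longleftrightarrow> (\<forall>h. CC n (\<Phi> h)) \<and> (\<forall>xs ys. poly_lin (\<lambda>h. \<Phi> h xs ys))"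

definition polychar :: "('a \<Rightarrow> 'k \<Rightarrow> 'k \<Rightarrow> 'k poly) \<Rightarrow> bool" where
  "polychar R \<longleftrightarrow> (\<forall>x. PFP 2 (\<lambda>ys. R x (ys ! 0) (ys ! 1))) \<and>
    (\<forall>L y z. poly_lin L \<longrightarrow> slot y z (\<lambda>x. L (R x y z)))"

text \<open>A polynomial read off the first edge is fed to \<open>\<Phi>\<close> as test polynomial,
  which turns a coefficient cochain into a scalar one of the next degree.\<close>

definition tht :: "('a \<Rightarrow> 'k \<Rightarrow> 'k \<Rightarrow> 'k poly) \<Rightarrow> ('k poly \<Rightarrow> 'a list \<Rightarrow> 'k list \<Rightarrow> 'k) \<Rightarrow> 'a list \<Rightarrow> 'k list \<Rightarrow> 'k" where
  "tht R \<Phi> xs ys = \<Phi> (R (hd xs) (hd ys) (hd (tl ys))) (tl xs) (tl ys)"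

lemma poly_lin_mult: "poly_lin L \<Longrightarrow> poly_lin (\<lambda>h. L (h * p))"
  by (simp add: poly_lin_def distrib_right)

lemma plinD: "poly_lin L \<Longrightarrow> L (p + q) = L p + L q" "poly_lin L \<Longrightarrow> L (smult c p) = c * L p"
  by (simp_all add: poly_lin_def)

lemma poly_lin_diff: "poly_lin L \<Longrightarrow> L (p - q) = L p - L q"
  using plinD(1)[of L "p - q" q] by simp

lemma poly_lin_psum': "poly_lin (\<lambda>p. psum p f)"
  by (simp add: poly_lin_def psum_add psum_smult)

lemma coeff_cochain_CC: "coeff_cochain n \<Phi> \<Longrightarrow> CC n (\<Phi> h)" and coeff_cochain_poly_lin: "coeff_cochain n \<Phi> \<Longrightarrow> poly_lin (\<lambda>h. \<Phi> h xs ys)"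
  by (simp_all add: coeff_cochain_def)

lemma polycharD: "polychar R \<Longrightarrow> poly_lin L \<Longrightarrow> slot y z (\<lambda>x. L (R x y z))"
  by (simp add: polychar_def)

lemma add_minus_eq_0: "a + (- b - c) = 0 \<Longrightarrow> a = b + (c::'k)"
  by (metis add_diff_cancel_right' diff_minus_eq_add minus_add_distrib right_minus_eq add_uminus_conv_diff)

lemma CC_tht:
  assumes R: "polychar R" and \<Phi>: "coeff_cochain n \<Phi>"
  shows "CC (Suc n) (tht R \<Phi>)"
proof -
  have "mlin (Suc n) (tht R \<Phi>)"
    unfolding mlin.simps
  proof (intro conjI allI impI)
    fix xs ys y z
    show "slot y z (\<lambda>x. tht R \<Phi> (x # xs) (y # z # ys))"
      using polycharD[OF R coeff_cochain_poly_lin[OF \<Phi>, of xs "z # ys"], of y z] by (simp add: tht_def)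
  next
    fix x y
    have "mlin n (\<lambda>xs ys. \<Phi> (R x y (hd ys)) xs ys)"
      by (rule mlin_hd) (use coeff_cochain_CC[OF \<Phi>] in \<open>simp add: CC_def\<close>)
    then show "mlin n (sl (tht R \<Phi>) x y)" by (simp add: tht_def)
  qed
  moreover have "PF (Suc (Suc n)) (tht R \<Phi> xs)" if l: "length xs = Suc n" for xs
  proof -
    have "PFP 2 (\<lambda>ys. R (hd xs) (ys ! 0) (ys ! 1))" using R by (simp add: polychar_def)
    moreover have "PL (Suc (Suc n)) 2 (\<lambda>ys. [hd ys, hd (tl ys)])"
      unfolding numeral_2_eq_2 by (rule PL_Cons[OF PF_hd PL_Cons[OF PF_hd_tl PL_Nil]])
    ultimately have "PFP (Suc (Suc n)) (\<lambda>ys. (\<lambda>ys. R (hd xs) (ys ! 0) (ys ! 1)) [hd ys, hd (tl ys)])"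
      by (rule PFP_PL)
    then have P: "PFP (Suc (Suc n)) (\<lambda>ys. R (hd xs) (hd ys) (hd (tl ys)))" by simp
    have "PF (Suc n) (\<Phi> (monom 1 j) (tl xs))" for j
      using coeff_cochain_CC[OF \<Phi>] l by (simp add: CC_def)
    from PF_psum[OF P PF_PL[OF this PL_tl]]
    have "PF (Suc (Suc n)) (\<lambda>ys. psum (R (hd xs) (hd ys) (hd (tl ys))) (\<lambda>j. \<Phi> (monom 1 j) (tl xs) (tl ys)))" .
    then show ?thesis
      by (rule PF_cong) (simp add: tht_def poly_lin_psum[OF coeff_cochain_poly_lin[OF \<Phi>], symmetric])
  qed
  ultimately show ?thesis by (simp add: CC_def)
qed

lemma tht_Cons [simp]: "tht R \<Phi> (x # xs) (y # z # ys) = \<Phi> (R x y z) xs (z # ys)"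
  by (simp add: tht_def)

lemma polychar_fp: "polychar (\<lambda>x y z. h * fp x y z)"
proof -
  have "PFP 2 (\<lambda>ys. fp x (ys ! 0) (ys ! 1))" for x by (rule fp_PFP[OF PF_i PF_i]) simp_all
  from PFP_mult[OF PFP_const this] show ?thesis by (simp add: polychar_def slot_poly_lin_fp)
qed

lemma coeff_cochain_add_eq: "coeff_cochain n \<Phi> \<Longrightarrow> \<Phi> (p + q) = (\<lambda>xs ys. \<Phi> p xs ys + \<Phi> q xs ys)"
  and coeff_cochain_smult_eq: "coeff_cochain n \<Phi> \<Longrightarrow> \<Phi> (smult c p) = (\<lambda>xs ys. c * \<Phi> p xs ys)"
  by (intro ext, simp add: coeff_cochain_def poly_lin_def)+

lemma coeff_cochain_coeff_diff: "coeff_cochain n \<Phi> \<Longrightarrow> coeff_cochain (Suc n) (coeff_diff \<Phi>)"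
proof -
  assume \<Phi>: "coeff_cochain n \<Phi>"
  have "coeff_cup \<Phi> h = tht (\<lambda>x y z. h * fp x y z) \<Phi>" for h
    by (simp add: coeff_cup_def[abs_def] tht_def[abs_def])
  then have "CC (Suc n) (coeff_diff \<Phi> h)" for h
    unfolding coeff_diff_def[abs_def] using CC_tht[OF polychar_fp \<Phi>, of h] CC_dl[OF coeff_cochain_CC[OF \<Phi>]]
    by (intro CC_add) simp_all
  moreover have "poly_lin (\<lambda>h. coeff_diff \<Phi> h xs ys)" for xs ys
    using poly_lin_mult[OF coeff_cochain_poly_lin[OF \<Phi>, of "tl xs" "tl ys"]]
    by (simp add: poly_lin_def coeff_diff_def coeff_cup_def coeff_cochain_add_eq[OF \<Phi>] coeff_cochain_smult_eq[OF \<Phi>] dl_add dl_scale algebra_simps)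
  ultimately show ?thesis by (simp add: coeff_cochain_def)
qed

lemma coeff_cochain_add: "coeff_cochain n \<Phi> \<Longrightarrow> coeff_cochain n \<Psi> \<Longrightarrow> coeff_cochain n (\<lambda>h xs ys. \<Phi> h xs ys + \<Psi> h xs ys)"
  unfolding coeff_cochain_def by (simp add: CC_add poly_lin_def algebra_simps)

lemma coeff_cochain_diff: "coeff_cochain n \<Phi> \<Longrightarrow> coeff_cochain n \<Psi> \<Longrightarrow> coeff_cochain n (\<lambda>h xs ys. \<Phi> h xs ys - \<Psi> h xs ys)"
  unfolding coeff_cochain_def by (simp add: CC_diff poly_lin_def algebra_simps)

lemma coeff_diff_lin: "coeff_diff (\<lambda>h xs ys. \<Phi> h xs ys + \<Psi> h xs ys) h xs ys = coeff_diff \<Phi> h xs ys + coeff_diff \<Psi> h xs ys"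
  "coeff_diff (\<lambda>h xs ys. \<Phi> h xs ys - \<Psi> h xs ys) h xs ys = coeff_diff \<Phi> h xs ys - coeff_diff \<Psi> h xs ys"
  by (simp_all add: coeff_diff_def coeff_cup_def dl_add dl_diff)

subsection \<open>Localisation of the first slot\<close>

text \<open>Inserting \<open>v\<close> on a loop at the first vertex \<open>y\<close> compares
  \<open>X\<close> with the scalar \<open>y\<close>, because merging along the loop yields
  \<open>X x\<close>. By \<open>quo_X\<close>, \<open>quo y\<close> is a homotopy between these two
  operators.\<close>

definition loc :: "('a list \<Rightarrow> 'k list \<Rightarrow> 'k) \<Rightarrow> 'a list \<Rightarrow> 'k list \<Rightarrow> 'k" where
  "loc \<phi> xs ys = (case xs of [] \<Rightarrow> 0 | x # xs' \<Rightarrow> \<phi> (v # quo (hd ys) x # xs') (hd ys # ys))"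

lemma CC_loc:
  assumes "CC (Suc n) \<phi>"
  shows "CC n (loc \<phi>)"
proof (cases n)
  case 0
  then show ?thesis by (simp add: CC_def loc_def[abs_def])
next
  case (Suc m)
  have sl: "mlin (Suc m) (sl \<phi> v y)" for y using assms Suc by (simp add: CC_def)
  have "mlin (Suc m) (loc \<phi>)"
    unfolding mlin.simps
  proof (intro conjI allI impI)
    fix xs ys y z assume l: "length (xs :: 'a list) = m" "length (ys :: 'k list) = m"
    have s: "slot y z (\<lambda>x. \<phi> (v # x # xs) (y # y # z # ys))" using sl[of y] l by simp
    show "slot y z (\<lambda>x. loc \<phi> (x # xs) (y # z # ys))"
      by (rule slotI) (simp_all add: loc_def quo_add quo_sc quo_dd slotD[OF s])
  next
    fix x y
    show "mlin m (sl (loc \<phi>) x y)" using sl[of y] by (simp add: loc_def)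
  qed
  moreover have "PF (Suc n) (loc \<phi> xs)" if l: "length xs = n" for xs
  proof -
    obtain x xs' where xs: "xs = x # xs'" "length xs' = m" using l Suc by (auto simp: length_Suc_conv)
    have "PF (Suc (Suc n)) (\<phi> (v # a # xs'))" for a using assms Suc xs(2) by (simp add: CC_def)
    from PF_PL[OF this PL_Cons[OF PF_hd PL_id]] have A: "PF (Suc n) (\<lambda>ys. \<phi> (v # a # xs') (hd ys # ys))" for a .
    have L: "lin (\<lambda>a. \<phi> (v # a # xs') (hd ys # ys))" if len: "length ys = Suc n" for ys
    proof -
      obtain y z ys' where "ys = y # z # ys'" "length ys' = m" using len Suc by (auto simp: length_Suc_conv)
      then show ?thesis using sl[of y] xs(2) by (simp add: slot_def)
    qed
    have "loc \<phi> xs = (\<lambda>ys. \<phi> (v # quo (hd ys) x # xs') (hd ys # ys))"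
      unfolding xs(1) loc_def[abs_def] by simp
    then show ?thesis using PF_quo[OF PF_hd L A, of x] by simp
  qed
  ultimately show ?thesis using Suc by (simp add: CC_def)
qed

lemma loc_Cons: "loc \<phi> (x # xs) (y # ys) = \<phi> (v # quo y x # xs) (y # y # ys)"
  by (simp add: loc_def)

text \<open>Replacing \<open>x\<close> by \<open>X x\<close> and subtracting \<open>y\<close> times
  the original turns \<open>quo y x\<close> into \<open>x\<close> in every term of
  \<open>dl (loc \<phi>)\<close>; what remains is the defect of locality recorded by the cocycle
  identity in the last assumption.\<close>

lemma loc_local:
  assumes \<phi>: "CC (Suc n) \<phi>" and l: "length xs = n" "length ys = n"
    and coc: "y * \<phi> (x # xs) (y # z # ys) = \<phi> (X x # xs) (y # z # ys) + dl (sl \<phi> v y) (x # xs) (y # z # ys)"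
  shows "\<phi> (X x # xs) (y # z # ys) + dl (loc \<phi>) (X x # xs) (y # z # ys)
    = y * (\<phi> (x # xs) (y # z # ys) + dl (loc \<phi>) (x # xs) (y # z # ys))"
proof (cases n)
  case 0
  then show ?thesis using l coc by simp
next
  case (Suc m)
  obtain x' xs' where xs: "xs = x' # xs'" "length xs' = m" using l(1) Suc by (auto simp: length_Suc_conv)
  obtain w ys' where ys: "ys = w # ys'" "length ys' = m" using l(2) Suc by (auto simp: length_Suc_conv)
  have q: "\<phi> (v # quo y (X a) # as) (y # y # bs) = \<phi> (v # a # as) (y # y # bs) + y * \<phi> (v # quo y a # as) (y # y # bs)"
    if "length as = m" "length bs = Suc m" for a as bs
  proof -
    obtain b bs' where "bs = b # bs'" "length bs' = m" using \<open>length bs = Suc m\<close> by (auto simp: length_Suc_conv)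
    then have "slot y b (\<lambda>x. \<phi> (v # x # as) (y # y # bs))" using \<phi> that Suc by (simp add: CC_def)
    from slotD(1,2)[OF this] show ?thesis by (simp add: quo_X)
  qed
  have "dl (sl (loc \<phi>) (X x) y) (x' # xs') (z # w # ys')
      = dl (\<lambda>as bs. \<phi> (v # x # as) (y # y # bs) + y * sl (loc \<phi>) x y as bs) (x' # xs') (z # w # ys')"
    by (rule dl_cong) (use ys xs q in \<open>auto simp: loc_Cons\<close>)
  then have 1: "dl (sl (loc \<phi>) (X x) y) (x' # xs') (z # w # ys') =
      dl (\<lambda>as bs. \<phi> (v # x # as) (y # y # bs)) (x' # xs') (z # w # ys') + y * dl (sl (loc \<phi>) x y) (x' # xs') (z # w # ys')"
    by (simp add: dl_add dl_scale)
  have 2: "loc \<phi> (mul (z - y) (X x) x' # xs') (y # w # ys') = \<phi> (v # mul (z - y) x x' # xs') (y # y # w # ys')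
      + y * loc \<phi> (mul (z - y) x x' # xs') (y # w # ys')"
    using q[of xs' "w # ys'"] xs ys by (simp add: loc_Cons mul_X_left)
  show ?thesis using coc 1 2 unfolding xs(1) ys(1) by (simp add: algebra_simps)
qed

definition X_local :: "nat \<Rightarrow> 'k \<Rightarrow> ('a list \<Rightarrow> 'k list \<Rightarrow> 'k) \<Rightarrow> bool" where
  "X_local n y \<phi> \<longleftrightarrow> (\<forall>x xs z ys. length xs = n \<longrightarrow> length ys = n \<longrightarrow> \<phi> (X x # xs) (y # z # ys) = y * \<phi> (x # xs) (y # z # ys))"

lemma X_local_expand:
  assumes "CC (Suc n) \<phi>" "X_local n y \<phi>" "length xs = n" "length ys = n"
  shows "\<phi> (x # xs) (y # z # ys) = gev x y z * \<phi> (v # xs) (y # z # ys)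
    + psum (rp x y z) (\<lambda>j. \<phi> (E j # xs) (y # z # ys))"
  by (rule slot_expand[where L = "\<lambda>x. \<phi> (x # xs) (y # z # ys)"]) (use assms in \<open>simp_all add: CC_def X_local_def\<close>)

lemma mul_loop: "mul (y - y) v x = X x"
  by (simp add: X_def)

definition closed_at :: "('a \<Rightarrow> 'k \<Rightarrow> 'k \<Rightarrow> 'k) \<Rightarrow> nat \<Rightarrow> 'k \<Rightarrow> ('a list \<Rightarrow> 'k list \<Rightarrow> 'k) \<Rightarrow> bool" where
  "closed_at r n y \<phi> \<longleftrightarrow> (\<forall>xs ys. length xs = Suc n \<longrightarrow> length ys = Suc n \<longrightarrow> dm r \<phi> xs (y # ys) = 0)"

lemma closed_at_dm: "multiplicative r \<Longrightarrow> closed_at r (Suc n) y (dm r \<phi>)"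
  by (simp add: closed_at_def dm_dm)

lemma closed_at_add: "closed_at r n y \<phi> \<Longrightarrow> closed_at r n y \<psi> \<Longrightarrow> closed_at r n y (\<lambda>xs ys. \<phi> xs ys + \<psi> xs ys)"
  by (simp add: closed_at_def dm_lin)

lemma localize_dm:
  assumes \<phi>: "CC (Suc n) \<phi>" and c: "closed_at r0 (Suc n) y \<phi>"
  shows "X_local n y (\<lambda>xs ys. \<phi> xs ys + dm r0 (loc \<phi>) xs ys)"
  unfolding X_local_def
proof (intro allI impI)
  fix x xs z ys assume l: "length (xs :: 'a list) = n" "length (ys :: 'k list) = n"
  \<comment> \<open>The first edge is a loop at \<open>y\<close>: there \<open>r0\<close> of
    \<open>v\<close> is \<open>y\<close>, and the merge has parameter 0.\<close>
  have "dm r0 \<phi> (v # x # xs) (y # y # z # ys) = 0" using c l by (simp add: closed_at_def)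
  then have "y * \<phi> (x # xs) (y # z # ys) = \<phi> (X x # xs) (y # z # ys) + dl (sl \<phi> v y) (x # xs) (y # z # ys)"
    unfolding dm_def cup_Cons dl.simps(1) mul_loop by (intro add_minus_eq_0) (simp add: r0_def gev_v)
  from loc_local[OF \<phi> l this]
  show "\<phi> (X x # xs) (y # z # ys) + dm r0 (loc \<phi>) (X x # xs) (y # z # ys) =
      y * (\<phi> (x # xs) (y # z # ys) + dm r0 (loc \<phi>) (x # xs) (y # z # ys))"
    by (simp add: dm_def r0_def gev_X algebra_simps)
qed

definition coeff_cocycle :: "nat \<Rightarrow> ('k poly \<Rightarrow> 'a list \<Rightarrow> 'k list \<Rightarrow> 'k) \<Rightarrow> bool" where
  "coeff_cocycle n \<Phi> \<longleftrightarrow> coeff_cochain n \<Phi> \<and> (\<forall>h xs ys. length xs = Suc n \<longrightarrow> length ys = Suc (Suc n) \<longrightarrow> coeff_diff \<Phi> h xs ys = 0)"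

lemma coeff_cochain_loc: "coeff_cochain (Suc n) \<Phi> \<Longrightarrow> coeff_cochain n (\<lambda>h. loc (\<Phi> h))"
  unfolding coeff_cochain_def by (auto simp: CC_loc loc_def poly_lin_def split: list.split)

lemma localize_coeff_diff:
  assumes \<Phi>: "coeff_cocycle (Suc n) \<Phi>"
  shows "X_local n y (\<lambda>xs ys. \<Phi> h xs ys + coeff_diff (\<lambda>h. loc (\<Phi> h)) h xs ys)"
  unfolding X_local_def
proof (intro allI impI)
  have coeff_cochain: "coeff_cochain (Suc n) \<Phi>" using \<Phi> by (simp add: coeff_cocycle_def)
  fix x xs z ys assume l: "length (xs :: 'a list) = n" "length (ys :: 'k list) = n"
  have "coeff_diff \<Phi> h (v # x # xs) (y # y # z # ys) = 0" using \<Phi> l by (simp add: coeff_cocycle_def)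
  moreover have "h * fp v y y = smult y h" by (simp add: fp_v)
  ultimately have "y * \<Phi> h (x # xs) (y # z # ys) = \<Phi> h (X x # xs) (y # z # ys) + dl (sl (\<Phi> h) v y) (x # xs) (y # z # ys)"
    unfolding coeff_diff_def coeff_cup_Cons dl.simps(1) mul_loop by (intro add_minus_eq_0) (simp add: coeff_cochain_smult_eq[OF coeff_cochain])
  from loc_local[OF coeff_cochain_CC[OF coeff_cochain] l this]
  have "\<Phi> h (X x # xs) (y # z # ys) + dl (loc (\<Phi> h)) (X x # xs) (y # z # ys) =
    y * (\<Phi> h (x # xs) (y # z # ys) + dl (loc (\<Phi> h)) (x # xs) (y # z # ys))" .
  moreover have "h * fp (X x) y z = smult y (h * fp x y z)" by (simp add: fp_X)
  ultimately show "\<Phi> h (X x # xs) (y # z # ys) + coeff_diff (\<lambda>h. loc (\<Phi> h)) h (X x # xs) (y # z # ys) =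
      y * (\<Phi> h (x # xs) (y # z # ys) + coeff_diff (\<lambda>h. loc (\<Phi> h)) h (x # xs) (y # z # ys))"
    using coeff_cochain_smult_eq[OF coeff_cochain_loc[OF coeff_cochain], of y "h * fp x y z"] unfolding coeff_diff_def coeff_cup_Cons by (simp add: algebra_simps)
qed

subsection \<open>Changing the base vertex\<close>

text \<open>The product of the linear polynomials of \<open>v\<close> from \<open>y\<close> to
  \<open>z\<close> and of \<open>v\<close> from \<open>z\<close> to \<open>w\<close> agrees with
  \<open>z\<close> times the one from \<open>y\<close> to \<open>w\<close> at \<open>d = 0\<close>
  and at \<open>d = 1\<close>. The difference is thus a multiple of \<open>ee\<close>, with the
  constant factor \<open>(z - y) * (z - w)\<close>.\<close>

lemma rp_mul_v: "rp (mul (z - y) v x) y w = [:(z - y) * (z - w) * gev x z w:] + [:y, z - y:] * rp x z w"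
proof (rule rp_eqI)
  have "fp (mul (z - y) v x) y w = smult (gev x z w) ([:y, z - y:] * [:z, w - z:]) + ee * ([:y, z - y:] * rp x z w)"
    unfolding fp_mul fp_v fp_eq[of x] by (simp only: distrib_left mult_smult_right) (simp only: mult.left_commute)
  also have "[:y, z - y:] * [:z, w - z:] = smult z [:y, w - y:] + ee * [:(z - y) * (z - w):]"
    by (simp add: algebra_simps)
  finally show "fp (mul (z - y) v x) y w = smult (gev (mul (z - y) v x) y w) [:y, w - y:]
      + ee * ([:(z - y) * (z - w) * gev x z w:] + [:y, z - y:] * rp x z w)"
    unfolding gev_mul gev_v
    by (simp only: distrib_left smult_add_right smult_smult mult_smult_right[symmetric]) (simp add: algebra_simps)
qed

lemma rp_mul: "rp (mul (z - y) a x) y w = smult (gev a y z) (rp (mul (z - y) v x) y w) + rp a y z * fp x z w"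
proof (rule rp_eqI)
  have "fp (mul (z - y) a x) y w = smult (gev a y z) ([:y, z - y:] * fp x z w) + ee * (rp a y z * fp x z w)"
    unfolding fp_mul fp_eq[of a] by (simp only: distrib_right mult_smult_left mult.assoc)
  also have "[:y, z - y:] * fp x z w = fp (mul (z - y) v x) y w" by (simp add: fp_mul fp_v)
  also have "\<dots> = smult (z * gev x z w) [:y, w - y:] + ee * rp (mul (z - y) v x) y w"
    unfolding fp_eq[of "mul (z - y) v x"] gev_mul gev_v by simp
  finally show "fp (mul (z - y) a x) y w = smult (gev (mul (z - y) a x) y w) [:y, w - y:]
      + ee * (smult (gev a y z) (rp (mul (z - y) v x) y w) + rp a y z * fp x z w)"
    unfolding gev_mul by (simp only: smult_add_right smult_smult distrib_left mult_smult_right add.assoc) (simp add: ac_simps)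
qed

text \<open>Up to the factor \<open>d (1 - d)\<close> this is the element \<open>v\<^sub>1\<^sub>y x - y g(x) v\<^sub>1\<^sub>z\<close>: it measures the failure of
  \<open>v\<close> to trivialise the representation at the base vertex 1, where \<open>v\<close> is invertible.\<close>

definition rz :: "'a \<Rightarrow> 'k \<Rightarrow> 'k \<Rightarrow> 'k poly" where
  "rz x y z = rp (mul (y - 1) v x) 1 z"

lemma rz_eq: "rz x y z = [:(y - 1) * (y - z) * gev x y z:] + [:1, y - 1:] * rp x y z"
  unfolding rz_def rp_mul_v ..

text \<open>Associativity of \<open>v\<close>, \<open>x\<close>, \<open>x'\<close> makes
  \<open>rz\<close> a derivation with the character \<open>r0\<close> acting on the left and the
  representation \<open>fp\<close> on the right.\<close>

lemma rz_mul: "rz (mul (z - y) x x') y w = smult (r0 x y z) (rz x' z w) + rz x y z * fp x' z w"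
proof -
  have *: "mul (y - 1) v (mul (z - y) x x') = mul (z - 1) (mul (y - 1) v x) x'"
    by (simp add: mul_assoc)
  show ?thesis unfolding rz_def * rp_mul[of z 1 "mul (y - 1) v x"] gev_mul by (simp add: r0_def gev_v)
qed

lemma slot_poly_lin_const:
  assumes L: "poly_lin L"
  shows "slot y z (\<lambda>x. L [:c * gev x y z:])"
proof -
  have "L [:a:] = a * L 1" for a using plinD(2)[OF L, of a 1] by simp
  then have "(\<lambda>x. L [:c * gev x y z:]) = (\<lambda>x. c * L 1 * gev x y z)" by (simp add: fun_eq_iff)
  then show ?thesis by (simp only:) (rule slot_scale[OF slot_gev])
qed

lemma polychar_rz: "polychar rz"
proof -
  have g: "PF 2 (\<lambda>ys. gev x (ys ! 0) (ys ! 1))" for x by (rule gev_PF[OF PF_i PF_i]) simp_all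
  have r: "PFP 2 (\<lambda>ys. rp x (ys ! 0) (ys ! 1))" for x by (rule rp_PFP[OF PF_i PF_i]) simp_all
  have y: "PF 2 (\<lambda>ys. (ys ! 0) - (1::'k))" by (rule PF_diff[OF PF_i PF_c]) simp
  have yz: "PF 2 (\<lambda>ys. ys ! 0 - ys ! 1 :: 'k)" by (rule PF_diff[OF PF_i PF_i]) simp_all
  have "PFP 2 (\<lambda>ys. rz x (ys ! 0) (ys ! 1))" for x
    unfolding rz_eq
    by (rule PFP_add[OF PFP_PF[OF PF_mult[OF PF_mult[OF y yz] g]] PFP_mult[OF PFP_pCons[OF PF_c PFP_PF[OF y]] r]])
  moreover have "slot y z (\<lambda>x. L (rz x y z))" if L: "poly_lin L" for L y z
  proof -
    have "slot y z (\<lambda>x. L ([:1, y - 1:] * rp x y z))"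
      by (rule slotI) (simp_all add: rp_add rp_sc rp_dd plinD[OF L] distrib_left del: mult_pCons_left)
    from slot_add[OF slot_poly_lin_const[OF L] this] show ?thesis unfolding rz_eq by (simp add: plinD[OF L] del: mult_pCons_left)
  qed
  ultimately show ?thesis by (simp add: polychar_def)
qed

text \<open>By the product rule \<open>rz_mul\<close>, pairing with \<open>rz\<close> commutes up to
  sign with the differentials, so it turns coefficient coboundaries into coboundaries for
  \<open>r0\<close>.\<close>

lemma tht_coeff_diff:
  assumes "coeff_cochain n \<Theta>" "length xs = Suc n" "length ys = Suc (Suc n)"
  shows "tht rz (coeff_diff \<Theta>) (x # xs) (y # ys) = - dm r0 (tht rz \<Theta>) (x # xs) (y # ys)"
proof -
  obtain x' xs' where xs: "xs = x' # xs'" "length xs' = n" using assms(2) by (auto simp: length_Suc_conv)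
  obtain z w ys' where ys: "ys = z # w # ys'" "length ys' = n" using assms(3) by (auto simp: length_Suc_conv)
  have "dl (sl (tht rz \<Theta>) x y) (x' # xs') (z # w # ys') = dl (\<Theta> (rz x y z)) (x' # xs') (z # w # ys')"
    by (rule dl_cong) (use xs ys in \<open>auto simp: tht_def\<close>)
  moreover have "\<Theta> (rz (mul (z - y) x x') y w) xs' (w # ys')
      = r0 x y z * \<Theta> (rz x' z w) xs' (w # ys') + \<Theta> (rz x y z * fp x' z w) xs' (w # ys')"
    unfolding rz_mul using coeff_cochain_poly_lin[OF assms(1)] by (simp add: poly_lin_def)
  ultimately show ?thesis
    unfolding xs(1) ys(1) dm_def dl.simps(1) cup_Cons tht_Cons coeff_diff_def coeff_cup_Cons by (simp add: algebra_simps)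
qed

lemma CC_sum: "(\<And>i. CC n (f i)) \<Longrightarrow> CC n (\<lambda>xs ys. \<Sum>i\<in>I. f i xs ys)"
  by (induction I rule: infinite_finite_induct) (simp_all add: CC_zero CC_add)

lemma CC_psum: "(\<And>j. CC n (f j)) \<Longrightarrow> CC n (\<lambda>xs ys. psum r (\<lambda>j. f j xs ys))"
  unfolding psum_def by (rule CC_sum) (rule CC_cmult)

definition E_coeffs :: "('a list \<Rightarrow> 'k list \<Rightarrow> 'k) \<Rightarrow> 'k \<Rightarrow> 'k poly \<Rightarrow> 'a list \<Rightarrow> 'k list \<Rightarrow> 'k" where
  "E_coeffs \<phi> b r xs ys = psum r (\<lambda>j. \<phi> (E j # xs) (b # ys))"

lemma coeff_cochain_E_coeffs:
  assumes "CC (Suc n) \<phi>"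
  shows "coeff_cochain n (E_coeffs \<phi> b)"
proof -
  have "CC n (\<lambda>xs ys. psum r (\<lambda>j. sl \<phi> (E j) b xs ys))" for r
    by (rule CC_psum) (rule CC_sl[OF assms])
  then show ?thesis by (simp add: coeff_cochain_def E_coeffs_def[abs_def] poly_lin_psum')
qed

lemma E_coeffs_expand:
  assumes "CC (Suc n) \<phi>" "X_local n b \<phi>" "length xs = n" "length ys = n"
  shows "\<phi> (x # xs) (b # z # ys) = gev x b z * \<phi> (v # xs) (b # z # ys) + E_coeffs \<phi> b (rp x b z) xs (z # ys)"
  unfolding E_coeffs_def by (rule X_local_expand[OF assms])

lemma E_coeffs_mul_E:
  assumes "CC (Suc n) \<phi>" "X_local n b \<phi>" "length xs = n" "length ys = n"
  shows "\<phi> (mul (z - b) (E j) x # xs) (b # w # ys) = E_coeffs \<phi> b (monom 1 j * fp x z w) xs (w # ys)"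
proof -
  have "rp (mul (z - b) (E j) x) b w = monom 1 j * fp x z w"
    by (rule rp_eqI) (simp only: fp_mul gev_mul fp_E gev_E, simp add: mult.assoc del: mult_pCons_left mult_pCons_right)
  then show ?thesis using E_coeffs_expand[OF assms, of "mul (z - b) (E j) x" w] by (simp add: gev_mul gev_E)
qed

text \<open>\<open>gev\<close> kills the \<open>E j\<close>, so the cocycle identity with
  \<open>E j\<close> in front has no action term. Merging \<open>E j\<close> with \<open>x\<close>
  multiplies its polynomial by \<open>fp x\<close>, which is exactly the action on
  coefficients.\<close>

lemma coeff_cocycle_E_coeffs:
  assumes \<phi>: "CC (Suc n) \<phi>" and c: "closed_at r0 (Suc n) b \<phi>" and J: "X_local n b \<phi>"
  shows "coeff_cocycle n (E_coeffs \<phi> b)"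
proof -
  have coeff_cochain: "coeff_cochain n (E_coeffs \<phi> b)" by (rule coeff_cochain_E_coeffs[OF \<phi>])
  have "coeff_diff (E_coeffs \<phi> b) r xs ys = 0" if l: "length xs = Suc n" "length ys = Suc (Suc n)" for r xs ys
  proof -
    obtain x xs' where xs: "xs = x # xs'" "length xs' = n" using l(1) by (auto simp: length_Suc_conv)
    obtain z w ys' where ys: "ys = z # w # ys'" "length ys' = n" using l(2) by (auto simp: length_Suc_conv)
    have d: "dl (sl \<phi> (E j) b) (x # xs') (z # w # ys') = - E_coeffs \<phi> b (monom 1 j * fp x z w) xs' (w # ys')" for j
    proof -
      have "dm r0 \<phi> (E j # x # xs') (b # z # w # ys') = 0" using c xs ys by (simp add: closed_at_def)
      then have "\<phi> (mul (z - b) (E j) x # xs') (b # w # ys') + dl (sl \<phi> (E j) b) (x # xs') (z # w # ys') = 0"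
        unfolding dm_def cup_Cons dl.simps(1) by (simp add: r0_def gev_E add_eq_0_iff)
      then show ?thesis unfolding E_coeffs_mul_E[OF \<phi> J xs(2) ys(2)] by (simp add: add_eq_0_iff)
    qed
    have "dl (E_coeffs \<phi> b r) xs ys = psum r (\<lambda>j. dl (sl \<phi> (E j) b) xs ys)"
      unfolding E_coeffs_def[abs_def] by (rule dl_psum)
    also have "\<dots> = - psum r (\<lambda>j. E_coeffs \<phi> b (monom 1 j * fp x z w) xs' (w # ys'))"
      unfolding xs(1) ys(1) d by (simp add: psum_def sum_negf)
    also have "\<dots> = - E_coeffs \<phi> b (r * fp x z w) xs' (w # ys')"
      by (subst poly_lin_psum[OF poly_lin_mult[OF coeff_cochain_poly_lin[OF coeff_cochain]], of r]) simp
    finally show ?thesis unfolding xs(1) ys(1) coeff_diff_def coeff_cup_Cons by simp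
  qed
  then show ?thesis using coeff_cochain by (simp add: coeff_cocycle_def)
qed

text \<open>On an edge that starts at 1, \<open>r0\<close> of \<open>v\<close> equals 1, so the
  cocycle identity with \<open>v\<close> in front can be solved for \<open>\<phi>\<close>. In the
  expansion of the merged element the \<open>v\<close> part completes the differential and the
  \<open>E\<close> part is \<open>rz\<close>.\<close>

lemma base_change_1:
  assumes \<phi>: "CC (Suc n) \<phi>" and c: "closed_at r0 (Suc n) 1 \<phi>" and J: "X_local n 1 \<phi>"
    and l: "length xs = n" "length ys = n"
  shows "\<phi> (x # xs) (y # z # ys) = dm r0 (sl \<phi> v 1) (x # xs) (y # z # ys) + tht rz (E_coeffs \<phi> 1) (x # xs) (y # z # ys)"
proof -
  have "dm r0 \<phi> (v # x # xs) (1 # y # z # ys) = 0" using c l by (simp add: closed_at_def)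
  then have "\<phi> (x # xs) (y # z # ys) = \<phi> (mul (y - 1) v x # xs) (1 # z # ys) + dl (sl \<phi> v 1) (x # xs) (y # z # ys)"
    unfolding dm_def cup_Cons dl.simps(1) by (intro add_minus_eq_0) (simp add: r0_def gev_v)
  then show ?thesis unfolding E_coeffs_expand[OF \<phi> J l, where x = "mul (y - 1) v x"]
    by (simp add: dm_def r0_def gev_mul gev_v rz_def)
qed

subsection \<open>Reduction of the coefficients\<close>

definition rem_ee :: "'k poly \<Rightarrow> 'k poly" where
  "rem_ee h = (h - [:poly h 0, poly h 1 - poly h 0:]) div ee"

lemma rem_ee_eqI: "h = [:a, b:] + ee * r \<Longrightarrow> rem_ee h = r"
proof -
  assume h: "h = [:a, b:] + ee * r"
  then have "[:poly h 0, poly h 1 - poly h 0:] = [:a, b:]" by simp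
  then have "h - [:poly h 0, poly h 1 - poly h 0:] = ee * r" using h by (simp only: add_diff_cancel_left')
  then show ?thesis unfolding rem_ee_def by (simp only:) (rule nonzero_mult_div_cancel_left, simp)
qed

lemma rem_ee_eq: "h = [:poly h 0, poly h 1 - poly h 0:] + ee * rem_ee h"
proof -
  have "\<exists>a b r. h = [:a, b:] + ee * r"
  proof (induction h)
    case 0
    show ?case by (rule exI[of _ 0], rule exI[of _ 0], rule exI[of _ 0]) simp
  next
    case (pCons c p)
    then obtain a b r where "p = [:a, b:] + ee * r" by blast
    then have "pCons c p = [:c, a + b:] + ee * (pCons 0 r - [:b:])" by (simp add: algebra_simps)
    then show ?case by blast
  qed
  then obtain a b r where h: "h = [:a, b:] + ee * r" by blast
  then have "[:poly h 0, poly h 1 - poly h 0:] = [:a, b:]" by simp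
  then show ?thesis using h rem_ee_eqI[OF h] by simp
qed

lemma rem_ee_add: "rem_ee (p + q) = rem_ee p + rem_ee q"
proof (rule rem_ee_eqI)
  have "p + q = ([:poly p 0, poly p 1 - poly p 0:] + ee * rem_ee p) + ([:poly q 0, poly q 1 - poly q 0:] + ee * rem_ee q)"
    using rem_ee_eq[of p] rem_ee_eq[of q] by simp
  also have "\<dots> = ([:poly p 0, poly p 1 - poly p 0:] + [:poly q 0, poly q 1 - poly q 0:]) + ee * (rem_ee p + rem_ee q)"
    by (simp only: distrib_left) (simp only: ac_simps)
  finally show "p + q = [:poly p 0 + poly q 0, (poly p 1 - poly p 0) + (poly q 1 - poly q 0):] + ee * (rem_ee p + rem_ee q)"
    by simp
qed

lemma rem_ee_smult: "rem_ee (smult c p) = smult c (rem_ee p)"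
proof (rule rem_ee_eqI)
  have "smult c p = smult c ([:poly p 0, poly p 1 - poly p 0:] + ee * rem_ee p)"
    using rem_ee_eq[of p] by simp
  then show "smult c p = [:c * poly p 0, c * (poly p 1 - poly p 0):] + ee * smult c (rem_ee p)"
    by (simp only: smult_add_right mult_smult_right) simp
qed

lemma rem_ee_diff: "rem_ee (p - q) = rem_ee p - rem_ee q"
  using rem_ee_add[of "p - q" q] by simp

lemma poly_lin_rem_ee: "poly_lin L \<Longrightarrow> poly_lin (\<lambda>h. L (rem_ee h))"
  by (simp add: poly_lin_def rem_ee_add rem_ee_smult)

text \<open>A decomposition adapted to the edge from 1 to \<open>y\<close>:
  \<open>[:1, y - 1:]\<close> is the polynomial of \<open>v\<close> there, multiples of
  \<open>ee\<close> come from the \<open>E j\<close>, and \<open>d\<close> represents the one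
  remaining direction.\<close>

lemma rem_ee_split: "h = smult (poly h 0) [:1, y - 1:] + smult (poly h 1 - y * poly h 0) [:0, 1:] + ee * rem_ee h"
proof -
  have "poly h 0 * (y - 1) + (poly h 1 - y * poly h 0) = poly h 1 - poly h 0" by (simp add: algebra_simps)
  then have *: "smult (poly h 0) [:1, y - 1:] + smult (poly h 1 - y * poly h 0) [:0, 1:] = [:poly h 0, poly h 1 - poly h 0:]"
    by simp
  show ?thesis unfolding * by (rule rem_ee_eq)
qed

text \<open>The element inserted on the edge from 1 to \<open>y\<close> is \<open>poly h 0\<close>
  times \<open>v\<close> plus the \<open>E j\<close> weighted by the coefficients of
  \<open>rem_ee h\<close>. Its polynomial is \<open>h\<close> without the \<open>d\<close> component
  of \<open>rem_ee_split\<close>.\<close>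

definition split_htp :: "('k poly \<Rightarrow> 'a list \<Rightarrow> 'k list \<Rightarrow> 'k) \<Rightarrow> 'k poly \<Rightarrow> 'a list \<Rightarrow> 'k list \<Rightarrow> 'k" where
  "split_htp \<Phi> h xs ys = poly h 0 * \<Phi> 1 (v # xs) (1 # ys) + E_coeffs (\<Phi> 1) 1 (rem_ee h) xs ys"

lemma coeff_cochain_split_htp: "coeff_cochain (Suc n) \<Phi> \<Longrightarrow> coeff_cochain n (split_htp \<Phi>)"
proof -
  assume \<Phi>: "coeff_cochain (Suc n) \<Phi>"
  note E = coeff_cochain_E_coeffs[OF coeff_cochain_CC[OF \<Phi>, of 1], of 1]
  have "CC n (split_htp \<Phi> h)" for h
    unfolding split_htp_def[abs_def] by (rule CC_add[OF CC_cmult[OF CC_sl[OF coeff_cochain_CC[OF \<Phi>]]] coeff_cochain_CC[OF E]])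
  moreover have "poly_lin (\<lambda>h. split_htp \<Phi> h xs ys)" for xs ys
    using poly_lin_rem_ee[OF coeff_cochain_poly_lin[OF E, of xs ys]] by (simp add: split_htp_def poly_lin_def algebra_simps)
  ultimately show ?thesis by (simp add: coeff_cochain_def)
qed

text \<open>Multiplying \<open>[:1, y - 1:]\<close> by \<open>fp x y z\<close> gives the polynomial
  of a product \<open>v x\<close> starting at 1, whose remainder is \<open>rz\<close>; hence only
  the \<open>d\<close> component of \<open>h\<close> contributes a defect.\<close>

lemma rem_ee_step:
  "smult (poly h 0) (rz x y z) + rem_ee h * fp x y z - rem_ee (h * fp x y z)
    = - smult (poly h 1 - y * poly h 0) (rem_ee ([:0, 1:] * fp x y z))"
proof -
  let ?c = "poly h 1 - y * poly h 0" and ?f = "fp x y z"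
  have "[:1, y - 1:] * ?f = smult (y * gev x y z) [:1, z - 1:] + ee * rz x y z"
    using fp_eq[of "mul (y - 1) v x" 1 z] by (simp only: fp_mul fp_v gev_mul gev_v rz_def mult_1_right)
  then have "smult (poly h 0) [:1, y - 1:] * ?f = smult (poly h 0 * (y * gev x y z)) [:1, z - 1:] + ee * smult (poly h 0) (rz x y z)"
    by (simp only: mult_smult_left smult_add_right smult_smult mult_smult_right)
  moreover have "h * ?f = smult (poly h 0) [:1, y - 1:] * ?f + smult ?c ([:0, 1:] * ?f) + ee * (rem_ee h * ?f)"
    using arg_cong[OF rem_ee_split[of h y], of "\<lambda>p. p * ?f"] by (simp only: distrib_right mult.assoc mult_smult_left)
  moreover have "H - Q = P1 + (P2 + R)" if "P = P1 + P2" "H = P + Q + R" for H P Q R P1 P2 :: "'k poly"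
    using that by simp
  ultimately have "h * ?f - smult ?c ([:0, 1:] * ?f)
    = smult (poly h 0 * (y * gev x y z)) [:1, z - 1:] + (ee * smult (poly h 0) (rz x y z) + ee * (rem_ee h * ?f))"
    by blast
  then have "h * ?f - smult ?c ([:0, 1:] * ?f)
    = smult (poly h 0 * (y * gev x y z)) [:1, z - 1:] + ee * (smult (poly h 0) (rz x y z) + rem_ee h * ?f)"
    by (simp only: distrib_left)
  then have "rem_ee (h * ?f - smult ?c ([:0, 1:] * ?f)) = smult (poly h 0) (rz x y z) + rem_ee h * ?f"
    by (intro rem_ee_eqI[of _ "poly h 0 * (y * gev x y z)" "poly h 0 * (y * gev x y z) * (z - 1)"]) simp
  moreover have "rem_ee (h * ?f - smult ?c ([:0, 1:] * ?f)) = rem_ee (h * ?f) - smult ?c (rem_ee ([:0, 1:] * ?f))"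
    by (simp only: rem_ee_diff rem_ee_smult)
  ultimately show ?thesis by (simp add: algebra_simps)
qed

text \<open>A test polynomial that belongs to an element on the edge from 1 to \<open>y\<close> can
  be contracted by the cocycle identity. Only the \<open>d\<close> direction survives, and
  \<open>poly h 1 - y * poly h 0\<close> is its coordinate.\<close>

lemma base_change_2:
  assumes \<Phi>: "coeff_cocycle (Suc n) \<Phi>" and J: "X_local n 1 (\<Phi> 1)" and l: "length xs = n" "length ys = n"
  shows "\<Phi> h (x # xs) (y # z # ys) - coeff_diff (split_htp \<Phi>) h (x # xs) (y # z # ys)
    = (poly h 1 - y * poly h 0) * (\<Phi> [:0, 1:] (x # xs) (y # z # ys) - coeff_diff (split_htp \<Phi>) [:0, 1:] (x # xs) (y # z # ys))"
proof -
  have coeff_cochain: "coeff_cochain (Suc n) \<Phi>" using \<Phi> by (simp add: coeff_cocycle_def)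
  note CC1 = coeff_cochain_CC[OF coeff_cochain, of 1]
  note P = plinD[OF coeff_cochain_poly_lin[OF coeff_cochain]]
  let ?V = "\<Phi> 1 (v # xs) (1 # z # ys)" and ?\<Psi> = "\<lambda>r. E_coeffs (\<Phi> 1) 1 r xs (z # ys)"
  have PE: "poly_lin ?\<Psi>" by (rule coeff_cochain_poly_lin[OF coeff_cochain_E_coeffs[OF CC1]])
  have coc: "\<Phi> (fp u 1 y) (x # xs) (y # z # ys) = \<Phi> 1 (mul (y - 1) u x # xs) (1 # z # ys) + dl (sl (\<Phi> 1) u 1) (x # xs) (y # z # ys)" for u
  proof -
    have "coeff_diff \<Phi> 1 (u # x # xs) (1 # y # z # ys) = 0" using \<Phi> l by (simp add: coeff_cocycle_def)
    then show ?thesis unfolding coeff_diff_def coeff_cup_Cons dl.simps(1) by (intro add_minus_eq_0) simp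
  qed
  have v: "\<Phi> [:1, y - 1:] (x # xs) (y # z # ys) = y * gev x y z * ?V + ?\<Psi> (rz x y z) + dl (sl (\<Phi> 1) v 1) (x # xs) (y # z # ys)"
    using coc[of v] unfolding E_coeffs_expand[OF CC1 J l, where x = "mul (y - 1) v x"] by (simp add: fp_v gev_mul gev_v rz_def)
  have e: "\<Phi> (ee * monom 1 j) (x # xs) (y # z # ys) = ?\<Psi> (monom 1 j * fp x y z) + dl (sl (\<Phi> 1) (E j) 1) (x # xs) (y # z # ys)" for j
    using coc[of "E j"] unfolding E_coeffs_mul_E[OF CC1 J l] fp_E .
  have "poly_lin (\<lambda>r. \<Phi> (ee * r) (x # xs) (y # z # ys))"
    unfolding mult.commute[of ee] by (rule poly_lin_mult[OF coeff_cochain_poly_lin[OF coeff_cochain]])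
  note Pe = this
  have er: "\<Phi> (ee * r) (x # xs) (y # z # ys) = ?\<Psi> (r * fp x y z) + dl (E_coeffs (\<Phi> 1) 1 r) (x # xs) (y # z # ys)" for r
  proof -
    have "\<Phi> (ee * r) (x # xs) (y # z # ys) = psum r (\<lambda>j. \<Phi> (ee * monom 1 j) (x # xs) (y # z # ys))"
      by (rule poly_lin_psum[OF Pe])
    also have "\<dots> = psum r (\<lambda>j. ?\<Psi> (monom 1 j * fp x y z)) + psum r (\<lambda>j. dl (sl (\<Phi> 1) (E j) 1) (x # xs) (y # z # ys))"
      unfolding e by (simp add: psum_def sum.distrib distrib_left)
    also have "psum r (\<lambda>j. ?\<Psi> (monom 1 j * fp x y z)) = ?\<Psi> (r * fp x y z)"
      by (rule poly_lin_psum[OF poly_lin_mult[OF PE], symmetric])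
    also have "psum r (\<lambda>j. dl (sl (\<Phi> 1) (E j) 1) (x # xs) (y # z # ys)) = dl (E_coeffs (\<Phi> 1) 1 r) (x # xs) (y # z # ys)"
      unfolding E_coeffs_def[abs_def] by (rule dl_psum[symmetric])
    finally show ?thesis .
  qed
  have key: "\<Phi> h (x # xs) (y # z # ys) - coeff_diff (split_htp \<Phi>) h (x # xs) (y # z # ys)
      = (poly h 1 - y * poly h 0) * (\<Phi> [:0, 1:] (x # xs) (y # z # ys) - ?\<Psi> (rem_ee ([:0, 1:] * fp x y z)))" for h
  proof -
    let ?c = "poly h 1 - y * poly h 0"
    have "\<Phi> h (x # xs) (y # z # ys) = poly h 0 * \<Phi> [:1, y - 1:] (x # xs) (y # z # ys)
        + ?c * \<Phi> [:0, 1:] (x # xs) (y # z # ys) + \<Phi> (ee * rem_ee h) (x # xs) (y # z # ys)"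
      using arg_cong[OF rem_ee_split[of h y], of "\<lambda>p. \<Phi> p (x # xs) (y # z # ys)"] by (simp only: P)
    moreover have "coeff_diff (split_htp \<Phi>) h (x # xs) (y # z # ys) = poly h 0 * (y * gev x y z) * ?V + ?\<Psi> (rem_ee (h * fp x y z))
        + (poly h 0 * dl (sl (\<Phi> 1) v 1) (x # xs) (y # z # ys) + dl (E_coeffs (\<Phi> 1) 1 (rem_ee h)) (x # xs) (y # z # ys))"
    proof -
      have "dl (split_htp \<Phi> h) (x # xs) (y # z # ys) = poly h 0 * dl (sl (\<Phi> 1) v 1) (x # xs) (y # z # ys)
          + dl (E_coeffs (\<Phi> 1) 1 (rem_ee h)) (x # xs) (y # z # ys)"
        unfolding split_htp_def[abs_def] dl_add dl_scale ..
      then show ?thesis unfolding coeff_diff_def coeff_cup_Cons by (simp add: split_htp_def poly_fp_0)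
    qed
    moreover have "?\<Psi> (smult (poly h 0) (rz x y z) + rem_ee h * fp x y z - rem_ee (h * fp x y z))
      = ?\<Psi> (smult (- ?c) (rem_ee ([:0, 1:] * fp x y z)))" unfolding rem_ee_step smult_minus_left ..
    then have "poly h 0 * ?\<Psi> (rz x y z) + ?\<Psi> (rem_ee h * fp x y z) - ?\<Psi> (rem_ee (h * fp x y z))
      = - ?c * ?\<Psi> (rem_ee ([:0, 1:] * fp x y z))"
      unfolding poly_lin_diff[OF PE] plinD[OF PE] .
    moreover have "A - B = c * (F - Q)" if "A = h0 * (g * V + R + d1) + c * F + (S + d2)"
        "B = h0 * g * V + T + (h0 * d1 + d2)" "h0 * R + S - T = - c * Q" for A B c F Q h0 g V R S T d1 d2 :: 'k
    proof -
      have "A - B = c * F + (h0 * R + S - T)" unfolding that(1,2) by (simp add: algebra_simps)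
      then show ?thesis unfolding that(3) by (simp add: algebra_simps)
    qed
    ultimately show ?thesis unfolding v er by blast
  qed
  from key[of "[:0, 1:]"] have "\<Phi> [:0, 1:] (x # xs) (y # z # ys) - coeff_diff (split_htp \<Phi>) [:0, 1:] (x # xs) (y # z # ys)
    = \<Phi> [:0, 1:] (x # xs) (y # z # ys) - ?\<Psi> (rem_ee ([:0, 1:] * fp x y z))" by simp
  then show ?thesis using key[of h] by simp
qed

text \<open>The surviving coordinate of the test polynomial \<open>rz x y z\<close>. The factor is
  \<open>z\<close> rather than \<open>y\<close> because \<open>z\<close> is the first vertex of the
  cochain to which \<open>rz\<close> is fed.\<close>

definition tau :: "'a \<Rightarrow> 'k \<Rightarrow> 'k \<Rightarrow> 'k" where
  "tau x y z = poly (rz x y z) 1 - z * poly (rz x y z) 0"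

definition closed :: "('a \<Rightarrow> 'k \<Rightarrow> 'k \<Rightarrow> 'k) \<Rightarrow> nat \<Rightarrow> ('a list \<Rightarrow> 'k list \<Rightarrow> 'k) \<Rightarrow> bool" where
  "closed r n \<phi> \<longleftrightarrow> (\<forall>y. closed_at r n y \<phi>)"

lemma coeff_cocycle_add: "coeff_cocycle n \<Phi> \<Longrightarrow> coeff_cocycle n \<Psi> \<Longrightarrow> coeff_cocycle n (\<lambda>h xs ys. \<Phi> h xs ys + \<Psi> h xs ys)"
  by (simp add: coeff_cocycle_def coeff_cochain_add coeff_diff_lin)

lemma coeff_cocycle_diff: "coeff_cocycle n \<Phi> \<Longrightarrow> coeff_cocycle n \<Psi> \<Longrightarrow> coeff_cocycle n (\<lambda>h xs ys. \<Phi> h xs ys - \<Psi> h xs ys)"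
  by (simp add: coeff_cocycle_def coeff_cochain_diff coeff_diff_lin)

lemma coeff_cocycle_coeff_diff: "coeff_cochain n \<Phi> \<Longrightarrow> coeff_cocycle (Suc n) (coeff_diff \<Phi>)"
  by (simp add: coeff_cocycle_def coeff_cochain_coeff_diff coeff_diff_coeff_diff)

text \<open>\<open>\<chi>\<close> is the corrected cocycle at the test polynomial \<open>d\<close>.
  The product of \<open>d\<close> with \<open>fp x y z\<close> vanishes at 0 and equals
  \<open>r1 x y z\<close> at 1, so the coefficient cocycle identity at \<open>d\<close> says that
  \<open>\<chi>\<close> is closed for \<open>r1\<close>.\<close>

lemma coeff_cocycle_decompose:
  assumes \<Phi>: "coeff_cocycle (Suc m) \<Phi>"
  obtains \<Theta> \<chi> where "coeff_cochain m \<Theta>" "CC (Suc m) \<chi>" "closed r1 (Suc m) \<chi>"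
    "\<And>h xs ys. length xs = Suc m \<Longrightarrow> length ys = Suc (Suc m) \<Longrightarrow>
      \<Phi> h xs ys = coeff_diff \<Theta> h xs ys + (poly h 1 - hd ys * poly h 0) * \<chi> xs ys"
proof -
  have coeff_cochain: "coeff_cochain (Suc m) \<Phi>" using \<Phi> by (simp add: coeff_cocycle_def)
  note RCq = coeff_cochain_loc[OF coeff_cochain]
  define \<Psi> where "\<Psi> = (\<lambda>h xs ys. \<Phi> h xs ys + coeff_diff (\<lambda>h. loc (\<Phi> h)) h xs ys)"
  have Z: "coeff_cocycle (Suc m) \<Psi>" unfolding \<Psi>_def by (rule coeff_cocycle_add[OF \<Phi> coeff_cocycle_coeff_diff[OF RCq]])
  have J: "X_local m 1 (\<Psi> 1)" unfolding \<Psi>_def by (rule localize_coeff_diff[OF \<Phi>])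
  have coeff_cochain\<Psi>: "coeff_cochain (Suc m) \<Psi>" using Z by (simp add: coeff_cocycle_def)
  define \<Gamma> where "\<Gamma> = (\<lambda>h xs ys. \<Psi> h xs ys - coeff_diff (split_htp \<Psi>) h xs ys)"
  have G: "coeff_cocycle (Suc m) \<Gamma>" unfolding \<Gamma>_def by (rule coeff_cocycle_diff[OF Z coeff_cocycle_coeff_diff[OF coeff_cochain_split_htp[OF coeff_cochain\<Psi>]]])
  have bc: "\<Gamma> h (x # xs) (y # z # ys) = (poly h 1 - y * poly h 0) * \<Gamma> [:0, 1:] (x # xs) (y # z # ys)"
    if "length xs = m" "length ys = m" for h x xs y z ys
    unfolding \<Gamma>_def by (rule base_change_2[OF Z J that])
  have CC: "CC (Suc m) (\<Gamma> [:0, 1:])" using G by (simp add: coeff_cocycle_def coeff_cochain_CC)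
  have "dm r1 (\<Gamma> [:0, 1:]) xs (y # ys) = 0" if l: "length xs = Suc (Suc m)" "length ys = Suc (Suc m)" for xs y ys
  proof -
    obtain x x' xs' where xs: "xs = x # x' # xs'" "length xs' = m" using l(1) by (auto simp: length_Suc_conv)
    obtain z w ys' where ys: "ys = z # w # ys'" "length ys' = m" using l(2) by (auto simp: length_Suc_conv)
    have "coeff_diff \<Gamma> [:0, 1:] (x # x' # xs') (y # z # w # ys') = 0" using G xs ys by (simp add: coeff_cocycle_def)
    then have "\<Gamma> ([:0, 1:] * fp x y z) (x' # xs') (z # w # ys') + dl (\<Gamma> [:0, 1:]) (x # x' # xs') (y # z # w # ys') = 0"
      unfolding coeff_diff_def coeff_cup_Cons .
    then show ?thesis unfolding bc[OF xs(2) ys(2), of "[:0, 1:] * fp x y z"] poly_mult poly_fp_1 xs(1) ys(1) dm_def cup_Cons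
      by (simp add: r1_def)
  qed
  then have cl: "closed r1 (Suc m) (\<Gamma> [:0, 1:])" by (simp add: closed_def closed_at_def)
  have RCd: "coeff_cochain m (\<lambda>h xs ys. split_htp \<Psi> h xs ys - loc (\<Phi> h) xs ys)" by (rule coeff_cochain_diff[OF coeff_cochain_split_htp[OF coeff_cochain\<Psi>] RCq])
  have "\<Phi> h xs ys = coeff_diff (\<lambda>h xs ys. split_htp \<Psi> h xs ys - loc (\<Phi> h) xs ys) h xs ys
      + (poly h 1 - hd ys * poly h 0) * \<Gamma> [:0, 1:] xs ys"
    if l: "length xs = Suc m" "length ys = Suc (Suc m)" for h xs ys
  proof -
    obtain x xs' where xs: "xs = x # xs'" "length xs' = m" using l(1) by (auto simp: length_Suc_conv)
    obtain y z ys' where ys: "ys = y # z # ys'" "length ys' = m" using l(2) by (auto simp: length_Suc_conv)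
    have "\<Gamma> h xs ys = (poly h 1 - hd ys * poly h 0) * \<Gamma> [:0, 1:] xs ys"
      unfolding xs(1) ys(1) list.sel by (rule bc[OF xs(2) ys(2)])
    moreover have "\<Phi> h xs ys = coeff_diff (split_htp \<Psi>) h xs ys - coeff_diff (\<lambda>h. loc (\<Phi> h)) h xs ys + \<Gamma> h xs ys"
      by (simp add: \<Gamma>_def \<Psi>_def)
    ultimately show ?thesis unfolding coeff_diff_lin by simp
  qed
  with RCd CC cl show ?thesis by (rule that)
qed

text \<open>On the loop at \<open>y\<close> the element \<open>v\<close> acts on coefficients by the
  scalar \<open>y\<close>, so \<open>y\<close> times the value is 0; the vertex 0 is reached by
  polynomiality.\<close>

lemma coeff_cocycle_0:
  assumes \<Phi>: "coeff_cocycle 0 \<Phi>"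
  shows "\<Phi> h [] [y] = 0"
proof -
  have coeff_cochain: "coeff_cochain 0 \<Phi>" using \<Phi> by (simp add: coeff_cocycle_def)
  have nz: "\<Phi> h [] [y] = 0" if "y \<noteq> 0" for y
  proof -
    have "coeff_diff \<Phi> h [v] [y, y] = 0" using \<Phi> by (simp add: coeff_cocycle_def)
    moreover have "h * fp v y y = smult y h" by (simp add: fp_v)
    ultimately have "y * \<Phi> h [] [y] = 0" by (simp add: coeff_diff_def coeff_cochain_smult_eq[OF coeff_cochain])
    then show ?thesis using that by simp
  qed
  have "PF 1 (\<Phi> h [])" using coeff_cochain_CC[OF coeff_cochain] by (simp add: CC_def)
  from is_pfun_PF[OF this PL_id] have "is_pfun (\<lambda>t. \<Phi> h [] [t])" .
  moreover have "is_pfun (\<lambda>t::'k. 0::'k)" unfolding is_pfun_def by (rule exI[of _ 0]) auto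
  ultimately show ?thesis by (rule is_pfun_eq_off[of _ _ "{0}"]) (simp_all add: nz)
qed

text \<open>The predicate \<open>P\<close> restricts the first vertex, so that one argument serves
  both for all first vertices and for the hyperplane where it is 0.\<close>

lemma base_decompose:
  assumes \<Phi>: "coeff_cocycle (Suc m) \<Phi>" and \<psi>: "CC (Suc m) \<psi>"
    and eq: "\<And>y x xs z ys. P y \<Longrightarrow> length xs = Suc m \<Longrightarrow> length ys = Suc m \<Longrightarrow>
      \<phi> (x # xs) (y # z # ys) = dm r0 \<psi> (x # xs) (y # z # ys) + tht rz \<Phi> (x # xs) (y # z # ys)"
  shows "\<exists>\<psi> \<chi>. CC (Suc m) \<psi> \<and> CC (Suc m) \<chi> \<and> closed r1 (Suc m) \<chi> \<and>
    (\<forall>xs ys. length xs = Suc (Suc m) \<longrightarrow> length ys = Suc (Suc (Suc m)) \<longrightarrow> P (hd ys) \<longrightarrow>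
      \<phi> xs ys = dm r0 \<psi> xs ys + cup tau \<chi> xs ys)"
proof -
  obtain \<Theta> \<chi> where \<Theta>: "coeff_cochain m \<Theta>" and \<chi>: "CC (Suc m) \<chi>" "closed r1 (Suc m) \<chi>"
    and d: "\<And>h xs ys. length xs = Suc m \<Longrightarrow> length ys = Suc (Suc m) \<Longrightarrow>
      \<Phi> h xs ys = coeff_diff \<Theta> h xs ys + (poly h 1 - hd ys * poly h 0) * \<chi> xs ys"
    using coeff_cocycle_decompose[OF \<Phi>] by blast
  have "\<phi> xs ys = dm r0 (\<lambda>xs ys. \<psi> xs ys - tht rz \<Theta> xs ys) xs ys + cup tau \<chi> xs ys"
    if l: "length xs = Suc (Suc m)" "length ys = Suc (Suc (Suc m))" "P (hd ys)" for xs ys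
  proof -
    obtain x xs' where xs: "xs = x # xs'" "length xs' = Suc m" using l(1) by (auto simp: length_Suc_conv)
    obtain y z ys' where ys: "ys = y # z # ys'" "length ys' = Suc m" using l(2) unfolding length_Suc_conv by blast
    have "tht rz \<Phi> xs ys = tht rz (coeff_diff \<Theta>) xs ys + cup tau \<chi> xs ys"
      using d[of xs' "z # ys'" "rz x y z"] xs ys by (simp add: tau_def)
    also have "tht rz (coeff_diff \<Theta>) xs ys = - dm r0 (tht rz \<Theta>) xs ys"
      unfolding xs(1) ys(1) by (rule tht_coeff_diff[OF \<Theta>]) (use xs ys in auto)
    finally show ?thesis using eq[of y xs' ys' x z] l xs ys unfolding dm_lin by simp
  qed
  moreover have "CC (Suc m) (\<lambda>xs ys. \<psi> xs ys - tht rz \<Theta> xs ys)"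
    by (rule CC_diff[OF \<psi> CC_tht[OF polychar_rz \<Theta>]])
  ultimately show ?thesis using \<chi> by blast
qed

lemma localize_cocycle:
  assumes "CC (Suc n) \<phi>" "closed_at r0 (Suc n) y \<phi>"
  defines "\<phi>' \<equiv> \<lambda>xs ys. \<phi> xs ys + dm r0 (loc \<phi>) xs ys"
  shows "CC (Suc n) \<phi>'" "closed_at r0 (Suc n) y \<phi>'" "X_local n y \<phi>'"
  unfolding \<phi>'_def
  using CC_add[OF assms(1) CC_dm[OF char_r0 CC_loc[OF assms(1)]]]
    closed_at_add[OF assms(2) closed_at_dm[OF multiplicative_r0]] localize_dm[OF assms(1,2)] by blast+

lemma cocycle_decompose:
  assumes \<phi>: "CC (Suc (Suc m)) \<phi>" "closed r0 (Suc (Suc m)) \<phi>"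
  shows "\<exists>\<psi> \<chi>. CC (Suc m) \<psi> \<and> CC (Suc m) \<chi> \<and> closed r1 (Suc m) \<chi> \<and>
    (\<forall>xs ys. length xs = Suc (Suc m) \<longrightarrow> length ys = Suc (Suc (Suc m)) \<longrightarrow>
      \<phi> xs ys = dm r0 \<psi> xs ys + cup tau \<chi> xs ys)"
proof -
  have c: "closed_at r0 (Suc (Suc m)) y \<phi>" for y using \<phi>(2) by (simp add: closed_def)
  note L = localize_cocycle[OF \<phi>(1) c]
  let ?\<phi> = "\<lambda>xs ys. \<phi> xs ys + dm r0 (loc \<phi>) xs ys"
  have "CC (Suc m) (\<lambda>xs ys. sl ?\<phi> v 1 xs ys - loc \<phi> xs ys)"
    by (rule CC_diff[OF CC_sl[OF L(1)] CC_loc[OF \<phi>(1)]])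
  moreover have "\<phi> (x # xs) (y # z # ys) = dm r0 (\<lambda>xs ys. sl ?\<phi> v 1 xs ys - loc \<phi> xs ys) (x # xs) (y # z # ys)
      + tht rz (E_coeffs ?\<phi> 1) (x # xs) (y # z # ys)" if "length xs = Suc m" "length ys = Suc m" for x xs y z ys
    using base_change_1[OF L(1) L(2)[of 1] L(3)[of 1] that, of x y z] unfolding dm_lin by (simp add: algebra_simps)
  ultimately show ?thesis
    using base_decompose[OF coeff_cocycle_E_coeffs[OF L(1) L(2)[of 1] L(3)[of 1]], of "\<lambda>xs ys. sl ?\<phi> v 1 xs ys - loc \<phi> xs ys" "\<lambda>_. True" \<phi>] by simp
qed

lemma cocycle_1:
  assumes \<phi>: "CC 1 \<phi>" "closed r0 1 \<phi>"
  shows "\<exists>\<psi>. CC 0 \<psi> \<and> (\<forall>xs ys. length xs = 1 \<longrightarrow> length ys = 2 \<longrightarrow> \<phi> xs ys = dm r0 \<psi> xs ys)"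
proof -
  have c: "closed_at r0 (Suc 0) y \<phi>" for y using \<phi>(2) by (simp add: closed_def)
  have \<phi>1: "CC (Suc 0) \<phi>" using \<phi>(1) by simp
  note L = localize_cocycle[OF \<phi>1 c]
  let ?\<phi> = "\<lambda>xs ys. \<phi> xs ys + dm r0 (loc \<phi>) xs ys"
  let ?\<psi> = "\<lambda>xs ys. sl ?\<phi> v 1 xs ys - loc \<phi> xs ys"
  have "CC 0 ?\<psi>" by (rule CC_diff[OF CC_sl[OF L(1)] CC_loc[OF \<phi>1]])
  moreover have "\<phi> xs ys = dm r0 ?\<psi> xs ys" if l: "length xs = 1" "length ys = 2" for xs ys
  proof -
    obtain x y z where "xs = [x]" "ys = [y, z]" using l by (auto simp: length_Suc_conv numeral_2_eq_2)
    then show ?thesis using base_change_1[OF L(1) L(2)[of 1] L(3)[of 1], of "[]" "[]" x y z] coeff_cocycle_0[OF coeff_cocycle_E_coeffs[OF L(1) L(2)[of 1] L(3)[of 1]]]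
      unfolding dm_lin by (simp add: algebra_simps)
  qed
  ultimately show ?thesis by blast
qed

subsection \<open>Cocycles at the base vertex 0\<close>

lemma mlin_shift: "mlin n \<phi> \<Longrightarrow> mlin n (\<lambda>xs ys. \<phi> xs (map (\<lambda>z. z + a) ys))"
proof (induction n arbitrary: \<phi>)
  case (Suc n)
  have "slot y z (\<lambda>x. \<phi> (x # xs) (map (\<lambda>z. z + a) (y # z # ys)))" if "length xs = n" "length ys = n" for xs ys y z
  proof -
    have "slot (y + a) (z + a) (\<lambda>x. \<phi> (x # xs) ((y + a) # (z + a) # map (\<lambda>z. z + a) ys))"
      using Suc.prems that by simp
    then show ?thesis by (simp add: slot_def)
  qed
  moreover have "mlin n (sl (\<lambda>xs ys. \<phi> xs (map (\<lambda>z. z + a) ys)) x y)" for x y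
    using Suc.IH[of "sl \<phi> x (y + a)"] Suc.prems by simp
  ultimately show ?case by simp
qed simp

lemma pfun_lin: "is_pfun f \<Longrightarrow> is_pfun g \<Longrightarrow> pfun (\<lambda>t. f t + g t) = pfun f + pfun g"
  "is_pfun f \<Longrightarrow> pfun (\<lambda>t. c * f t) = smult c (pfun f)"
  by (auto simp: is_pfun_def intro!: pfun_eqI)

lemma mlin_lc:
  assumes "\<And>t. mlin n (\<Psi> t)" "\<And>xs ys. length xs = n \<Longrightarrow> length ys = Suc n \<Longrightarrow> is_pfun (\<lambda>t. \<Psi> t xs ys)"
  shows "mlin n (\<lambda>xs ys. coeff (pfun (\<lambda>t. \<Psi> t xs ys)) 1)"
  using assms
proof (induction n arbitrary: \<Psi>)
  case (Suc n)
  have "slot y z (\<lambda>x. coeff (pfun (\<lambda>t. \<Psi> t (x # xs) (y # z # ys))) 1)" if l: "length xs = n" "length ys = n" for xs ys y z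
  proof -
    have s: "slot y z (\<lambda>x. \<Psi> t (x # xs) (y # z # ys))" for t using Suc.prems(1)[of t] l by simp
    have p: "is_pfun (\<lambda>t. \<Psi> t (x # xs) (y # z # ys))" for x by (rule Suc.prems(2)) (use l in auto)
    show ?thesis by (rule slotI) (simp_all add: slotD(1-3)[OF s] pfun_lin[OF p] pfun_lin(1)[OF p p])
  qed
  moreover have "mlin n (sl (\<lambda>xs ys. coeff (pfun (\<lambda>t. \<Psi> t xs ys)) 1) x y)" for x y
    by (rule Suc.IH[of "\<lambda>t. sl (\<Psi> t) x y"]) (use Suc.prems in auto)
  ultimately show ?case by simp
qed simp

text \<open>The merge parameter depends only on differences of vertices. \<open>dl\<close> is
  therefore translation invariant, whereas the action term through \<open>r0\<close> is not.\<close>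

lemma dl_shift: "dl (\<lambda>xs ys. \<phi> xs (map (\<lambda>z. z + a) ys)) xs ys = dl \<phi> xs (map (\<lambda>z. z + a) ys)"
proof (induction xs arbitrary: \<phi> ys)
  case (Cons x xs)
  show ?case
  proof (cases "xs = [] \<or> ys = [] \<or> tl ys = []")
    case True
    then show ?thesis by (cases xs; cases ys; cases "tl ys") auto
  next
    case False
    then obtain x' xs' y z ys' where "xs = x' # xs'" "ys = y # z # ys'"
      by (metis list.exhaust list.sel(3))
    then show ?thesis using Cons.IH[of "sl \<phi> x (y + a)" "z # ys'"] by simp
  qed
qed simp

lemma is_pfun_lin: "is_pfun f \<Longrightarrow> is_pfun g \<Longrightarrow> is_pfun (\<lambda>t. f t + g t)" "is_pfun f \<Longrightarrow> is_pfun (\<lambda>t. - f t)"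
proof -
  show "is_pfun f \<Longrightarrow> is_pfun g \<Longrightarrow> is_pfun (\<lambda>t. f t + g t)"
    unfolding is_pfun_def by (elim exE, rule_tac x = "p + pa" in exI) auto
  show "is_pfun f \<Longrightarrow> is_pfun (\<lambda>t. - f t)"
    unfolding is_pfun_def by (elim exE, rule_tac x = "- p" in exI) auto
qed

lemma dl_lc:
  assumes "length ys = Suc (length xs)"
    "\<And>as bs. Suc (length as) = length xs \<Longrightarrow> length bs = Suc (length as) \<Longrightarrow> is_pfun (\<lambda>t. \<Psi> t as bs)"
  shows "is_pfun (\<lambda>t. dl (\<Psi> t) xs ys) \<and>
    dl (\<lambda>xs ys. coeff (pfun (\<lambda>t. \<Psi> t xs ys)) 1) xs ys = coeff (pfun (\<lambda>t. dl (\<Psi> t) xs ys)) 1"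
  using assms
proof (induction xs arbitrary: \<Psi> ys)
  have 0: "is_pfun (\<lambda>t::'k. 0::'k)" unfolding is_pfun_def by (rule exI[of _ 0]) auto
  have p0: "pfun (\<lambda>t::'k. 0::'k) = 0" by (rule pfun_eqI) simp
  case Nil
  then show ?case using 0 p0 by simp
next
  have 0: "is_pfun (\<lambda>t::'k. 0::'k)" unfolding is_pfun_def by (rule exI[of _ 0]) auto
  have p0: "pfun (\<lambda>t::'k. 0::'k) = 0" by (rule pfun_eqI) simp
  case (Cons x xs)
  show ?case
  proof (cases xs)
    case Nil
    then show ?thesis using 0 p0 by simp
  next
    case xs: (Cons x' xs')
    obtain y z ys' where ys: "ys = y # z # ys'" "length ys' = length xs" using Cons.prems(1) xs by (auto simp: length_Suc_conv)
    have IH: "is_pfun (\<lambda>t. dl (sl (\<Psi> t) x y) xs (z # ys'))"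
      "dl (\<lambda>as bs. coeff (pfun (\<lambda>t. sl (\<Psi> t) x y as bs)) 1) xs (z # ys') = coeff (pfun (\<lambda>t. dl (sl (\<Psi> t) x y) xs (z # ys'))) 1"
      using Cons.IH[of "z # ys'" "\<lambda>t. sl (\<Psi> t) x y"] Cons.prems(2) ys by auto
    have a: "is_pfun (\<lambda>t. \<Psi> t (mul (z - y) x x' # xs') (y # ys'))" by (rule Cons.prems(2)) (use xs ys in auto)
    have "pfun (\<lambda>t. - \<Psi> t (mul (z - y) x x' # xs') (y # ys') - dl (sl (\<Psi> t) x y) xs (z # ys'))
      = - pfun (\<lambda>t. \<Psi> t (mul (z - y) x x' # xs') (y # ys')) - pfun (\<lambda>t. dl (sl (\<Psi> t) x y) xs (z # ys'))"
      by (rule pfun_eqI) (simp add: poly_pfun[OF a] poly_pfun[OF IH(1)])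
    moreover have "is_pfun (\<lambda>t. - \<Psi> t (mul (z - y) x x' # xs') (y # ys') - dl (sl (\<Psi> t) x y) xs (z # ys'))"
      using is_pfun_lin(1)[OF is_pfun_lin(2)[OF a] is_pfun_lin(2)[OF IH(1)]] by simp
    ultimately show ?thesis using IH(2) unfolding ys(1) xs dl.simps(1) by simp
  qed
qed

text \<open>All vertices are translated so that the first becomes \<open>t\<close>, and
  \<open>v\<close> is placed on the new edge from 0 to \<open>t\<close>. Evaluated at first vertex 0
  the translation is by \<open>t\<close> itself.\<close>

definition lin_htp :: "('a list \<Rightarrow> 'k list \<Rightarrow> 'k) \<Rightarrow> 'a list \<Rightarrow> 'k list \<Rightarrow> 'k" where
  "lin_htp \<phi> xs ys = coeff (pfun (\<lambda>t. \<phi> (v # xs) (0 # map (\<lambda>z. z + (t - hd ys)) ys))) 1"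

lemma is_pfun_shift:
  assumes "PF (Suc n) F" "length ys = n"
  shows "is_pfun (\<lambda>t. F (0 # map (\<lambda>z. z + (t - a)) ys))"
proof -
  have h: "PF 1 hd" using PF_hd[of 0] by simp
  have "PF 1 (\<lambda>ts. map (\<lambda>z. z + (hd ts - a)) ys ! i)" if "i < n" for i
    by (rule PF_cong[OF PF_add[OF PF_c[of _ "ys ! i"] PF_diff[OF h PF_c[of _ a]]]]) (use that assms(2) in simp)
  then have "PL 1 n (\<lambda>ts. map (\<lambda>z. z + (hd ts - a)) ys)" using assms(2) by (simp add: PL_def)
  from is_pfun_PF[OF assms(1) PL_Cons[OF PF_c this, of 0]] show ?thesis by simp
qed

lemma CC_lin_htp:
  assumes "CC (Suc n) \<phi>"
  shows "CC n (lin_htp \<phi>)"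
proof -
  have p: "is_pfun (\<lambda>t. \<phi> (v # xs) (0 # map (\<lambda>z. z + (t - a)) ys))" if "length xs = n" "length ys = Suc n" for xs ys a
    by (rule is_pfun_shift) (use assms that in \<open>auto simp: CC_def\<close>)
  have "mlin n (\<lambda>xs ys. sl \<phi> v 0 xs (map (\<lambda>z. z + (t - a)) ys))" for t a
    by (rule mlin_shift) (use assms in \<open>simp add: CC_def\<close>)
  then have "mlin n (\<lambda>xs ys. coeff (pfun (\<lambda>t. sl \<phi> v 0 xs (map (\<lambda>z. z + (t - a)) ys))) 1)" for a
    by (rule mlin_lc) (use p in simp)
  from mlin_hd[of n "\<lambda>a xs ys. coeff (pfun (\<lambda>t. sl \<phi> v 0 xs (map (\<lambda>z. z + (t - a)) ys))) 1", OF this]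
  have "mlin n (lin_htp \<phi>)" by (simp add: lin_htp_def[abs_def])
  moreover have "PF (Suc n) (lin_htp \<phi> xs)" if l: "length xs = n" for xs
  proof -
    have F: "PF (Suc (Suc n)) (\<phi> (v # xs))" using assms l by (simp add: CC_def)
    have g: "PF (Suc (Suc (Suc n))) (\<lambda>us. hd us + (hd (tl us) - hd (tl (tl us))) :: 'k)"
    proof -
      have "PF (Suc (Suc (Suc n))) (\<lambda>us. us ! 0 + (us ! 1 - us ! 2) :: 'k)"
        by (rule PF_add[OF PF_i PF_diff[OF PF_i PF_i]]) simp_all
      then show ?thesis by (rule PF_cong) (auto simp: length_Suc_conv numeral_2_eq_2)
    qed
    have "PL (Suc (Suc n)) (Suc n) (\<lambda>us. map (\<lambda>z. z + (hd us - hd (tl us))) (tl us) :: 'k list)"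
      by (rule PL_map[OF _ PL_tl]) (rule g)
    from PF_PL[OF F PL_Cons[OF PF_c this, of 0]]
    have "PF (Suc (Suc n)) (\<lambda>us. \<phi> (v # xs) (0 # map (\<lambda>z. z + (hd us - hd (tl us))) (tl us)))" .
    from PFP_pfun[OF this] have "PF (Suc n) (\<lambda>ys. coeff (pfun (\<lambda>t. \<phi> (v # xs) (0 # map (\<lambda>z. z + (t - hd ys)) ys))) 1)"
      by (simp add: PFP_def)
    then show ?thesis by (simp add: lin_htp_def[abs_def])
  qed
  ultimately show ?thesis by (simp add: CC_def)
qed

text \<open>Inserting \<open>v\<close> at the edge from 0 to \<open>t\<close> yields a multiple of \<open>t\<close>; its linear coefficient plays the
  role of a contracting homotopy at the vertex 0, where \<open>v\<close> itself is not invertible.\<close>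

lemma base_change_0:
  assumes \<phi>: "CC (Suc n) \<phi>" and c: "closed_at r0 (Suc n) 0 \<phi>" and J: "X_local n 0 \<phi>"
    and l: "length xs = n" "length ys = n"
  shows "\<phi> (x # xs) (0 # z # ys) = dm r0 (\<lambda>xs ys. - lin_htp \<phi> xs ys) (x # xs) (0 # z # ys) + tht rz (E_coeffs \<phi> 0) (x # xs) (0 # z # ys)"
proof -
  define D where "D t = dl (sl \<phi> v 0) (x # xs) (map (\<lambda>z. z + t) (0 # z # ys))" for t
  \<comment> \<open>Merging \<open>v\<close> across the edge from 0 to \<open>t\<close> multiplies
    both coordinates of \<open>x\<close> by \<open>t\<close>; \<open>H t\<close> is the value after
    this factor has been removed.\<close>
  define H where "H t = gev x t (z + t) * \<phi> (v # xs) (0 # (z + t) # map (\<lambda>z. z + t) ys)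
    + E_coeffs \<phi> 0 ([:- z * gev x t (z + t):] + [:0, 1:] * rp x t (z + t)) xs ((z + t) # map (\<lambda>z. z + t) ys)" for t
  note PE = coeff_cochain_poly_lin[OF coeff_cochain_E_coeffs[OF \<phi>, of 0]]
  have D: "D t = - (t * H t)" for t
  proof -
    let ?ys = "map (\<lambda>z. z + t) ys"
    have ly: "length ?ys = n" using l by simp
    have "dm r0 \<phi> (v # x # xs) (0 # t # (z + t) # ?ys) = 0" using c l by (simp add: closed_at_def)
    then have 1: "D t = - \<phi> (mul (t - 0) v x # xs) (0 # (z + t) # ?ys)"
      unfolding dm_def cup_Cons dl.simps(1) D_def by (simp add: r0_def add_eq_0_iff)
    have "rp (mul (t - 0) v x) 0 (z + t) = smult t ([:- z * gev x t (z + t):] + [:0, 1:] * rp x t (z + t))"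
      unfolding rp_mul_v by (simp add: algebra_simps)
    then have "\<phi> (mul (t - 0) v x # xs) (0 # (z + t) # ?ys) = t * H t"
      unfolding E_coeffs_expand[OF \<phi> J l(1) ly, where x = "mul (t - 0) v x"] H_def gev_mul gev_v
      by (simp only: plinD(2)[OF PE]) (simp add: algebra_simps)
    then show ?thesis using 1 by simp
  qed
  have pH: "is_pfun H"
  proof -
    have h: "PF 1 hd" using PF_hd[of 0] by simp
    have zt: "PF 1 (\<lambda>ts. z + hd ts)" by (rule PF_add[OF PF_c h])
    have "PF 1 (\<lambda>ts. map (\<lambda>z. z + hd ts) ys ! i)" if "i < n" for i
      by (rule PF_cong[OF PF_add[OF PF_c[of _ "ys ! i"] h]]) (use that l in simp)
    then have m: "PL 1 n (\<lambda>ts. map (\<lambda>z. z + hd ts) ys)" using l by (simp add: PL_def)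
    have f: "PF 1 (\<lambda>ts. \<phi> (a # xs) (0 # (z + hd ts) # map (\<lambda>z. z + hd ts) ys))" for a
      by (rule PF_PL[OF _ PL_Cons[OF PF_c PL_Cons[OF zt m]]]) (use \<phi> l in \<open>simp add: CC_def\<close>)
    have g: "PF 1 (\<lambda>ts. gev x (hd ts) (z + hd ts))" by (rule gev_PF[OF h zt])
    have r: "PFP 1 (\<lambda>ts. [:- z * gev x (hd ts) (z + hd ts):] + [:0, 1:] * rp x (hd ts) (z + hd ts))"
      by (rule PFP_add[OF PFP_PF[OF PF_mult[OF PF_c g]] PFP_mult[OF PFP_const rp_PFP[OF h zt]]])
    have "PF 1 (\<lambda>ts. H (hd ts))"
      unfolding H_def E_coeffs_def by (rule PF_add[OF PF_mult[OF g f] PF_psum[OF r f]])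
    from is_pfun_PF[OF this PL_id] show ?thesis by simp
  qed
  have "pfun D = - pCons 0 (pfun H)"
    by (rule pfun_eqI) (simp add: D poly_pfun[OF pH])
  then have lcD: "coeff (pfun D) 1 = - H 0"
    using poly_pfun[OF pH, of 0] by (simp add: poly_0_coeff_0)
  have "dl (lin_htp \<phi>) (x # xs) (0 # z # ys)
      = dl (\<lambda>as bs. coeff (pfun (\<lambda>t. sl \<phi> v 0 as (map (\<lambda>z. z + t) bs))) 1) (x # xs) (0 # z # ys)"
    by (rule dl_cong) (use l in \<open>auto simp: lin_htp_def\<close>)
  also have "\<dots> = coeff (pfun D) 1"
  proof -
    have "is_pfun (\<lambda>t. sl \<phi> v 0 as (map (\<lambda>z. z + t) bs))"
      if "Suc (length as) = length (x # xs)" "length bs = Suc (length as)" for as bs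
      using is_pfun_shift[of "Suc n" "\<phi> (v # as)" bs 0] \<phi> that l by (simp add: CC_def)
    moreover have "length (0 # z # ys) = Suc (length (x # xs))" using l by simp
    ultimately show ?thesis unfolding D_def dl_shift[symmetric] by (intro conjunct2[OF dl_lc])
  qed
  finally have T: "dl (lin_htp \<phi>) (x # xs) (0 # z # ys) = - H 0" using lcD by simp
  \<comment> \<open>\<open>H 0\<close> has the same \<open>v\<close> part as the expansion of
    \<open>\<phi>\<close>; the difference of the two \<open>E\<close> parts is exactly the
    polynomial that is fed in by \<open>tht rz\<close>.\<close>
  have "rz x 0 z = rp x 0 z - ([:- z * gev x 0 z:] + [:0, 1:] * rp x 0 z)"
    unfolding rz_eq by (simp add: algebra_simps)
  then have "E_coeffs \<phi> 0 (rz x 0 z) xs (z # ys) = E_coeffs \<phi> 0 (rp x 0 z) xs (z # ys)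
      - E_coeffs \<phi> 0 ([:- z * gev x 0 z:] + [:0, 1:] * rp x 0 z) xs (z # ys)"
    by (simp only: poly_lin_diff[OF PE])
  moreover have "dm r0 (\<lambda>xs ys. - lin_htp \<phi> xs ys) (x # xs) (0 # z # ys) = H 0"
    unfolding dm_def cup_Cons dl_uminus T by (simp add: r0_def)
  ultimately show ?thesis
    unfolding E_coeffs_expand[OF \<phi> J l, where x = x] tht_Cons by (simp add: H_def)
qed

lemma cocycle_decompose_0:
  assumes \<phi>: "CC (Suc (Suc m)) \<phi>" "closed_at r0 (Suc (Suc m)) 0 \<phi>"
  shows "\<exists>\<psi> \<chi>. CC (Suc m) \<psi> \<and> CC (Suc m) \<chi> \<and> closed r1 (Suc m) \<chi> \<and>
    (\<forall>xs ys. length xs = Suc (Suc m) \<longrightarrow> length ys = Suc (Suc (Suc m)) \<longrightarrow> hd ys = 0 \<longrightarrow>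
      \<phi> xs ys = dm r0 \<psi> xs ys + cup tau \<chi> xs ys)"
proof -
  note L = localize_cocycle[OF \<phi>]
  let ?\<phi> = "\<lambda>xs ys. \<phi> xs ys + dm r0 (loc \<phi>) xs ys"
  let ?\<psi> = "\<lambda>xs ys. - lin_htp ?\<phi> xs ys - loc \<phi> xs ys"
  have CC: "CC (Suc m) ?\<psi>" by (rule CC_diff[OF CC_uminus[OF CC_lin_htp[OF L(1)]] CC_loc[OF \<phi>(1)]])
  have "\<phi> (x # xs) (y # z # ys) = dm r0 ?\<psi> (x # xs) (y # z # ys)
      + tht rz (E_coeffs ?\<phi> 0) (x # xs) (y # z # ys)" if "y = 0" "length xs = Suc m" "length ys = Suc m" for x xs y z ys
    using base_change_0[OF L that(2,3), of x z] unfolding dm_lin that(1) by (simp add: algebra_simps)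
  then show ?thesis
    using base_decompose[OF coeff_cocycle_E_coeffs[OF L] CC, of "\<lambda>y. y = 0" \<phi>] by blast
qed

text \<open>In degree 1 a coboundary consists of the action term alone, which vanishes with
  \<open>r0\<close> at first vertex 0. Being exact on the hyperplane thus means being 0.\<close>

lemma cocycle_1_0:
  assumes \<phi>: "CC 1 \<phi>" "closed_at r0 1 0 \<phi>"
  shows "\<phi> [x] [0, z] = 0"
proof -
  have \<phi>1: "CC (Suc 0) \<phi>" "closed_at r0 (Suc 0) 0 \<phi>" using \<phi> by simp_all
  note L = localize_cocycle[OF \<phi>1]
  have "dm r0 \<psi> [x] [0, z] = 0" for \<psi> by (simp add: dm_def r0_def)
  then show ?thesis
    using base_change_0[OF L, of "[]" "[]" x z] coeff_cocycle_0[OF coeff_cocycle_E_coeffs[OF L]] by simp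
qed

section \<open>Cohomology of the basic complex\<close>

definition one :: "'a list \<Rightarrow> 'k list \<Rightarrow> 'k" where "one = (\<lambda>_ _. 1)"

text \<open>Minus the derivative of \<open>fp x y z\<close> in \<open>d\<close> at 1. Since
  \<open>fp\<close> is multiplicative and its value at 1 is \<open>r1\<close>, the product rule
  makes \<open>alpha\<close> a derivation over \<open>r1\<close>.\<close>

definition alpha :: "'a \<Rightarrow> 'k \<Rightarrow> 'k \<Rightarrow> 'k" where
  "alpha x y z = poly (rp x y z) 1 + (y - z) * gev x y z"

text \<open>The first vertex times \<open>gamma\<close> is the coboundary of \<open>one\<close> for
  \<open>r0\<close>. \<open>gamma\<close> is what remains after division by that vertex, although
  \<open>one\<close> is not divisible by it.\<close>

definition gamma :: "'a list \<Rightarrow> 'k list \<Rightarrow> 'k" where "gamma = cup gev one"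
definition chi2 :: "'a list \<Rightarrow> 'k list \<Rightarrow> 'k" where "chi2 = cup alpha gamma"
definition w2 :: "'a list \<Rightarrow> 'k list \<Rightarrow> 'k" where "w2 xs ys = hd ys * chi2 xs ys"
definition w3 :: "'a list \<Rightarrow> 'k list \<Rightarrow> 'k" where "w3 = cup tau chi2"

lemma PF2_gev: "PF 2 (\<lambda>ys. gev x (ys ! 0) (ys ! 1))"
  by (rule gev_PF[OF PF_i PF_i]) simp_all

lemma char_gev: "char gev"
  unfolding char_def using slot_gev PF2_gev by blast

lemma char_alpha: "char alpha"
proof -
  have d: "PF 2 (\<lambda>ys. ys ! 0 - ys ! 1 :: 'k)" by (rule PF_diff[OF PF_i PF_i]) simp_all
  have "PF 2 (\<lambda>ys. poly (rp x (ys ! 0) (ys ! 1)) 1)" for x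
    by (rule PFP_poly[OF rp_PFP[OF PF_i PF_i] PF_c]) simp_all
  from PF_add[OF this PF_mult[OF d PF2_gev]] have "PF 2 (\<lambda>ys. alpha x (ys ! 0) (ys ! 1))" for x
    unfolding alpha_def .
  moreover have "slot y z (\<lambda>x. alpha x y z)" for y z
    unfolding alpha_def by (rule slot_add[OF slot_poly_rp slot_scale[OF slot_gev]])
  ultimately show ?thesis by (simp add: char_def)
qed

lemma char_tau: "char tau"
proof -
  have r: "PFP 2 (\<lambda>ys. rz x (ys ! 0) (ys ! 1))" for x using polychar_rz by (simp add: polychar_def)
  have z: "PF 2 (\<lambda>ys. ys ! 1 :: 'k)" by (rule PF_i) simp
  have "PF 2 (\<lambda>ys. tau x (ys ! 0) (ys ! 1))" for x
    unfolding tau_def by (rule PF_diff[OF PFP_poly[OF r PF_c] PF_mult[OF z PFP_poly[OF r PF_c]]])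
  moreover have "slot y z (\<lambda>x. tau x y z)" for y z
  proof -
    have "slot y z (\<lambda>x. poly (rz x y z) d)" for d
      by (rule polycharD[OF polychar_rz]) (simp add: poly_lin_def)
    then show ?thesis unfolding tau_def by (intro slot_diff slot_scale)
  qed
  ultimately show ?thesis by (simp add: char_def)
qed

definition derivation :: "('a \<Rightarrow> 'k \<Rightarrow> 'k \<Rightarrow> 'k) \<Rightarrow> ('a \<Rightarrow> 'k \<Rightarrow> 'k \<Rightarrow> 'k) \<Rightarrow> ('a \<Rightarrow> 'k \<Rightarrow> 'k \<Rightarrow> 'k) \<Rightarrow> bool" where
  "derivation r s a \<longleftrightarrow> (\<forall>x x' y z w. a (mul (z - y) x x') y w = r x y z * a x' z w + a x y z * s x' z w)"

lemma rp_mul': "rp (mul (z - y) a x) y w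
    = smult (gev a y z) ([:(z - y) * (z - w) * gev x z w:] + [:y, z - y:] * rp x z w) + rp a y z * fp x z w"
  by (subst rp_mul) (simp only: rp_mul_v)

lemma derivation_alpha: "derivation r1 r1 alpha"
  unfolding derivation_def alpha_def r1_def rp_mul' gev_mul
  by (simp add: poly_fp_1 algebra_simps)

lemma derivation_tau: "derivation r0 r1 tau"
  unfolding derivation_def tau_def rz_mul r0_def r1_def
  by (simp add: poly_fp_1 poly_fp_0 algebra_simps)

lemma dm_cup:
  assumes a: "derivation r s a" and l: "length xs = Suc (Suc n)" "length ys = Suc (Suc (Suc n))"
  shows "dm r (cup a \<chi>) xs ys = - cup a (dm s \<chi>) xs ys"
proof -
  obtain x x' xs' where xs: "xs = x # x' # xs'" "length xs' = n" using l(1) by (auto simp: length_Suc_conv)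
  obtain y z w ys' where ys: "ys = y # z # w # ys'" "length ys' = n" using l(2) by (auto simp: length_Suc_conv)
  have "dl (sl (cup a \<chi>) x y) (x' # xs') (z # w # ys') = dl (\<lambda>as bs. a x y z * \<chi> as bs) (x' # xs') (z # w # ys')"
    by (rule dl_cong) (use xs ys in \<open>auto simp: cup_def\<close>)
  then show ?thesis using a unfolding xs(1) ys(1) dm_def cup_Cons dl.simps(1) dl_scale derivation_def
    by (simp add: algebra_simps)
qed

text \<open>Since \<open>r0 x y z * z = y * r1 x y z\<close>, multiplication by the first vertex is
  a chain map from the complex of \<open>r1\<close> to that of \<open>r0\<close>.\<close>

lemma dm_hd:
  assumes "length ys = Suc (length xs)" "xs \<noteq> []"
  shows "dm r0 (\<lambda>xs ys. hd ys * \<psi> xs ys) xs ys = hd ys * dm r1 \<psi> xs ys"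
proof -
  obtain x xs' where xs: "xs = x # xs'" using assms(2) by (cases xs) auto
  obtain y z ys' where ys: "ys = y # z # ys'" using assms(1) xs by (auto simp: length_Suc_conv)
  show ?thesis using dl_scale_hd[OF assms(1), of "\<lambda>t. t" \<psi>] unfolding xs ys dm_def
    by (simp add: r0_def r1_def algebra_simps)
qed

lemma CC_hd: "CC n \<phi> \<Longrightarrow> CC n (\<lambda>xs ys. hd ys * \<phi> xs ys)"
  by (rule CC_scale[OF _ PF_hd])

lemma CC_one: "CC 0 one"
  by (simp add: CC_def one_def)

lemma CC_gamma: "CC 1 gamma" and CC_chi2: "CC 2 chi2" and CC_w2: "CC 2 w2" and CC_w3: "CC 3 w3"
proof -
  show 1: "CC 1 gamma" using CC_cup[OF char_gev CC_one] by (simp add: gamma_def)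
  then show 2: "CC 2 chi2" using CC_cup[OF char_alpha, of 1 gamma] by (simp add: chi2_def numeral_2_eq_2)
  then show "CC 2 w2" unfolding w2_def[abs_def] by (rule CC_hd)
  show "CC 3 w3" using CC_cup[OF char_tau 2] by (simp add: w3_def numeral_3_eq_3 numeral_2_eq_2)
qed

lemma dm_gamma: "length xs = 2 \<Longrightarrow> length ys = 3 \<Longrightarrow> dm r1 gamma xs ys = 0"
  by (auto simp: gamma_def one_def dm_def r1_def gev_mul numeral_2_eq_2 numeral_3_eq_3 length_Suc_conv)

lemma dm_chi2: "length xs = 3 \<Longrightarrow> length ys = 4 \<Longrightarrow> dm r1 chi2 xs ys = 0"
  unfolding chi2_def by (subst dm_cup[OF derivation_alpha, of _ 1]) (auto simp: cup_def dm_gamma)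

lemma dm_w2: "length xs = 3 \<Longrightarrow> length ys = 4 \<Longrightarrow> dm r0 w2 xs ys = 0"
  unfolding w2_def[abs_def] by (subst dm_hd) (auto simp: dm_chi2)

lemma dm_w3: "length xs = 4 \<Longrightarrow> length ys = 5 \<Longrightarrow> dm r0 w3 xs ys = 0"
  unfolding w3_def by (subst dm_cup[OF derivation_tau, of _ 2]) (auto simp: cup_def dm_chi2)

text \<open>\<open>tau\<close> is \<open>y * poly (rp x y z) 1 - z * poly (rp x y z) 0\<close> plus
  a multiple of \<open>gev\<close>. The first term belongs to \<open>w2\<close>; the second is the
  coboundary of the value of \<open>rp\<close> at 0, and the factor \<open>z - 1 + y ^ 2\<close>
  absorbs the multiples of \<open>gev x y z * gev x' z w\<close>.\<close>

lemma tau_gamma: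
  assumes "length xs = 2" "length ys = 3"
  shows "cup tau gamma xs ys = w2 xs ys
    + dm r0 (cup (\<lambda>x y z. poly (rp x y z) 0 + (z - 1 + y ^ 2) * gev x y z) one) xs ys"
proof -
  obtain x x' y z w where xs: "xs = [x, x']" "ys = [y, z, w]"
    using assms by (auto simp: numeral_2_eq_2 numeral_3_eq_3 length_Suc_conv)
  show ?thesis unfolding xs
    by (simp add: gamma_def one_def dm_def w2_def chi2_def alpha_def tau_def rz_eq r0_def rp_mul'
        gev_mul poly_fp_0 algebra_simps power2_eq_square)
qed

lemma CC_eta: "CC 1 (cup (\<lambda>x y z. poly (rp x y z) 0 + (z - 1 + y ^ 2) * gev x y z) one)"
proof -
  have c: "PF 2 (\<lambda>ys. ys ! 1 - 1 + ys ! 0 ^ 2 :: 'k)"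
    by (rule PF_add[OF PF_diff[OF PF_i PF_c] PF_power[OF PF_i]]) simp_all
  have "PF 2 (\<lambda>ys. poly (rp x (ys ! 0) (ys ! 1)) 0)" for x
    by (rule PFP_poly[OF rp_PFP[OF PF_i PF_i] PF_c]) simp_all
  from PF_add[OF this PF_mult[OF c PF2_gev]]
  have "char (\<lambda>x y z. poly (rp x y z) 0 + (z - 1 + y ^ 2) * gev x y z)"
    unfolding char_def using slot_add[OF slot_poly_rp slot_scale[OF slot_gev]] by blast
  from CC_cup[OF this CC_one] show ?thesis by simp
qed

text \<open>Of the product rule for \<open>alpha\<close> the term
  \<open>alpha x y z * r1 x' z w\<close> is left over, and \<open>r1 x' z w\<close> is the last
  vertex times \<open>gev x' z w\<close>.\<close>

lemma alpha_one_dm: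
  assumes "length xs = 2" "length ys = 3"
  shows "dm r1 (cup alpha one) xs ys = - (last ys * chi2 xs ys)"
proof -
  obtain x x' y z w where xs: "xs = [x, x']" "ys = [y, z, w]"
    using assms by (auto simp: numeral_2_eq_2 numeral_3_eq_3 length_Suc_conv)
  have "alpha (mul (z - y) x x') y w = r1 x y z * alpha x' z w + alpha x y z * r1 x' z w"
    using derivation_alpha unfolding derivation_def by blast
  then show ?thesis unfolding xs by (simp add: dm_def one_def chi2_def gamma_def r1_def)
qed

definition u1 :: "'a list \<Rightarrow> 'k list \<Rightarrow> 'k" where "u1 xs ys = - (hd ys * cup alpha one xs ys)"
definition u2 :: "'a list \<Rightarrow> 'k list \<Rightarrow> 'k" where "u2 = cup tau (cup alpha one)"

lemma CC_u1: "CC 1 u1" and CC_u2: "CC 2 u2"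
proof -
  have 1: "CC (Suc 0) (cup alpha one)" by (rule CC_cup[OF char_alpha CC_one])
  show "CC 1 u1" unfolding u1_def[abs_def] using CC_uminus[OF CC_hd[OF 1]] by simp
  show "CC 2 u2" unfolding u2_def numeral_2_eq_2 by (rule CC_cup[OF char_tau 1])
qed

lemma dm_u1: "length xs = 2 \<Longrightarrow> length ys = 3 \<Longrightarrow> dm r0 u1 xs ys = last ys * w2 xs ys"
  unfolding u1_def[abs_def] dm_lin by (subst dm_hd) (auto simp: alpha_one_dm w2_def)

lemma dm_u2: "length xs = 3 \<Longrightarrow> length ys = 4 \<Longrightarrow> dm r0 u2 xs ys = last ys * w3 xs ys"
proof -
  assume l: "length xs = 3" "length ys = 4"
  then have "last (tl ys) = last ys" by (cases ys; cases "tl ys") auto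
  then show ?thesis unfolding u2_def
    by (subst dm_cup[OF derivation_tau, of _ 1]) (use l in \<open>auto simp: cup_def alpha_one_dm w3_def\<close>)
qed

subsection \<open>Dividing by the first vertex\<close>

lemma poly_shift_eq: "p = pCons (coeff p 0) (poly_shift 1 p)"
  by (rule poly_eqI) (auto simp: coeff_pCons coeff_poly_shift split: nat.split)

text \<open>As a polynomial in the first vertex the cochain has no constant term, so its
  coefficients can be shifted down. The work lies in showing that the quotient is again multilinear
  at first vertex 0.\<close>

lemma divide_by_hd:
  assumes \<psi>: "CC n \<psi>" and 0: "\<And>xs ys. length xs = n \<Longrightarrow> length ys = Suc n \<Longrightarrow> hd ys = 0 \<Longrightarrow> \<psi> xs ys = 0"
  shows "\<exists>\<psi>'. CC n \<psi>' \<and> (\<forall>xs ys. length xs = n \<longrightarrow> length ys = Suc n \<longrightarrow> \<psi> xs ys = hd ys * \<psi>' xs ys)"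
proof -
  \<comment> \<open>At first vertex 0 the quotient must be the linear coefficient, the only value
    compatible with polynomiality.\<close>
  define \<psi>' where "\<psi>' xs ys = (if hd ys = 0 then coeff (pfun (\<lambda>t. \<psi> xs (t # tl ys))) 1 else \<psi> xs ys / hd ys)" for xs ys
  have PFPs: "PFP n (\<lambda>ls. pfun (\<lambda>t. \<psi> xs (t # ls)))" if "length xs = n" for xs
    using \<psi> that by (intro PFP_pfun) (simp add: CC_def)
  have pp: "poly (pfun (\<lambda>t. \<psi> xs (t # ls))) t = \<psi> xs (t # ls)" if "length xs = n" "length ls = n" for xs ls t
    using \<psi> that by (intro poly_pfun_PF[of n]) (simp_all add: CC_def)
  have isp: "is_pfun (\<lambda>t. \<psi> xs (t # ls))" if "length xs = n" "length ls = n" for xs ls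
    unfolding is_pfun_def using pp[OF that] by (intro exI[of _ "pfun (\<lambda>t. \<psi> xs (t # ls))"]) auto
  have c0: "coeff (pfun (\<lambda>t. \<psi> xs (t # ls))) 0 = 0" if "length xs = n" "length ls = n" for xs ls
    using pp[OF that, of 0] 0[of xs "0 # ls"] that by (simp add: poly_0_coeff_0)
  have shift: "\<psi>' xs (t # ls) = poly (poly_shift 1 (pfun (\<lambda>t. \<psi> xs (t # ls)))) t"
    and prod: "\<psi> xs (t # ls) = t * \<psi>' xs (t # ls)"
    if l: "length xs = n" "length ls = n" for xs t ls
  proof -
    let ?p = "pfun (\<lambda>t. \<psi> xs (t # ls))"
    have "\<psi> xs (t # ls) = poly (pCons (coeff ?p 0) (poly_shift 1 ?p)) t"
      using pp[OF l, of t] poly_shift_eq[of ?p] by simp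
    then have *: "\<psi> xs (t # ls) = t * poly (poly_shift 1 ?p) t" using c0[OF l] by simp
    show s: "\<psi>' xs (t # ls) = poly (poly_shift 1 ?p) t"
    proof (cases "t = 0")
      case True
      then show ?thesis by (simp add: \<psi>'_def poly_0_coeff_0 coeff_poly_shift)
    next
      case False
      then show ?thesis using * by (simp add: \<psi>'_def)
    qed
    show "\<psi> xs (t # ls) = t * \<psi>' xs (t # ls)" unfolding s by (rule *)
  qed
  have PF: "PF (Suc n) (\<psi>' xs)" if l: "length xs = n" for xs
  proof -
    have "PFP n (\<lambda>ls. poly_shift 1 (pfun (\<lambda>t. \<psi> xs (t # ls))))"
    proof -
      obtain N where N: "\<And>ls. length ls = n \<Longrightarrow> degree (pfun (\<lambda>t. \<psi> xs (t # ls))) \<le> N"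
        using PFPs[OF l] by (auto simp: PFP_def)
      have "degree (poly_shift 1 (pfun (\<lambda>t. \<psi> xs (t # ls)))) \<le> N" if "length ls = n" for ls
        by (rule degree_le) (use N[OF that] in \<open>auto simp: coeff_poly_shift coeff_eq_0\<close>)
      then show ?thesis using PFPs[OF l] by (auto simp: PFP_def coeff_poly_shift)
    qed
    from PFP_poly[OF PFP_PL[OF this PL_tl] PF_hd] show ?thesis
      by (rule PF_cong) (use shift[OF l] in \<open>auto simp: length_Suc_conv\<close>)
  qed
  have "mlin n \<psi>'"
  proof (cases n)
    case 0 then show ?thesis by simp
  next
    case (Suc m)
    have "slot y z (\<lambda>x. \<psi>' (x # xs) (y # z # ys))" if l: "length xs = m" "length ys = m" for xs ys y z
    proof (cases "y = 0")
      case False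
      have "slot y z (\<lambda>x. (1 / y) * \<psi> (x # xs) (y # z # ys))"
        using \<psi> Suc l by (intro slot_scale) (simp add: CC_def)
      then show ?thesis using False by (simp add: \<psi>'_def)
    next
      case True
      have s: "slot t z (\<lambda>x. \<psi> (x # xs) (t # z # ys))" for t using \<psi> Suc l by (simp add: CC_def)
      have p: "is_pfun (\<lambda>t. \<psi> (x # xs) (t # z # ys))" for x using isp[of "x # xs" "z # ys"] Suc l by simp
      have q: "coeff (pfun (\<lambda>t. \<psi> (x # xs) (t # z # ys))) 0 = 0" for x using c0[of "x # xs" "z # ys"] Suc l by simp
      \<comment> \<open>The factor of \<open>dd\<close> is \<open>t - z\<close>, not
        \<open>- z\<close>; the extra \<open>t\<close> contributes only the constant coefficient to
        the linear one, and that is 0 by \<open>q\<close>.\<close>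
      have dd: "pfun (\<lambda>t. (t - z) * \<psi> (x # xs) (t # z # ys)) = [:- z, 1:] * pfun (\<lambda>t. \<psi> (x # xs) (t # z # ys))" for x
        by (rule pfun_eqI) (simp add: poly_pfun[OF p] algebra_simps)
      show ?thesis unfolding True
        by (rule slotI) (simp_all add: \<psi>'_def slotD(1-3)[OF s] pfun_lin(2)[OF p] pfun_lin(1)[OF p p] dd q)
    qed
    moreover have "mlin m (sl \<psi>' x y)" for x y
    proof (cases "y = 0")
      case False
      have "mlin m (\<lambda>as bs. (1 / y) * sl \<psi> x y as bs)"
        using \<psi> Suc by (intro mlin_scale) (simp add: CC_def)
      then show ?thesis by (rule mlin_cong) (use False in \<open>simp add: \<psi>'_def\<close>)
    next
      case True
      have "mlin m (\<lambda>as bs. coeff (pfun (\<lambda>t. sl \<psi> x t as bs)) 1)"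
      proof (rule mlin_lc)
        show "mlin m (sl \<psi> x t)" for t using \<psi> Suc by (simp add: CC_def)
        show "is_pfun (\<lambda>t. sl \<psi> x t as bs)" if "length as = m" "length bs = Suc m" for as bs
          using isp[of "x # as" bs] Suc that by simp
      qed
      then show ?thesis by (rule mlin_cong) (simp add: \<psi>'_def True)
    qed
    ultimately show ?thesis using Suc by simp
  qed
  then have "CC n \<psi>'" using PF by (simp add: CC_def)
  moreover have "\<psi> xs ys = hd ys * \<psi>' xs ys" if "length xs = n" "length ys = Suc n" for xs ys
    using prod[of xs "tl ys" "hd ys"] that by (cases ys) auto
  ultimately show ?thesis by blast
qed

lemma cancel_hd:
  assumes "CC n \<phi>" "CC n \<psi>" "\<And>xs ys. length xs = n \<Longrightarrow> length ys = Suc n \<Longrightarrow> hd ys * \<phi> xs ys = hd ys * \<psi> xs ys"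
    and l: "length xs = n" "length ys = Suc n"
  shows "\<phi> xs ys = \<psi> xs ys"
proof -
  obtain y ls where ys: "ys = y # ls" "length ls = n" using l by (auto simp: length_Suc_conv)
  have p: "is_pfun (\<lambda>t. \<phi> xs (t # ls))" if "CC n \<phi>" for \<phi>
  proof -
    have "PF (Suc n) (\<phi> xs)" using that l by (simp add: CC_def)
    then have "poly (pfun (\<lambda>t. \<phi> xs (t # ls))) t = \<phi> xs (t # ls)" for t
      by (rule poly_pfun_PF) (rule ys(2))
    then show ?thesis unfolding is_pfun_def by (intro exI[of _ "pfun (\<lambda>t. \<phi> xs (t # ls))"]) auto
  qed
  show ?thesis unfolding ys(1)
  proof (rule is_pfun_eq_off[OF p[OF assms(1)] p[OF assms(2)], of "{0}"])
    fix t assume "t \<notin> {0::'k}"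
    then show "\<phi> xs (t # ls) = \<psi> xs (t # ls)" using assms(3)[OF l(1), of "t # ls"] ys by simp
  qed simp
qed

lemma closed_iff: "closed r n \<phi> \<longleftrightarrow> (\<forall>xs ys. length xs = Suc n \<longrightarrow> length ys = Suc (Suc n) \<longrightarrow> dm r \<phi> xs ys = 0)"
  by (auto simp: closed_def closed_at_def length_Suc_conv)

definition exact :: "('a \<Rightarrow> 'k \<Rightarrow> 'k \<Rightarrow> 'k) \<Rightarrow> nat \<Rightarrow> ('a list \<Rightarrow> 'k list \<Rightarrow> 'k) \<Rightarrow> bool" where
  "exact r n \<phi> \<longleftrightarrow> (\<exists>\<psi>. CC n \<psi> \<and> (\<forall>xs ys. length xs = Suc n \<longrightarrow> length ys = Suc (Suc n) \<longrightarrow> \<phi> xs ys = dm r \<psi> xs ys))"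

lemma dm_eq:
  assumes "length ys = Suc (length xs)" "length xs = Suc n"
    "\<And>as bs. length as = n \<Longrightarrow> length bs = Suc n \<Longrightarrow> \<Phi> as bs = \<Psi> as bs"
  shows "dm r \<Phi> xs ys = dm r \<Psi> xs ys"
  by (rule dm_cong) (use assms in auto)

text \<open>Subtracting \<open>dm r0 \<kappa>\<close> does not change the coboundary of
  \<open>\<psi>\<close> and makes it vanish at first vertex 0. It can then be divided by that
  vertex, and \<open>dm_hd\<close> turns the quotient into a primitive for
  \<open>r1\<close>.\<close>

lemma exact_r1:
  assumes \<chi>: "CC (Suc (Suc n)) \<chi>" and \<psi>: "CC (Suc n) \<psi>" and \<kappa>: "CC n \<kappa>"
    and 1: "\<And>xs ys. length xs = Suc (Suc n) \<Longrightarrow> length ys = Suc (Suc (Suc n)) \<Longrightarrow> hd ys * \<chi> xs ys = dm r0 \<psi> xs ys"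
    and 0: "\<And>xs ys. length xs = Suc n \<Longrightarrow> length ys = Suc (Suc n) \<Longrightarrow> hd ys = 0 \<Longrightarrow> \<psi> xs ys = dm r0 \<kappa> xs ys"
  shows "exact r1 (Suc n) \<chi>"
proof -
  have "CC (Suc n) (\<lambda>xs ys. \<psi> xs ys - dm r0 \<kappa> xs ys)"
    by (rule CC_diff[OF \<psi> CC_dm[OF char_r0 \<kappa>]])
  then obtain \<psi>' where \<psi>': "CC (Suc n) \<psi>'"
    and d: "\<And>xs ys. length xs = Suc n \<Longrightarrow> length ys = Suc (Suc n) \<Longrightarrow> \<psi> xs ys - dm r0 \<kappa> xs ys = hd ys * \<psi>' xs ys"
    using divide_by_hd[of "Suc n" "\<lambda>xs ys. \<psi> xs ys - dm r0 \<kappa> xs ys"] 0 by auto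
  have "\<chi> xs ys = dm r1 \<psi>' xs ys" if l: "length xs = Suc (Suc n)" "length ys = Suc (Suc (Suc n))" for xs ys
  proof (rule cancel_hd[OF \<chi> CC_dm[OF char_r1 \<psi>'] _ l])
    fix xs ys assume l: "length (xs :: 'a list) = Suc (Suc n)" "length (ys :: 'k list) = Suc (Suc (Suc n))"
    have "dm r0 (\<lambda>xs ys. \<psi> xs ys - dm r0 \<kappa> xs ys) xs ys = dm r0 (\<lambda>xs ys. hd ys * \<psi>' xs ys) xs ys"
      by (rule dm_eq[OF _ l(1)]) (use l d in auto)
    moreover have "dm r0 (dm r0 \<kappa>) xs ys = 0" by (rule dm_dm[OF multiplicative_r0]) (use l in auto)
    moreover have "dm r0 (\<lambda>xs ys. hd ys * \<psi>' xs ys) xs ys = hd ys * dm r1 \<psi>' xs ys"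
      by (rule dm_hd) (use l in auto)
    ultimately show "hd ys * \<chi> xs ys = hd ys * dm r1 \<psi>' xs ys" using 1[OF l] unfolding dm_lin by simp
  qed
  then show ?thesis using \<psi>' by (auto simp: exact_def)
qed

lemma closed_hd: "closed r1 n \<chi> \<Longrightarrow> closed r0 n (\<lambda>xs ys. hd ys * \<chi> xs ys)"
  unfolding closed_iff
proof (intro allI impI)
  fix xs ys
  assume c: "\<forall>xs ys. length xs = Suc n \<longrightarrow> length ys = Suc (Suc n) \<longrightarrow> dm r1 \<chi> xs ys = 0"
    and l: "length (xs :: 'a list) = Suc n" "length (ys :: 'k list) = Suc (Suc n)"
  have "length ys = Suc (length xs)" "xs \<noteq> []" using l by auto
  from dm_hd[OF this] show "dm r0 (\<lambda>xs ys. hd ys * \<chi> xs ys) xs ys = 0" using c l by simp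
qed

lemma r1_cocycle_1:
  assumes \<chi>: "CC 1 \<chi>" "closed r1 1 \<chi>"
  shows "\<exists>c \<psi>. CC 0 \<psi> \<and> (\<forall>xs ys. length xs = 1 \<longrightarrow> length ys = 2 \<longrightarrow> \<chi> xs ys = c * gamma xs ys + dm r1 \<psi> xs ys)"
proof -
  have "closed r0 1 (\<lambda>xs ys. hd ys * \<chi> xs ys)" by (rule closed_hd[OF \<chi>(2)])
  then obtain \<psi> where \<psi>: "CC 0 \<psi>"
    and e: "\<And>xs ys. length xs = 1 \<Longrightarrow> length ys = 2 \<Longrightarrow> hd ys * \<chi> xs ys = dm r0 \<psi> xs ys"
    using cocycle_1[OF CC_hd[OF \<chi>(1)]] by blast
  \<comment> \<open>The value at 0 obstructs the division of \<open>\<psi>\<close> by the first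
    vertex; removing \<open>c\<close> times \<open>one\<close> costs exactly \<open>c\<close> times
    \<open>gamma\<close>.\<close>
  define c where "c = \<psi> [] [0]"
  have C0: "CC 0 (\<lambda>xs ys. \<psi> xs ys - c * one xs ys)" by (rule CC_diff[OF \<psi> CC_cmult[OF CC_one]])
  have "\<psi> xs ys - c * one xs ys = 0" if "length xs = 0" "length ys = Suc 0" "hd ys = 0" for xs ys
  proof -
    have "xs = []" "ys = [0]" using that by (auto simp: length_Suc_conv)
    then show ?thesis by (simp add: c_def one_def)
  qed
  from divide_by_hd[OF C0 this] obtain \<psi>' where \<psi>': "CC 0 \<psi>'"
    and d: "\<And>xs ys. length xs = 0 \<Longrightarrow> length ys = Suc 0 \<Longrightarrow> \<psi> xs ys - c * one xs ys = hd ys * \<psi>' xs ys"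
    by blast
  have "\<chi> xs ys = c * gamma xs ys + dm r1 \<psi>' xs ys" if l: "length xs = 1" "length ys = 2" for xs ys
  proof -
    have C: "CC 1 (\<lambda>xs ys. c * gamma xs ys + dm r1 \<psi>' xs ys)"
      using CC_add[OF CC_cmult[OF CC_gamma]] CC_dm[OF char_r1 \<psi>'] by simp
    show ?thesis
    proof (rule cancel_hd[OF \<chi>(1) C])
      fix xs ys assume "length (xs :: 'a list) = 1" "length (ys :: 'k list) = Suc 1"
      then obtain x y z where xy: "xs = [x]" "ys = [y, z]" by (auto simp: length_Suc_conv)
      have "\<psi> [] [z] = c + z * \<psi>' [] [z]" using d[of "[]" "[z]"] by (simp add: one_def diff_eq_eq add.commute)
      then show "hd ys * \<chi> xs ys = hd ys * (c * gamma xs ys + dm r1 \<psi>' xs ys)"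
        using e[of xs ys] unfolding xy by (simp add: dm_def r0_def r1_def gamma_def one_def algebra_simps)
    qed (use l in auto)
  qed
  then show ?thesis using \<psi>' by blast
qed

lemma exactD: "exact r n \<phi> \<Longrightarrow> \<exists>\<psi>. CC n \<psi> \<and> (\<forall>xs ys. length xs = Suc n \<longrightarrow> length ys = Suc (Suc n) \<longrightarrow> \<phi> xs ys = dm r \<psi> xs ys)"
  by (simp add: exact_def)

lemma cup_zero: "cup a (\<lambda>_ _. 0) xs ys = 0"
  by (simp add: cup_def)

lemma cup_tau_dm:
  assumes "\<And>xs ys. length xs = Suc n \<Longrightarrow> length ys = Suc (Suc n) \<Longrightarrow> \<chi> xs ys = \<chi>' xs ys + dm r1 \<zeta> xs ys"
    and l: "length xs = Suc (Suc n)" "length ys = Suc (Suc (Suc n))"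
  shows "cup tau \<chi> xs ys = cup tau \<chi>' xs ys - dm r0 (cup tau \<zeta>) xs ys"
  unfolding dm_cup[OF derivation_tau l] using assms(1)[of "tl xs" "tl ys"] l by (simp add: cup_def algebra_simps)

lemma r0_cocycle_2_gen:
  assumes \<phi>: "CC 2 \<phi>" and
    d: "\<exists>\<psi> \<chi>. CC 1 \<psi> \<and> CC 1 \<chi> \<and> closed r1 1 \<chi> \<and>
    (\<forall>xs ys. length xs = 2 \<longrightarrow> length ys = 3 \<longrightarrow> P (hd ys) \<longrightarrow> \<phi> xs ys = dm r0 \<psi> xs ys + cup tau \<chi> xs ys)"
  shows "\<exists>c \<psi>. CC 1 \<psi> \<and> (\<forall>xs ys. length xs = 2 \<longrightarrow> length ys = 3 \<longrightarrow> P (hd ys) \<longrightarrow> \<phi> xs ys = c * w2 xs ys + dm r0 \<psi> xs ys)"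
proof -
  obtain \<psi> \<chi> where \<psi>: "CC 1 \<psi>" "CC 1 \<chi>" "closed r1 1 \<chi>" and
    e: "\<And>xs ys. length xs = 2 \<Longrightarrow> length ys = 3 \<Longrightarrow> P (hd ys) \<Longrightarrow> \<phi> xs ys = dm r0 \<psi> xs ys + cup tau \<chi> xs ys"
    using d by blast
  obtain c \<zeta> where \<zeta>: "CC 0 \<zeta>" and
    z: "\<And>xs ys. length xs = Suc 0 \<Longrightarrow> length ys = Suc (Suc 0) \<Longrightarrow> \<chi> xs ys = c * gamma xs ys + dm r1 \<zeta> xs ys"
    using r1_cocycle_1[OF \<psi>(2,3)] by (auto simp: numeral_2_eq_2)
  let ?\<eta> = "cup (\<lambda>x y z. poly (rp x y z) 0 + (z - 1 + y ^ 2) * gev x y z) one"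
  let ?\<psi> = "\<lambda>xs ys. \<psi> xs ys + c * ?\<eta> xs ys - cup tau \<zeta> xs ys"
  have "CC 1 ?\<psi>" using CC_diff[OF CC_add[OF \<psi>(1) CC_cmult[OF CC_eta, of c]]] CC_cup[OF char_tau \<zeta>] by simp
  moreover have "\<phi> xs ys = c * w2 xs ys + dm r0 ?\<psi> xs ys" if l: "length xs = 2" "length ys = 3" "P (hd ys)" for xs ys
  proof -
    have "cup tau \<chi> xs ys = cup tau (\<lambda>xs ys. c * gamma xs ys) xs ys - dm r0 (cup tau \<zeta>) xs ys"
      by (rule cup_tau_dm[of 0]) (use l z in auto)
    moreover have "cup tau (\<lambda>xs ys. c * gamma xs ys) xs ys = c * cup tau gamma xs ys" by (simp add: cup_def)
    ultimately show ?thesis using e[OF l] tau_gamma[OF l(1,2)] unfolding dm_lin by (simp add: algebra_simps)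
  qed
  ultimately show ?thesis by blast
qed

lemma r0_cocycle_2:
  assumes "CC 2 \<phi>" "closed r0 2 \<phi>"
  shows "\<exists>c \<psi>. CC 1 \<psi> \<and> (\<forall>xs ys. length xs = 2 \<longrightarrow> length ys = 3 \<longrightarrow> \<phi> xs ys = c * w2 xs ys + dm r0 \<psi> xs ys)"
  using r0_cocycle_2_gen[OF assms(1), of "\<lambda>_. True"] cocycle_decompose[of 0 \<phi>] assms
  by (simp add: numeral_2_eq_2 numeral_3_eq_3)

text \<open>The class \<open>w2\<close> carries the first vertex as a factor, so its multiple drops
  out at first vertex 0.\<close>

lemma r0_cocycle_2_at_0:
  assumes "CC 2 \<phi>" "closed_at r0 2 0 \<phi>"
  shows "\<exists>\<psi>. CC 1 \<psi> \<and> (\<forall>xs ys. length xs = 2 \<longrightarrow> length ys = 3 \<longrightarrow> hd ys = 0 \<longrightarrow> \<phi> xs ys = dm r0 \<psi> xs ys)"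
proof -
  have "\<exists>c \<psi>. CC 1 \<psi> \<and> (\<forall>xs ys. length xs = 2 \<longrightarrow> length ys = 3 \<longrightarrow> hd ys = 0 \<longrightarrow> \<phi> xs ys = c * w2 xs ys + dm r0 \<psi> xs ys)"
    using r0_cocycle_2_gen[OF assms(1), of "\<lambda>y. y = 0"] cocycle_decompose_0[of 0 \<phi>] assms
    by (simp add: numeral_2_eq_2 numeral_3_eq_3)
  then show ?thesis by (auto simp: w2_def)
qed

lemma closed_at_0_of_dm:
  assumes "\<And>xs ys. length xs = Suc n \<Longrightarrow> length ys = Suc (Suc n) \<Longrightarrow> hd ys * \<chi> xs ys = dm r0 \<psi> xs ys"
  shows "closed_at r0 n 0 \<psi>"
  unfolding closed_at_def
proof (intro allI impI)
  fix xs ys assume "length (xs :: 'a list) = Suc n" "length (ys :: 'k list) = Suc n"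
  then show "dm r0 \<psi> xs (0 # ys) = 0" using assms[of xs "0 # ys"] by simp
qed

text \<open>A multiple of \<open>w2\<close> is removed through \<open>chi2\<close>, because
  \<open>w2\<close> is the first vertex times \<open>chi2\<close>. The primitive left over is a
  degree 1 cocycle on the hyperplane, hence 0 there, and \<open>exact_r1\<close> applies with
  \<open>\<kappa> = 0\<close>.\<close>

lemma r1_cocycle_2:
  assumes \<chi>: "CC 2 \<chi>" "closed r1 2 \<chi>"
  shows "\<exists>c \<psi>. CC 1 \<psi> \<and> (\<forall>xs ys. length xs = 2 \<longrightarrow> length ys = 3 \<longrightarrow> \<chi> xs ys = c * chi2 xs ys + dm r1 \<psi> xs ys)"
proof -
  obtain c \<psi> where \<psi>: "CC 1 \<psi>" and
    e: "\<And>xs ys. length xs = 2 \<Longrightarrow> length ys = 3 \<Longrightarrow> hd ys * \<chi> xs ys = c * w2 xs ys + dm r0 \<psi> xs ys"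
    using r0_cocycle_2[OF CC_hd[OF \<chi>(1)] closed_hd[OF \<chi>(2)]] by blast
  let ?\<chi> = "\<lambda>xs ys. \<chi> xs ys - c * chi2 xs ys"
  have C: "CC (Suc (Suc 0)) ?\<chi>" using CC_diff[OF \<chi>(1) CC_cmult[OF CC_chi2]] by (simp add: numeral_2_eq_2)
  have e': "hd ys * ?\<chi> xs ys = dm r0 \<psi> xs ys" if "length xs = Suc (Suc 0)" "length ys = Suc (Suc (Suc 0))" for xs ys
    using e[of xs ys] that by (simp add: w2_def algebra_simps numeral_2_eq_2 numeral_3_eq_3)
  have z: "closed_at r0 1 0 \<psi>" using closed_at_0_of_dm[OF e'] by simp
  have "exact r1 (Suc 0) ?\<chi>"
  proof (rule exact_r1[OF C _ CC_zero e'])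
    fix xs ys assume "length (xs :: 'a list) = Suc 0" "length (ys :: 'k list) = Suc (Suc 0)" "hd ys = 0"
    then obtain x z where xy: "xs = [x]" "ys = [0, z]" by (auto simp: length_Suc_conv)
    show "\<psi> xs ys = dm r0 (\<lambda>_ _. 0) xs ys"
      unfolding xy using cocycle_1_0[OF \<psi> z] by (simp add: dm_def)
  qed (use \<psi> in auto)
  then obtain \<psi>' where "CC 1 \<psi>'" "\<forall>xs ys. length xs = 2 \<longrightarrow> length ys = 3 \<longrightarrow> ?\<chi> xs ys = dm r1 \<psi>' xs ys"
    by (auto simp: exact_def numeral_2_eq_2 numeral_3_eq_3)
  then show ?thesis by (intro exI[of _ c] exI[of _ \<psi>']) (auto simp: algebra_simps)
qed

lemma r0_cocycle_3_gen:
  assumes d: "\<exists>\<psi> \<chi>. CC 2 \<psi> \<and> CC 2 \<chi> \<and> closed r1 2 \<chi> \<and>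
    (\<forall>xs ys. length xs = 3 \<longrightarrow> length ys = 4 \<longrightarrow> P (hd ys) \<longrightarrow> \<phi> xs ys = dm r0 \<psi> xs ys + cup tau \<chi> xs ys)"
  shows "\<exists>c \<psi>. CC 2 \<psi> \<and> (\<forall>xs ys. length xs = 3 \<longrightarrow> length ys = 4 \<longrightarrow> P (hd ys) \<longrightarrow> \<phi> xs ys = c * w3 xs ys + dm r0 \<psi> xs ys)"
proof -
  obtain \<psi> \<chi> where \<psi>: "CC 2 \<psi>" "CC 2 \<chi>" "closed r1 2 \<chi>" and
    e: "\<And>xs ys. length xs = 3 \<Longrightarrow> length ys = 4 \<Longrightarrow> P (hd ys) \<Longrightarrow> \<phi> xs ys = dm r0 \<psi> xs ys + cup tau \<chi> xs ys"
    using d by blast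
  obtain c \<zeta> where \<zeta>: "CC 1 \<zeta>" and
    z: "\<And>xs ys. length xs = 2 \<Longrightarrow> length ys = 3 \<Longrightarrow> \<chi> xs ys = c * chi2 xs ys + dm r1 \<zeta> xs ys"
    using r1_cocycle_2[OF \<psi>(2,3)] by blast
  let ?\<psi> = "\<lambda>xs ys. \<psi> xs ys - cup tau \<zeta> xs ys"
  have "CC 2 ?\<psi>" using CC_diff[OF \<psi>(1)] CC_cup[OF char_tau \<zeta>] by (simp add: numeral_2_eq_2)
  moreover have "\<phi> xs ys = c * w3 xs ys + dm r0 ?\<psi> xs ys" if l: "length xs = 3" "length ys = 4" "P (hd ys)" for xs ys
  proof -
    have "cup tau \<chi> xs ys = cup tau (\<lambda>xs ys. c * chi2 xs ys) xs ys - dm r0 (cup tau \<zeta>) xs ys"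
      by (rule cup_tau_dm[of 1]) (use l z in auto)
    moreover have "cup tau (\<lambda>xs ys. c * chi2 xs ys) xs ys = c * w3 xs ys" by (simp add: cup_def w3_def)
    ultimately show ?thesis using e[OF l] unfolding dm_lin by (simp add: algebra_simps)
  qed
  ultimately show ?thesis by blast
qed

lemma nat_eqs: "(2::nat) = Suc (Suc 0)" "(3::nat) = Suc (Suc (Suc 0))" "(4::nat) = Suc (Suc (Suc (Suc 0)))"
  "(5::nat) = Suc (Suc (Suc (Suc (Suc 0))))"
  by simp_all

lemma r0_cocycle_3:
  assumes "CC 3 \<phi>" "closed r0 3 \<phi>"
  shows "\<exists>c \<psi>. CC 2 \<psi> \<and> (\<forall>xs ys. length xs = 3 \<longrightarrow> length ys = 4 \<longrightarrow> \<phi> xs ys = c * w3 xs ys + dm r0 \<psi> xs ys)"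
  using r0_cocycle_3_gen[of "\<lambda>_. True" \<phi>] cocycle_decompose[of 1 \<phi>] assms
  by (simp add: nat_eqs)

lemma r0_cocycle_3_at_0:
  assumes "CC 3 \<phi>" "closed_at r0 3 0 \<phi>"
  shows "\<exists>c \<psi>. CC 2 \<psi> \<and> (\<forall>xs ys. length xs = 3 \<longrightarrow> length ys = 4 \<longrightarrow> hd ys = 0 \<longrightarrow> \<phi> xs ys = c * w3 xs ys + dm r0 \<psi> xs ys)"
  using r0_cocycle_3_gen[of "\<lambda>y. y = 0" \<phi>] cocycle_decompose_0[of 1 \<phi>] assms
  by (simp add: nat_eqs)

subsection \<open>The classes in degrees 2 and 3 do not vanish\<close>

lemma CC_slot: "CC (Suc n) \<phi> \<Longrightarrow> length xs = n \<Longrightarrow> length ys = n \<Longrightarrow> slot y z (\<lambda>x. \<phi> (x # xs) (y # z # ys))"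
  by (simp add: CC_def)

text \<open>The coefficient of \<open>E 1\<close> is the middle vertex \<open>y + m\<close> minus
  the end vertex \<open>z\<close>. The tests below let these coincide, so that only
  \<open>E 0\<close> and \<open>X (E 0)\<close> occur.\<close>

lemma slot_E0_v: "slot y z L \<Longrightarrow> L (mul m (E 0) v) = L (X (E 0)) + m * L (E 0) - (y - z + m) * L (E 1)"
proof -
  assume L: "slot y z L"
  have "L (mul m (E 0) v) + (L (dd (E 1)) + L (sc m (E 1))) = L (X (E 0) + sc m (E 0))"
    unfolding slotD(1)[OF L, symmetric] by (simp add: mul_E0_v)
  then show ?thesis unfolding slotD(1-3)[OF L] by (simp add: algebra_simps)
qed

text \<open>The pair \<open>E 0\<close>, \<open>v\<close> along 1, 0, 0 expresses \<open>c\<close>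
  as the difference of the values of \<open>\<psi>\<close> on \<open>E 0\<close> and
  \<open>X (E 0)\<close>. The pair \<open>v\<close>, \<open>E 0\<close> with a loop at 1 shows that
  these values agree.\<close>

lemma w2_not_exact:
  assumes \<psi>: "CC 1 \<psi>" and e: "\<And>xs ys. length xs = 2 \<Longrightarrow> length ys = 3 \<Longrightarrow> c * w2 xs ys = dm r0 \<psi> xs ys"
  shows "c = 0"
proof -
  have s: "slot y z (\<lambda>x. \<psi> [x] [y, z])" for y z using CC_slot[of 0 \<psi> "[]" "[]"] \<psi> by simp
  have "c * 1 = - \<psi> [mul (- 1) (E 0) v] [1, 0]"
    using e[of "[E 0, v]" "[1, 0, 0]"]
    by (simp add: w2_def chi2_def gamma_def one_def alpha_def rp_E gev_E gev_v poly_monom dm_def r0_def)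
  moreover have "\<psi> [X (E 0)] [1, 0] = \<psi> [E 0] [1, 0]"
    using e[of "[v, E 0]" "[1, 1, 0]"] mul_loop[of 1 "E 0"]
    by (simp add: w2_def chi2_def gamma_def one_def alpha_def rp_v gev_E gev_v dm_def r0_def)
  ultimately show "c = 0" unfolding slot_E0_v[OF s] by simp
qed

text \<open>Moving \<open>v\<close> from right to left through two copies of \<open>E 0\<close>
  links three instances of the identity at a free vertex \<open>y\<close>. The terms
  \<open>y * \<psi> [E 0, E 0] [0, y, 0]\<close> cancel, and by \<open>mul_E0_E\<close> the rest is
  constant in \<open>y\<close>; on the other side stands \<open>- c y\<close>.\<close>

lemma w3_not_exact_at_0:
  assumes \<psi>: "CC 2 \<psi>"
    and e: "\<And>xs ys. length xs = 3 \<Longrightarrow> length ys = 4 \<Longrightarrow> hd ys = 0 \<Longrightarrow> c * w3 xs ys = dm r0 \<psi> xs ys"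
  shows "c = 0"
proof -
  define b where "b = mul 0 (E 0) (E 0)"
  have b: "mul m (E 0) (E 0) = b" for m using mul_E0_E[of m 0] by (simp add: b_def)
  have split_htp: "slot y z (\<lambda>x. \<psi> [x, a] [y, z, w])" for a y z w
    using CC_slot[of 1 \<psi> "[a]" "[w]"] \<psi> by (simp add: numeral_2_eq_2)
  have s2: "slot y z (\<lambda>x. \<psi> [a, x] [w, y, z])" for a y z w
    using CC_slot[OF CC_sl, of 0 \<psi> "[]" "[]"] \<psi> by (simp add: numeral_2_eq_2)
  have A: "c * (- y) = - \<psi> [b, v] [0, 0, 0] + \<psi> [E 0, mul (- y) (E 0) v] [0, y, 0]" for y
    using e[of "[E 0, E 0, v]" "[0, y, 0, 0]"]
    by (simp add: w3_def chi2_def gamma_def one_def alpha_def tau_def rz_eq rp_E gev_E gev_v poly_monom dm_def r0_def b)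
  have B: "\<psi> [E 0, X (E 0)] [0, y, 0] = \<psi> [mul y (E 0) v, E 0] [0, y, 0]" for y
    using e[of "[E 0, v, E 0]" "[0, y, y, 0]"] mul_loop[of y "E 0"]
    by (simp add: w3_def chi2_def gamma_def one_def alpha_def rp_v gev_v gev_E dm_def r0_def add_eq_0_iff)
  have C: "\<psi> [X (E 0), E 0] [0, y, 0] = \<psi> [v, b] [0, 0, 0]" for y
    using e[of "[v, E 0, E 0]" "[0, 0, y, 0]"] mul_loop[of 0 "E 0"]
    by (simp add: w3_def chi2_def gamma_def one_def tau_def rz_eq rp_v gev_v dm_def r0_def b add_eq_0_iff)
  have "c * (- y) = - \<psi> [b, v] [0, 0, 0] + \<psi> [v, b] [0, 0, 0]" for y
  proof -
    have "\<psi> [E 0, mul (- y) (E 0) v] [0, y, 0] = \<psi> [E 0, X (E 0)] [0, y, 0] - y * \<psi> [E 0, E 0] [0, y, 0]"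
      unfolding slot_E0_v[OF s2] by simp
    moreover have "\<psi> [mul y (E 0) v, E 0] [0, y, 0] = \<psi> [X (E 0), E 0] [0, y, 0] + y * \<psi> [E 0, E 0] [0, y, 0]"
      unfolding slot_E0_v[OF split_htp] by simp
    ultimately show ?thesis unfolding A B C by simp
  qed
  from this[of 0] this[of 1] show "c = 0" by simp
qed

subsection \<open>Vanishing in higher degrees\<close>

text \<open>At first vertex 0 the left side of \<open>hd ys * \<chi> = c w3 + dm r0 \<psi>\<close>
  vanishes, so the nontriviality of \<open>w3\<close> on the hyperplane forces \<open>c = 0\<close>.
  Degree 2 cocycles on the hyperplane are exact, which allows the division.\<close>

lemma r1_cocycle_3:
  assumes \<chi>: "CC 3 \<chi>" "closed r1 3 \<chi>"
  shows "exact r1 2 \<chi>"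
proof -
  obtain c \<psi> where \<psi>: "CC 2 \<psi>" and
    e: "\<And>xs ys. length xs = 3 \<Longrightarrow> length ys = 4 \<Longrightarrow> hd ys * \<chi> xs ys = c * w3 xs ys + dm r0 \<psi> xs ys"
    using r0_cocycle_3[OF CC_hd[OF \<chi>(1)] closed_hd[OF \<chi>(2)]] by blast
  have "c = 0"
  proof (rule w3_not_exact_at_0[OF CC_uminus[OF \<psi>]])
    fix xs ys assume "length (xs :: 'a list) = 3" "length (ys :: 'k list) = 4" "hd ys = 0"
    then show "c * w3 xs ys = dm r0 (\<lambda>xs ys. - \<psi> xs ys) xs ys" using e[of xs ys]
      unfolding dm_lin by (simp add: eq_neg_iff_add_eq_0)
  qed
  then have e': "hd ys * \<chi> xs ys = dm r0 \<psi> xs ys" if "length xs = Suc 2" "length ys = Suc (Suc 2)" for xs ys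
    using e[of xs ys] that by simp
  have "closed_at r0 2 0 \<psi>" by (rule closed_at_0_of_dm[OF e'])
  from r0_cocycle_2_at_0[OF \<psi> this] obtain \<kappa> where \<kappa>: "CC 1 \<kappa>"
    "\<And>xs ys. length xs = 2 \<Longrightarrow> length ys = 3 \<Longrightarrow> hd ys = 0 \<Longrightarrow> \<psi> xs ys = dm r0 \<kappa> xs ys" by blast
  show ?thesis
    using exact_r1[of 1 \<chi> \<psi> \<kappa>] \<chi>(1) \<psi> \<kappa> e' by (simp add: nat_eqs)
qed

lemma r1_exact_step:
  assumes \<chi>: "CC (Suc (Suc (Suc n))) \<chi>" "closed r1 (Suc (Suc (Suc n))) \<chi>"
    and ex: "\<And>\<chi>. CC (Suc (Suc n)) \<chi> \<Longrightarrow> closed r1 (Suc (Suc n)) \<chi> \<Longrightarrow> exact r1 (Suc n) \<chi>"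
  obtains \<psi> where "CC (Suc (Suc n)) \<psi>"
    "\<And>xs ys. length xs = Suc (Suc (Suc n)) \<Longrightarrow> length ys = Suc (Suc (Suc (Suc n))) \<Longrightarrow> hd ys * \<chi> xs ys = dm r0 \<psi> xs ys"
    "closed_at r0 (Suc (Suc n)) 0 \<psi>"
proof -
  obtain \<psi> \<chi>' where \<psi>: "CC (Suc (Suc n)) \<psi>" "CC (Suc (Suc n)) \<chi>'" "closed r1 (Suc (Suc n)) \<chi>'" and
    e: "\<And>xs ys. length xs = Suc (Suc (Suc n)) \<Longrightarrow> length ys = Suc (Suc (Suc (Suc n))) \<Longrightarrow>
      hd ys * \<chi> xs ys = dm r0 \<psi> xs ys + cup tau \<chi>' xs ys"
    using cocycle_decompose[OF CC_hd[OF \<chi>(1)] closed_hd[OF \<chi>(2)]] by blast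
  obtain \<zeta> where \<zeta>: "CC (Suc n) \<zeta>"
    "\<And>xs ys. length xs = Suc (Suc n) \<Longrightarrow> length ys = Suc (Suc (Suc n)) \<Longrightarrow> \<chi>' xs ys = dm r1 \<zeta> xs ys"
    using exactD[OF ex[OF \<psi>(2,3)]] by blast
  let ?\<psi> = "\<lambda>xs ys. \<psi> xs ys - cup tau \<zeta> xs ys"
  have C: "CC (Suc (Suc n)) ?\<psi>" by (rule CC_diff[OF \<psi>(1) CC_cup[OF char_tau \<zeta>(1)]])
  have e': "hd ys * \<chi> xs ys = dm r0 ?\<psi> xs ys"
    if l: "length xs = Suc (Suc (Suc n))" "length ys = Suc (Suc (Suc (Suc n)))" for xs ys
  proof -
    have "cup tau \<chi>' xs ys = cup tau (\<lambda>_ _. 0) xs ys - dm r0 (cup tau \<zeta>) xs ys"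
      by (rule cup_tau_dm[of "Suc n"]) (use l \<zeta> in auto)
    then show ?thesis using e[OF l] unfolding dm_lin by (simp add: cup_zero)
  qed
  show ?thesis by (rule that[OF C e' closed_at_0_of_dm[OF e']])
qed

text \<open>The primitive may contain \<open>w3\<close> on the hyperplane. Since \<open>w3\<close>
  is closed at all vertices, its multiple can be subtracted without changing the coboundary.\<close>

lemma r1_cocycle_4:
  assumes \<chi>: "CC 4 \<chi>" "closed r1 4 \<chi>"
  shows "exact r1 3 \<chi>"
proof -
  have \<chi>': "CC (Suc (Suc (Suc 1))) \<chi>" "closed r1 (Suc (Suc (Suc 1))) \<chi>"
    using \<chi> by (simp_all add: eval_nat_numeral)
  have ex: "exact r1 (Suc 1) \<chi>" if "CC (Suc (Suc 1)) \<chi>" "closed r1 (Suc (Suc 1)) \<chi>" for \<chi>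
    using r1_cocycle_3[of \<chi>] that by (simp add: eval_nat_numeral)
  obtain \<psi> where \<psi>: "CC (Suc (Suc 1)) \<psi>" "closed_at r0 (Suc (Suc 1)) 0 \<psi>" and
    e: "\<And>xs ys. length xs = Suc (Suc (Suc 1)) \<Longrightarrow> length ys = Suc (Suc (Suc (Suc 1))) \<Longrightarrow> hd ys * \<chi> xs ys = dm r0 \<psi> xs ys"
    by (rule r1_exact_step[OF \<chi>' ex], assumption, assumption, rule that)
  have \<psi>: "CC 3 \<psi>" "closed_at r0 3 0 \<psi>" and
    e: "\<And>xs ys. length xs = 4 \<Longrightarrow> length ys = 5 \<Longrightarrow> hd ys * \<chi> xs ys = dm r0 \<psi> xs ys"
    using \<psi> e by (simp_all add: eval_nat_numeral)
  from r0_cocycle_3_at_0[OF \<psi>] obtain c \<kappa> where \<kappa>: "CC 2 \<kappa>"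
    "\<And>xs ys. length xs = 3 \<Longrightarrow> length ys = 4 \<Longrightarrow> hd ys = 0 \<Longrightarrow> \<psi> xs ys = c * w3 xs ys + dm r0 \<kappa> xs ys" by blast
  let ?\<psi> = "\<lambda>xs ys. \<psi> xs ys - c * w3 xs ys"
  have "CC 3 ?\<psi>" by (rule CC_diff[OF \<psi>(1) CC_cmult[OF CC_w3]])
  moreover have "hd ys * \<chi> xs ys = dm r0 ?\<psi> xs ys" if "length xs = 4" "length ys = 5" for xs ys
    using e[OF that] dm_w3[OF that] unfolding dm_lin by simp
  ultimately show ?thesis
    using exact_r1[of 2 \<chi> ?\<psi> \<kappa>] \<chi>(1) \<kappa> by (simp add: nat_eqs)
qed

text \<open>The induction descends by one degree when the first vertex times \<open>\<chi>\<close>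
  is decomposed, and by two when its primitive is decomposed on the hyperplane; hence the two base
  cases.\<close>

lemma r1_cocycle_ge_3: "CC (n + 3) \<chi> \<Longrightarrow> closed r1 (n + 3) \<chi> \<Longrightarrow> exact r1 (n + 2) \<chi>"
proof (induction n arbitrary: \<chi> rule: less_induct)
  case (less n)
  consider "n = 0" | "n = 1" | m where "n = Suc (Suc m)" by (cases n; cases "n - 1") auto
  then show ?case
  proof cases
    case 1
    then show ?thesis using less.prems r1_cocycle_3[of \<chi>] by (simp add: eval_nat_numeral)
  next
    case 2
    then show ?thesis using less.prems r1_cocycle_4[of \<chi>] by (simp add: eval_nat_numeral)
  next
    case (3 m)
    have IH1: "exact r1 (Suc (Suc (Suc m))) \<chi>" if "CC (Suc (Suc (Suc (Suc m)))) \<chi>" "closed r1 (Suc (Suc (Suc (Suc m)))) \<chi>" for \<chi>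
      using less.IH[of "Suc m" \<chi>] that 3 by (simp add: eval_nat_numeral)
    have IH2: "exact r1 (Suc (Suc m)) \<chi>" if "CC (Suc (Suc (Suc m))) \<chi>" "closed r1 (Suc (Suc (Suc m))) \<chi>" for \<chi>
      using less.IH[of m \<chi>] that 3 by (simp add: eval_nat_numeral)
    let ?n = "Suc (Suc (Suc m))"
    have \<chi>: "CC (Suc (Suc ?n)) \<chi>" "closed r1 (Suc (Suc ?n)) \<chi>" using less.prems 3 by (simp_all add: eval_nat_numeral)
    obtain \<psi> where \<psi>: "CC (Suc ?n) \<psi>" "closed_at r0 (Suc ?n) 0 \<psi>" and
      e: "\<And>xs ys. length xs = Suc (Suc ?n) \<Longrightarrow> length ys = Suc (Suc (Suc ?n)) \<Longrightarrow> hd ys * \<chi> xs ys = dm r0 \<psi> xs ys"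
      by (rule r1_exact_step[OF \<chi> IH1], assumption, assumption, rule that)
    obtain \<kappa> \<chi>' where \<kappa>: "CC ?n \<kappa>" "CC ?n \<chi>'" "closed r1 ?n \<chi>'" and
      k: "\<And>xs ys. length xs = Suc ?n \<Longrightarrow> length ys = Suc (Suc ?n) \<Longrightarrow> hd ys = 0 \<Longrightarrow> \<psi> xs ys = dm r0 \<kappa> xs ys + cup tau \<chi>' xs ys"
      using cocycle_decompose_0[OF \<psi>] by blast
    obtain \<zeta> where \<zeta>: "CC (Suc (Suc m)) \<zeta>"
      "\<And>xs ys. length xs = ?n \<Longrightarrow> length ys = Suc ?n \<Longrightarrow> \<chi>' xs ys = dm r1 \<zeta> xs ys"
      using exactD[OF IH2[OF \<kappa>(2,3)]] by blast
    let ?\<kappa> = "\<lambda>xs ys. \<kappa> xs ys - cup tau \<zeta> xs ys"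
    have C: "CC ?n ?\<kappa>" by (rule CC_diff[OF \<kappa>(1) CC_cup[OF char_tau \<zeta>(1)]])
    have "\<psi> xs ys = dm r0 ?\<kappa> xs ys" if l: "length xs = Suc ?n" "length ys = Suc (Suc ?n)" "hd ys = 0" for xs ys
    proof -
      have "cup tau \<chi>' xs ys = cup tau (\<lambda>_ _. 0) xs ys - dm r0 (cup tau \<zeta>) xs ys"
        by (rule cup_tau_dm[of "Suc (Suc m)"]) (use l \<zeta> in auto)
      then show ?thesis using k[OF l] unfolding dm_lin by (simp add: cup_zero)
    qed
    note k0 = this
    have "exact r1 (Suc ?n) \<chi>" by (rule exact_r1[OF \<chi>(1) \<psi>(1) C e k0])
    moreover have "n + 2 = Suc ?n" using 3 by simp
    ultimately show ?thesis by simp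
  qed
qed

lemma r0_cocycle_ge_4:
  assumes \<phi>: "CC (n + 4) \<phi>" "closed r0 (n + 4) \<phi>"
  shows "exact r0 (n + 3) \<phi>"
proof -
  let ?m = "n + 2"
  have \<phi>': "CC (Suc (Suc ?m)) \<phi>" "closed r0 (Suc (Suc ?m)) \<phi>" using \<phi> by (simp_all add: eval_nat_numeral)
  obtain \<psi> \<chi> where \<psi>: "CC (Suc ?m) \<psi>" "CC (Suc ?m) \<chi>" "closed r1 (Suc ?m) \<chi>" and
    k: "\<And>xs ys. length xs = Suc (Suc ?m) \<Longrightarrow> length ys = Suc (Suc (Suc ?m)) \<Longrightarrow> \<phi> xs ys = dm r0 \<psi> xs ys + cup tau \<chi> xs ys"
    using cocycle_decompose[OF \<phi>'] by blast
  have "exact r1 ?m \<chi>" using r1_cocycle_ge_3[of n \<chi>] \<psi> by (simp add: eval_nat_numeral)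
  then obtain \<zeta> where \<zeta>: "CC ?m \<zeta>"
    "\<And>xs ys. length xs = Suc ?m \<Longrightarrow> length ys = Suc (Suc ?m) \<Longrightarrow> \<chi> xs ys = dm r1 \<zeta> xs ys"
    using exactD by blast
  let ?\<psi> = "\<lambda>xs ys. \<psi> xs ys - cup tau \<zeta> xs ys"
  have C: "CC (Suc ?m) ?\<psi>" by (rule CC_diff[OF \<psi>(1) CC_cup[OF char_tau \<zeta>(1)]])
  have "\<phi> xs ys = dm r0 ?\<psi> xs ys" if l: "length xs = Suc (Suc ?m)" "length ys = Suc (Suc (Suc ?m))" for xs ys
  proof -
    have "cup tau \<chi> xs ys = cup tau (\<lambda>_ _. 0) xs ys - dm r0 (cup tau \<zeta>) xs ys"
      by (rule cup_tau_dm[of ?m]) (use l \<zeta> in auto)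
    then show ?thesis using k[OF l] unfolding dm_lin by (simp add: cup_zero)
  qed
  then show ?thesis using C unfolding exact_def by (auto simp: eval_nat_numeral)
qed

end

section \<open>The reduced complex in vertex coordinates\<close>

context u3
begin

lemma cancel_last:
  assumes "CC n \<phi>" "CC n \<psi>" "\<And>xs ys. length xs = n \<Longrightarrow> length ys = Suc n \<Longrightarrow> last ys * \<phi> xs ys = last ys * \<psi> xs ys"
    and l: "length xs = n" "length ys = Suc n"
  shows "\<phi> xs ys = \<psi> xs ys"
proof -
  obtain ls y where ys: "ys = ls @ [y]" "length ls = n" using l by (cases ys rule: rev_cases) auto
  have PL: "PL 1 (Suc n) ((@) ls)"
    unfolding PL_def
  proof (intro conjI allI impI)
    fix i assume "i < Suc n"
    then show "PF 1 (\<lambda>ys. (ls @ ys) ! i)"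
      using ys(2) PF_c[of 1 "ls ! i"] PF_i[of 0 1] by (cases "i < n") (simp_all add: nth_append less_Suc_eq)
  qed (simp add: ys)
  have p: "is_pfun (\<lambda>t. \<phi> xs (ls @ [t]))" if "CC n \<phi>" for \<phi>
    by (rule is_pfun_PF[OF _ PL]) (use that l in \<open>simp add: CC_def\<close>)
  have "\<phi> xs (ls @ [y]) = \<psi> xs (ls @ [y])"
    by (rule is_pfun_eq_off[OF p[OF assms(1)] p[OF assms(2)], of "{0}"])
      (use assms(3)[OF l(1), of "ls @ [t]" for t] ys in auto)
  then show ?thesis using ys by simp
qed

text \<open>Zero in the degrees without a class, so that the passage to the reduced complex can
  treat all degrees at once.\<close>

definition cw :: "nat \<Rightarrow> 'a list \<Rightarrow> 'k list \<Rightarrow> 'k" where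
  "cw n = (if n = 2 then w2 else if n = 3 then w3 else (\<lambda>_ _. 0))"

definition cu :: "nat \<Rightarrow> 'a list \<Rightarrow> 'k list \<Rightarrow> 'k" where
  "cu n = (if n = 1 then u1 else if n = 2 then u2 else (\<lambda>_ _. 0))"

lemma CC_cw: "CC n (cw n)" and CC_cu: "CC n (cu n)"
  by (simp_all add: cw_def cu_def CC_w2 CC_w3 CC_u1[unfolded One_nat_def] CC_u2 CC_zero)

lemma dm_zero: "dm r (\<lambda>_ _. 0) xs ys = 0"
  by (simp add: dm_def cup_def dl_zero)

lemma dm_cw: "length xs = Suc n \<Longrightarrow> length ys = Suc (Suc n) \<Longrightarrow> dm r0 (cw n) xs ys = 0"
  using dm_w2 dm_w3 by (simp add: cw_def dm_zero)

lemma dm_cu: "length xs = Suc n \<Longrightarrow> length ys = Suc (Suc n) \<Longrightarrow> dm r0 (cu n) xs ys = last ys * cw (Suc n) xs ys"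
  using dm_u1 dm_u2 by (auto simp: cw_def cu_def dm_zero)

lemma closed_cw:
  assumes \<phi>: "CC (Suc m) \<phi>"
    and d: "\<And>xs ys. length xs = Suc (Suc m) \<Longrightarrow> length ys = Suc (Suc (Suc m)) \<Longrightarrow> dm r0 \<phi> xs ys = 0"
  shows "\<exists>c \<psi>. CC m \<psi> \<and> (\<forall>xs ys. length xs = Suc m \<longrightarrow> length ys = Suc (Suc m) \<longrightarrow> \<phi> xs ys = c * cw (Suc m) xs ys + dm r0 \<psi> xs ys)"
proof -
  have c: "closed r0 (Suc m) \<phi>" using d by (simp add: closed_iff)
  consider "m = 0" | "m = 1" | "m = 2" | k where "m = k + 3"
    by (metis One_nat_def Suc_1 add.commute add_Suc le_Suc_ex not_less_eq_eq numeral_3_eq_3 le0 le_antisym plus_1_eq_Suc)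
  then show ?thesis
  proof cases
    case 1
    have cw: "cw (Suc m) = (\<lambda>_ _. 0)" using 1 by (simp add: cw_def)
    show ?thesis using cocycle_1[of \<phi>] \<phi> c unfolding cw unfolding 1 by (auto simp: eval_nat_numeral)
  next
    case 2
    have "cw (Suc m) = w2" using 2 by (simp add: cw_def)
    then show ?thesis using r0_cocycle_2[of \<phi>] \<phi> c unfolding 2 by (simp add: nat_eqs)
  next
    case 3
    have "cw (Suc m) = w3" using 3 by (simp add: cw_def)
    then show ?thesis using r0_cocycle_3[of \<phi>] \<phi> c unfolding 3 by (simp add: nat_eqs)
  next
    case (4 k)
    have cw: "cw (Suc m) = (\<lambda>_ _. 0)" using 4 by (simp add: cw_def)
    have "exact r0 (k + 3) \<phi>" by (rule r0_cocycle_ge_4) (use \<phi> c 4 in \<open>simp_all add: eval_nat_numeral\<close>)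
    then show ?thesis unfolding exact_def cw unfolding 4 by simp
  qed
qed

lemma cw_exact:
  assumes \<psi>: "CC m \<psi>"
    and e: "\<And>xs ys. length xs = Suc m \<Longrightarrow> length ys = Suc (Suc m) \<Longrightarrow> c * cw (Suc m) xs ys = dm r0 \<psi> xs ys"
  shows "c = 0 \<or> m \<notin> {1, 2}"
proof -
  have "c = 0" if "m = 1"
    using w2_not_exact[of \<psi> c] \<psi> e unfolding that by (simp add: cw_def nat_eqs)
  moreover have "c = 0" if "m = 2"
    using w3_not_exact_at_0[of \<psi> c] \<psi> e unfolding that by (simp add: cw_def nat_eqs)
  ultimately show ?thesis by blast
qed

lemma cw_eq_0: "c = 0 \<or> m \<notin> {1, 2} \<Longrightarrow> c * cw (Suc m) xs ys = 0"
  by (auto simp: cw_def)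

text \<open>The long exact sequence for multiplication by the last vertex, made explicit. Cancelling
  that vertex shows \<open>\<chi>\<close> closed, so \<open>\<chi> = b cw + dm \<theta>\<close>;
  then \<open>b cu\<close> plus the last vertex times \<open>\<theta>\<close> has the same
  coboundary as \<open>\<phi>\<close>, and the difference is closed.\<close>

lemma reduced_cocycle:
  assumes \<phi>: "CC (Suc m) \<phi>" and \<chi>: "CC (Suc (Suc m)) \<chi>"
    and d: "\<And>xs ys. length xs = Suc (Suc m) \<Longrightarrow> length ys = Suc (Suc (Suc m)) \<Longrightarrow> dm r0 \<phi> xs ys = last ys * \<chi> xs ys"
  shows "\<exists>a b \<psi> \<theta>. CC m \<psi> \<and> CC (Suc m) \<theta> \<and> (\<forall>xs ys. length xs = Suc m \<longrightarrow> length ys = Suc (Suc m) \<longrightarrow>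
    \<phi> xs ys = a * cw (Suc m) xs ys + b * cu (Suc m) xs ys + (dm r0 \<psi> xs ys + last ys * \<theta> xs ys))"
proof -
  have "dm r0 \<chi> xs ys = 0" if l: "length xs = Suc (Suc (Suc m))" "length ys = Suc (Suc (Suc (Suc m)))" for xs ys
  proof (rule cancel_last[OF CC_dm[OF char_r0 \<chi>] CC_zero _ l])
    fix xs :: "'a list" and ys :: "'k list"
    assume l: "length xs = Suc (Suc (Suc m))" "length ys = Suc (Suc (Suc (Suc m)))"
    have "last ys * dm r0 \<chi> xs ys = dm r0 (\<lambda>as bs. last bs * \<chi> as bs) xs ys"
      by (rule dm_scale_last[symmetric]) (use l in auto)
    also have "\<dots> = dm r0 (dm r0 \<phi>) xs ys" by (rule dm_eq[OF _ l(1)]) (use l d in auto)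
    also have "\<dots> = 0" by (rule dm_dm[OF multiplicative_r0]) (use l in auto)
    finally show "last ys * dm r0 \<chi> xs ys = last ys * 0" by simp
  qed
  from closed_cw[OF \<chi> this] obtain b \<theta> where \<theta>: "CC (Suc m) \<theta>"
    and b: "\<And>xs ys. length xs = Suc (Suc m) \<Longrightarrow> length ys = Suc (Suc (Suc m)) \<Longrightarrow> \<chi> xs ys = b * cw (Suc (Suc m)) xs ys + dm r0 \<theta> xs ys"
    by blast
  let ?\<phi> = "\<lambda>xs ys. \<phi> xs ys - b * cu (Suc m) xs ys - last ys * \<theta> xs ys"
  have C: "CC (Suc m) ?\<phi>" by (rule CC_diff[OF CC_diff[OF \<phi> CC_cmult[OF CC_cu]] CC_last[OF \<theta>]])
  have "dm r0 ?\<phi> xs ys = 0" if l: "length xs = Suc (Suc m)" "length ys = Suc (Suc (Suc m))" for xs ys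
  proof -
    have "dm r0 (\<lambda>as bs. last bs * \<theta> as bs) xs ys = last ys * dm r0 \<theta> xs ys"
      by (rule dm_scale_last) (use l in auto)
    then show ?thesis unfolding dm_lin using d[OF l] b[OF l] dm_cu[OF l] by (simp add: algebra_simps)
  qed
  from closed_cw[OF C this] obtain a \<psi> where \<psi>: "CC m \<psi>"
    and a: "\<And>xs ys. length xs = Suc m \<Longrightarrow> length ys = Suc (Suc m) \<Longrightarrow> ?\<phi> xs ys = a * cw (Suc m) xs ys + dm r0 \<psi> xs ys"
    by blast
  have "\<phi> xs ys = a * cw (Suc m) xs ys + b * cu (Suc m) xs ys + (dm r0 \<psi> xs ys + last ys * \<theta> xs ys)"
    if "length xs = Suc m" "length ys = Suc (Suc m)" for xs ys
    using a[OF that] by (simp add: algebra_simps)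
  then show ?thesis using \<psi> \<theta> by blast
qed

text \<open>The connecting map sends the combination to \<open>b\<close> times \<open>cw\<close> one
  degree higher, which must be exact; this settles \<open>b\<close>. Afterwards
  \<open>\<theta>\<close> is closed and \<open>a\<close> can be tested in the basic complex.\<close>

lemma reduced_coboundary:
  assumes \<psi>: "CC m \<psi>" and \<theta>: "CC (Suc m) \<theta>"
    and e: "\<And>xs ys. length xs = Suc m \<Longrightarrow> length ys = Suc (Suc m) \<Longrightarrow>
      a * cw (Suc m) xs ys + b * cu (Suc m) xs ys = dm r0 \<psi> xs ys + last ys * \<theta> xs ys"
  shows "(a = 0 \<or> m \<notin> {1, 2}) \<and> (b = 0 \<or> m \<notin> {0, 1})"
proof -
  have b': "b * cw (Suc (Suc m)) xs ys = dm r0 \<theta> xs ys"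
    if l: "length xs = Suc (Suc m)" "length ys = Suc (Suc (Suc m))" for xs ys
  proof (rule cancel_last[OF CC_cmult[OF CC_cw] CC_dm[OF char_r0 \<theta>] _ l])
    fix xs :: "'a list" and ys :: "'k list"
    assume l: "length xs = Suc (Suc m)" "length ys = Suc (Suc (Suc m))"
    have "dm r0 (\<lambda>xs ys. a * cw (Suc m) xs ys + b * cu (Suc m) xs ys) xs ys
      = dm r0 (\<lambda>xs ys. dm r0 \<psi> xs ys + last ys * \<theta> xs ys) xs ys"
      by (rule dm_eq[OF _ l(1)]) (use l e in auto)
    moreover have "dm r0 (dm r0 \<psi>) xs ys = 0" by (rule dm_dm[OF multiplicative_r0]) (use l in auto)
    moreover have "dm r0 (\<lambda>as bs. last bs * \<theta> as bs) xs ys = last ys * dm r0 \<theta> xs ys"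
      by (rule dm_scale_last) (use l in auto)
    ultimately show "last ys * (b * cw (Suc (Suc m)) xs ys) = last ys * dm r0 \<theta> xs ys"
      using dm_cw[OF l] dm_cu[OF l] unfolding dm_lin by (simp add: algebra_simps)
  qed
  have b0: "b = 0 \<or> Suc m \<notin> {1, 2}" by (rule cw_exact[OF \<theta> b'])
  have bu: "b * cu (Suc m) xs ys = 0" for xs ys using b0 by (auto simp: cu_def)
  have "dm r0 \<theta> xs ys = 0" if l: "length xs = Suc (Suc m)" "length ys = Suc (Suc (Suc m))" for xs ys
    using b'[OF l] cw_eq_0[OF b0] by simp
  from closed_cw[OF \<theta> this] obtain c \<zeta> where \<zeta>: "CC m \<zeta>"
    and c: "\<And>xs ys. length xs = Suc m \<Longrightarrow> length ys = Suc (Suc m) \<Longrightarrow> \<theta> xs ys = c * cw (Suc m) xs ys + dm r0 \<zeta> xs ys"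
    by blast
  \<comment> \<open>The last vertex times \<open>cw\<close> is the coboundary of
    \<open>cu m\<close>, so with \<open>\<theta> = c cw + dm \<zeta>\<close> the last vertex times
    \<open>\<theta>\<close> has this explicit primitive.\<close>
  have "CC m (\<lambda>xs ys. \<psi> xs ys + (c * cu m xs ys + last ys * \<zeta> xs ys))"
    by (rule CC_add[OF \<psi> CC_add[OF CC_cmult[OF CC_cu] CC_last[OF \<zeta>]]])
  then have "a = 0 \<or> m \<notin> {1, 2}"
  proof (rule cw_exact)
    fix xs :: "'a list" and ys :: "'k list"
    assume l: "length xs = Suc m" "length ys = Suc (Suc m)"
    have "dm r0 (\<lambda>as bs. last bs * \<zeta> as bs) xs ys = last ys * dm r0 \<zeta> xs ys"
      by (rule dm_scale_last) (use l in auto)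
    then show "a * cw (Suc m) xs ys = dm r0 (\<lambda>xs ys. \<psi> xs ys + (c * cu m xs ys + last ys * \<zeta> xs ys)) xs ys"
      unfolding dm_lin using e[OF l] bu c[OF l] dm_cu[OF l] by (simp add: algebra_simps)
  qed
  then show ?thesis using b0 by auto
qed

end

section \<open>Comparison of the two kinds of cochains\<close>

lemma poly_fun_cong: "poly_fun n g \<Longrightarrow> (\<And>ls. length ls = n \<Longrightarrow> h ls = g ls) \<Longrightarrow> poly_fun n h"
  by (simp add: poly_fun_def)

lemma poly_fun_0: "poly_fun n (\<lambda>_. 0)"
  unfolding poly_fun_def by (intro exI[of _ "{}"]) simp

lemma poly_fun_add:
  assumes "poly_fun n g" "poly_fun n h"
  shows "poly_fun n (\<lambda>ls. g ls + h ls)"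
proof -
  obtain K c L d where K: "finite K" "\<And>ls. length ls = n \<Longrightarrow> g ls = (\<Sum>k\<in>K. smult (\<Prod>i<n. ls ! i ^ (k ! i)) (c k))"
    and L: "finite L" "\<And>ls. length ls = n \<Longrightarrow> h ls = (\<Sum>k\<in>L. smult (\<Prod>i<n. ls ! i ^ (k ! i)) (d k))"
    using assms unfolding poly_fun_def by blast
  let ?e = "\<lambda>k. (if k \<in> K then c k else 0) + (if k \<in> L then d k else 0)"
  have "g ls + h ls = (\<Sum>k\<in>K \<union> L. smult (\<Prod>i<n. ls ! i ^ (k ! i)) (?e k))" if "length ls = n" for ls
  proof -
    have "g ls = (\<Sum>k\<in>K \<union> L. smult (\<Prod>i<n. ls ! i ^ (k ! i)) (if k \<in> K then c k else 0))"
      unfolding K(2)[OF that] by (rule sum.mono_neutral_cong_left) (use K L in auto)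
    moreover have "h ls = (\<Sum>k\<in>K \<union> L. smult (\<Prod>i<n. ls ! i ^ (k ! i)) (if k \<in> L then d k else 0))"
      unfolding L(2)[OF that] by (rule sum.mono_neutral_cong_left) (use K L in auto)
    ultimately show ?thesis by (simp only: smult_add_right sum.distrib)
  qed
  then show ?thesis unfolding poly_fun_def using K(1) L(1) by (intro exI[of _ "K \<union> L"] exI[of _ ?e]) simp
qed

lemma poly_fun_sum: "(\<And>i. i \<in> I \<Longrightarrow> poly_fun n (g i)) \<Longrightarrow> poly_fun n (\<lambda>ls. \<Sum>i\<in>I. g i ls)"
  by (induction I rule: infinite_finite_induct) (simp_all add: poly_fun_0 poly_fun_add)

lemma smult_sum_right: "smult c (\<Sum>i\<in>I. f i) = (\<Sum>i\<in>I. smult c (f i))"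
  by (induction I rule: infinite_finite_induct) (simp_all add: smult_add_right)

lemma poly_fun_Suc:
  assumes "poly_fun n g"
  shows "poly_fun (Suc n) (\<lambda>ls. smult (hd ls ^ j) (g (tl ls)))"
proof -
  obtain K c where K: "finite K" "\<And>ls. length ls = n \<Longrightarrow> g ls = (\<Sum>k\<in>K. smult (\<Prod>i<n. ls ! i ^ (k ! i)) (c k))"
    using assms unfolding poly_fun_def by blast
  have "smult (hd ls ^ j) (g (tl ls)) = (\<Sum>k\<in>(#) j ` K. smult (\<Prod>i<Suc n. ls ! i ^ (k ! i)) (c (tl k)))"
    if "length ls = Suc n" for ls
  proof -
    from that obtain l ls' where "ls = l # ls'" "length ls' = n" by (auto simp: length_Suc_conv)
    then show ?thesis using K(2)[of ls']
      by (simp add: sum.reindex inj_on_def prod.lessThan_Suc_shift smult_sum_right del: prod.lessThan_Suc)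
  qed
  then show ?thesis unfolding poly_fun_def using K(1)
    by (intro exI[of _ "(#) j ` K"] exI[of _ "\<lambda>k. c (tl k)"]) simp
qed

lemma PF_poly_fun: "PF n F \<Longrightarrow> poly_fun n (\<lambda>ls. smult (F ls) p)"
proof (induction n arbitrary: F)
  case 0
  then show ?case unfolding poly_fun_def by (intro exI[of _ "{[]}"] exI[of _ "\<lambda>_. smult (F []) p"]) auto
next
  case (Suc n)
  from PF_PFP[OF Suc.prems] obtain P N where P: "\<And>i. PF n (\<lambda>ys. coeff (P ys) i)"
    and N: "\<And>ys. length ys = n \<Longrightarrow> degree (P ys) \<le> N"
    and F: "\<And>t ls. length ls = n \<Longrightarrow> F (t # ls) = poly (P ls) t"
    unfolding PFP_def by blast
  have "poly_fun (Suc n) (\<lambda>ls. \<Sum>j\<le>N. smult (hd ls ^ j) (smult (coeff (P (tl ls)) j) p))"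
    by (rule poly_fun_sum, rule poly_fun_Suc, rule Suc.IH, rule P)
  then show ?case
  proof (rule poly_fun_cong)
    fix ls :: "'a list" assume "length ls = Suc n"
    then obtain l ls' where "ls = l # ls'" "length ls' = n" by (auto simp: length_Suc_conv)
    then show "smult (F ls) p = (\<Sum>j\<le>N. smult (hd ls ^ j) (smult (coeff (P (tl ls)) j) p))"
      by (simp add: F poly_altdef_le[OF N] smult_sum mult.commute)
  qed
qed

lemma PFP_sum: "(\<And>i. i \<in> I \<Longrightarrow> PFP n (F i)) \<Longrightarrow> PFP n (\<lambda>ys. \<Sum>i\<in>I. F i ys)"
  by (induction I rule: infinite_finite_induct) (simp_all add: PFP_add)

lemma poly_fun_iff: "poly_fun n g \<longleftrightarrow> PFP n g"
proof
  assume "poly_fun n g"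
  then obtain K c where K: "\<And>ls. length ls = n \<Longrightarrow> g ls = (\<Sum>k\<in>K. smult (\<Prod>i<n. ls ! i ^ (k ! i)) (c k))"
    unfolding poly_fun_def by blast
  have "PFP n (\<lambda>ls. \<Sum>k\<in>K. smult (\<Prod>i<n. ls ! i ^ (k ! i)) (c k))"
    by (rule PFP_sum, rule PFP_smult[OF PF_prod PFP_const], rule PF_power, rule PF_i) simp
  then show "PFP n g" by (rule PFP_cong) (rule K)
next
  assume "PFP n g"
  then obtain N where P: "\<And>i. PF n (\<lambda>ys. coeff (g ys) i)"
    and N: "\<And>ys. length ys = n \<Longrightarrow> degree (g ys) \<le> N"
    unfolding PFP_def by blast
  have "poly_fun n (\<lambda>ls. \<Sum>j\<le>N. smult (coeff (g ls) j) (monom 1 j))"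
    by (rule poly_fun_sum, rule PF_poly_fun, rule P)
  then show "poly_fun n g"
  proof (rule poly_fun_cong)
    fix ls :: "'a list" assume "length ls = n"
    from N[OF this] show "g ls = (\<Sum>j\<le>N. smult (coeff (g ls) j) (monom 1 j))"
      by (simp add: smult_monom poly_as_sum_of_monoms')
  qed
qed

section \<open>Change of coordinates between vertices and the parameters \<partial>,
  \<lambda>\<close>

fun diffs :: "'k::field_char_0 list \<Rightarrow> 'k list" where
  "diffs (y # z # ys) = (z - y) # diffs (z # ys)"
| "diffs _ = []"

primrec psums :: "'k::field_char_0 \<Rightarrow> 'k list \<Rightarrow> 'k list" where
  "psums y [] = [y]"
| "psums y (l # ls) = y # psums (y + l) ls"

lemma length_psums [simp]: "length (psums y ls) = Suc (length ls)"
  by (induction ls arbitrary: y) auto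

lemma psums_nonempty [simp]: "psums y ls \<noteq> []"
  by (cases ls) auto

lemma hd_psums [simp]: "hd (psums y ls) = y"
  by (cases ls) auto

lemma diffs_psums [simp]: "diffs (psums y ls) = ls"
proof (induction ls arbitrary: y)
  case (Cons l ls)
  have "psums (y + l) ls = (y + l) # tl (psums (y + l) ls)" by (cases ls) auto
  then show ?case using Cons[of "y + l"] by (metis diffs.simps(1) psums.simps(2) add_diff_cancel_left')
qed simp

lemma length_diffs [simp]: "length (diffs ys) = length ys - 1"
  by (induction ys rule: diffs.induct) auto

lemma psums_diffs: "ys \<noteq> [] \<Longrightarrow> psums (hd ys) (diffs ys) = ys"
  by (induction ys rule: diffs.induct) auto

lemma last_psums: "last (psums y ls) = y + sum_list ls"
  by (induction ls arbitrary: y) (auto simp: add.assoc)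

lemma nth_diffs: "Suc i < length ys \<Longrightarrow> diffs ys ! i = ys ! Suc i - ys ! i"
  by (induction ys arbitrary: i rule: diffs.induct) (auto simp: nth_Cons split: nat.splits)

lemma tl_diffs: "diffs (tl ys) = tl (diffs ys)"
  by (cases ys rule: diffs.cases) auto

lemma PL_diffs: "PL (Suc n) n diffs"
  unfolding PL_def
proof (intro conjI allI impI)
  fix i assume i: "i < n"
  have "PF (Suc n) (\<lambda>ys. ys ! Suc i - ys ! i)" by (rule PF_diff[OF PF_i PF_i]) (use i in simp_all)
  then show "PF (Suc n) (\<lambda>ys. diffs ys ! i)" by (rule PF_cong) (use i in \<open>simp add: nth_diffs\<close>)
qed simp

lemma psums_nth: "i \<le> length ls \<Longrightarrow> psums y ls ! i = y + (\<Sum>j<i. ls ! j)"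
proof (induction ls arbitrary: y i)
  case (Cons l ls)
  then show ?case by (cases i) (simp_all add: sum.lessThan_Suc_shift add.assoc del: sum.lessThan_Suc)
qed simp

lemma PL_psums: "PL (Suc n) (Suc n) (\<lambda>ys. psums (hd ys) (tl ys))"
  unfolding PL_def
proof (intro conjI allI impI)
  fix i assume i: "i < Suc n"
  have "PF (Suc n) (\<lambda>ys. hd ys + (\<Sum>j<i. ys ! Suc j))"
    by (rule PF_add[OF PF_hd PF_sum], rule PF_i) (use i in auto)
  then show "PF (Suc n) (\<lambda>ys. psums (hd ys) (tl ys) ! i)"
    by (rule PF_cong) (use i in \<open>simp add: psums_nth nth_tl\<close>)
qed simp

text \<open>Dropping an inner vertex joins its two edges, whose lengths add; this is the sum of
  neighbouring parameters in the Hochschild differential.\<close>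

lemma diffs_merge:
  assumes "0 < i" "Suc i < length ys"
  shows "diffs (take i ys @ drop (Suc i) ys)
    = take (i - 1) (diffs ys) @ [diffs ys ! (i - 1) + diffs ys ! i] @ drop (Suc i) (diffs ys)"
  using assms
proof (induction ys arbitrary: i rule: diffs.induct)
  case (1 y z ys)
  show ?case
  proof (cases "i = 1")
    case True
    then obtain w ws where "ys = w # ws" using 1(3) by (cases ys) auto
    then show ?thesis using True by simp
  next
    case False
    then obtain j where j: "i = Suc (Suc j)" using 1(2) by (metis One_nat_def gr0_implies_Suc not0_implies_Suc)
    then show ?thesis using 1(1)[of "Suc j"] 1(3) by simp
  qed
qed simp_all

context u3
begin

lemma dl_eq_sum:
  assumes "length xs = Suc n" "length ys = Suc (Suc n)"
  shows "dl \<Phi> xs ys = (\<Sum>i\<in>{1..n}. (-1) ^ i *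
    \<Phi> (take (i - 1) xs @ [mul (diffs ys ! (i - 1)) (xs ! (i - 1)) (xs ! i)] @ drop (i + 1) xs)
      (take i ys @ drop (Suc i) ys))"
  using assms
proof (induction n arbitrary: \<Phi> xs ys)
  case 0
  then show ?case by (auto simp: length_Suc_conv)
next
  case (Suc n)
  then obtain x x' xs' y z ys' where xs: "xs = x # x' # xs'" "length xs' = n"
    and ys: "ys = y # z # ys'" "length ys' = Suc n" by (auto simp: length_Suc_conv)
  have "dl (sl \<Phi> x y) (x' # xs') (z # ys') = (\<Sum>i\<in>{1..n}. (-1) ^ i *
    \<Phi> (x # take (i - 1) (x' # xs') @ [mul (diffs (z # ys') ! (i - 1)) ((x' # xs') ! (i - 1)) ((x' # xs') ! i)] @ drop (i + 1) (x' # xs'))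
      (y # take i (z # ys') @ drop (Suc i) (z # ys')))"
    using xs ys by (intro Suc.IH) simp_all
  also have "\<dots> = (\<Sum>i\<in>{Suc 1..Suc n}. - ((-1) ^ i *
    \<Phi> (take (i - 1) xs @ [mul (diffs ys ! (i - 1)) (xs ! (i - 1)) (xs ! i)] @ drop (i + 1) xs)
      (take i ys @ drop (Suc i) ys)))"
    unfolding sum.shift_bounds_cl_Suc_ivl
  proof (rule sum.cong)
    fix i assume "i \<in> {1..n}"
    then obtain j where "i = Suc j" by (cases i) auto
    then show "(- 1) ^ i * \<Phi> (x # take (i - 1) (x' # xs') @
         [mul (diffs (z # ys') ! (i - 1)) ((x' # xs') ! (i - 1)) ((x' # xs') ! i)] @ drop (i + 1) (x' # xs'))
         (y # take i (z # ys') @ drop (Suc i) (z # ys')) =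
      - ((- 1) ^ Suc i * \<Phi> (take (Suc i - 1) xs @
         [mul (diffs ys ! (Suc i - 1)) (xs ! (Suc i - 1)) (xs ! Suc i)] @ drop (Suc i + 1) xs)
         (take (Suc i) ys @ drop (Suc (Suc i)) ys))"
      by (simp add: xs ys)
  qed simp
  finally show ?case
    unfolding sum_negf by (subst sum.atLeast_Suc_atMost) (simp_all add: xs ys)
qed

lemma mlin_iff:
  "mlin n \<Phi> \<longleftrightarrow> (\<forall>xs ys i. length xs = n \<longrightarrow> length ys = Suc n \<longrightarrow> i < n \<longrightarrow>
    slot (ys ! i) (ys ! Suc i) (\<lambda>x. \<Phi> (xs[i := x]) ys))"
proof (induction n arbitrary: \<Phi>)
  case (Suc n)
  show ?case
  proof (intro iffI allI impI)
    fix xs :: "'a list" and ys :: "'k list" and i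
    assume *: "mlin (Suc n) \<Phi>" "length xs = Suc n" "length ys = Suc (Suc n)" "i < Suc n"
    then obtain x xs' y z ys' where "xs = x # xs'" "length xs' = n" "ys = y # z # ys'" "length ys' = n"
      by (auto simp: length_Suc_conv)
    then show "slot (ys ! i) (ys ! Suc i) (\<lambda>x. \<Phi> (xs[i := x]) ys)" using *(1,4)
    proof (cases i)
      case (Suc j)
      then have "slot ((z # ys') ! j) ((z # ys') ! Suc j) (\<lambda>u. sl \<Phi> x y (xs'[j := u]) (z # ys'))"
        using * \<open>xs = x # xs'\<close> \<open>ys = y # z # ys'\<close>
        by (intro Suc.IH[THEN iffD1, rule_format]) simp_all
      then show ?thesis using Suc \<open>xs = x # xs'\<close> \<open>ys = y # z # ys'\<close> by simp
    qed simp
  next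
    assume *: "\<forall>xs ys i. length xs = Suc n \<longrightarrow> length ys = Suc (Suc n) \<longrightarrow> i < Suc n \<longrightarrow>
      slot (ys ! i) (ys ! Suc i) (\<lambda>x. \<Phi> (xs[i := x]) ys)"
    show "mlin (Suc n) \<Phi>"
      unfolding mlin.simps
    proof (intro conjI allI impI)
      fix xs :: "'a list" and ys :: "'k list" and y z
      assume "length xs = n" "length ys = n"
      then show "slot y z (\<lambda>x. \<Phi> (x # xs) (y # z # ys))"
        using *[rule_format, of "0 # xs" "y # z # ys" 0] by simp
    next
      fix x y
      show "mlin n (sl \<Phi> x y)" unfolding Suc.IH
      proof (intro allI impI)
        fix xs :: "'a list" and ys :: "'k list" and i
        assume "length xs = n" "length ys = Suc n" "i < n"
        then show "slot (ys ! i) (ys ! Suc i) (\<lambda>u. \<Phi> (x # xs[i := u]) (y # ys))"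
          using *[rule_format, of "x # xs" "y # ys" "Suc i"] by simp
      qed
    qed
  qed
qed simp

end

locale u3_module = u3 sc dd pr v
  for sc :: "'k::field_char_0 \<Rightarrow> 'a \<Rightarrow> 'a::ab_group_add" and dd pr v +
  fixes ma :: "nat \<Rightarrow> 'a \<Rightarrow> 'k poly \<Rightarrow> 'k poly"
  assumes module: "conf_module sc dd pr ma"
    and v_1: "\<forall>l. lam_ev smult ma v 1 l = dM 1"
begin

section \<open>The module action is given by the character \<open>r0\<close>\<close>

definition act :: "'k \<Rightarrow> 'a \<Rightarrow> 'k poly \<Rightarrow> 'k poly" where
  "act l a p = lam_ev smult ma a p l"

lemma act_sum: "finite S \<Longrightarrow> {n. ma n a p \<noteq> 0} \<subseteq> S \<Longrightarrow> act l a p = (\<Sum>n\<in>S. smult (l ^ n / fact n) (ma n a p))"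
  unfolding act_def lam_ev_def by (rule sum.mono_neutral_left) auto

lemma ma_lin: "ma n (x + y) p = ma n x p + ma n y p" "ma n x (p + q) = ma n x p + ma n x q"
  "ma n (sc c x) p = smult c (ma n x p)" "ma n x (smult c p) = smult c (ma n x p)"
  and ma_fin: "finite {n. ma n a p \<noteq> 0}"
  using module by (simp_all add: conf_module_def)

lemma act_dd: "act l (dd a) p = - smult l (act l a p)"
  and act_dM: "act l a (dM p) = dM (act l a p) + smult l (act l a p)"
  and act_mul: "act (l + m) (mul l a b) p = act l a (act m b p)"
  using module by (simp_all add: conf_module_def act_def mul_def)

lemma act_add: "act l (a + b) p = act l a p + act l b p"
proof -
  have S: "finite ({n. ma n a p \<noteq> 0} \<union> {n. ma n b p \<noteq> 0})" by (simp add: ma_fin)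
  show ?thesis
    unfolding act_sum[OF S, of a p l, simplified] act_sum[OF S, of b p l, simplified]
    by (subst act_sum[OF S]) (auto simp: ma_lin sum.distrib smult_add_right)
qed

lemma act_add_right: "act l a (p + q) = act l a p + act l a q"
proof -
  have S: "finite ({n. ma n a p \<noteq> 0} \<union> {n. ma n a q \<noteq> 0})" by (simp add: ma_fin)
  show ?thesis
    unfolding act_sum[OF S, of a p l, simplified] act_sum[OF S, of a q l, simplified]
    by (subst act_sum[OF S]) (auto simp: ma_lin sum.distrib smult_add_right)
qed

lemma act_sc: "act l (sc c a) p = smult c (act l a p)" "act l a (smult c p) = smult c (act l a p)"
  using act_sum[OF ma_fin[of a p], of "sc c a" p l] act_sum[OF ma_fin[of a p], of a p l]
    act_sum[OF ma_fin[of a p], of a "smult c p" l]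
  by (auto simp: ma_lin smult_sum_right mult.commute)

lemma poly_dM: "poly (dM p) y = y * poly p y"
  by (simp add: dM_def)

text \<open>Sesquilinearity turns \<partial> into \<partial> + \<open>l\<close>, so the prescribed
  action on 1 propagates to all polynomials.\<close>

lemma poly_act_v: "poly (act l v p) y = y * poly p (y + l)"
proof (induction p)
  case 0
  show ?case using act_sc(2)[of l v 0 0] by simp
next
  case (pCons c p)
  have "pCons c p = [:c:] + dM p" by (simp add: dM_def)
  moreover have "act l v [:c:] = smult c (dM 1)" using v_1 act_sc(2)[of l v c 1] by (simp add: act_def)
  ultimately show ?case using pCons
    by (simp add: act_add_right act_sc act_dM poly_dM algebra_simps)
qed

text \<open>Applying \<open>v\<close> with parameter \<open>k\<close> after \<open>v\<close> with
  parameter \<open>l - k\<close> can be computed from \<open>poly_act_v\<close> or through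
  \<open>mul_vv\<close>; the two results differ by \<open>k (l - k)\<close> times the action of
  \<open>E 0\<close>. The remaining \<open>E j\<close> follow from \<open>mul_vE\<close>.\<close>

lemma act_E: "act l (E j) p = 0"
proof (induction j arbitrary: l p)
  case 0
  obtain k where k: "k \<noteq> 0" "k \<noteq> l"
    using ex_new_if_finite[OF infinite_UNIV_char_0, of "{0, l}"] by auto
  have "k * (l - k) * poly (act l (E 0) p) y = 0" for y
  proof -
    have "act l (X v) p = act 0 v (act l v p)" using act_mul[of 0 l v v p] by (simp add: X_def)
    moreover have "act l (X v + sc k (v + dd (E 0)) + sc (k ^ 2) (E 0)) p = act k v (act (l - k) v p)"
      using act_mul[of k "l - k" v v p] by (simp add: mul_vv)
    ultimately have "poly (act k v (act (l - k) v p)) y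
      = poly (act 0 v (act l v p) + smult k (act l v p + - smult l (act l (E 0) p)) + smult (k ^ 2) (act l (E 0) p)) y"
      unfolding act_add act_sc act_dd by simp
    then show ?thesis by (simp add: poly_act_v algebra_simps power2_eq_square)
  qed
  then have "poly (act l (E 0) p) y = 0" for y using k by simp
  then show ?case by (intro poly_eq_poly_eq_iff[THEN iffD1] ext) simp
next
  case (Suc j)
  have "act (1 + (l - 1)) (mul 1 v (E j)) p = act 1 v (act (l - 1) (E j) p)" by (rule act_mul)
  moreover have "act (0 + l) (X (E j)) p = act 0 v (act l (E j) p)" unfolding X_def by (rule act_mul)
  moreover have "act k v 0 = 0" for k using act_sc(2)[of k v 0 0] by simp
  ultimately show ?case by (simp add: mul_vE act_add act_sc Suc)
qed

lemma poly_act: "poly (act l a p) y = y * gev a y (y + l) * poly p (y + l)"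
proof (induction a arbitrary: l p y rule: u3_induct)
  case (X a)
  have "act (0 + l) (X a) p = act 0 v (act l a p)" unfolding X_def by (rule act_mul)
  then show ?case by (simp add: poly_act_v X gev_X algebra_simps)
qed (simp_all add: poly_act_v gev_v act_E gev_E act_dd gev_dd act_add gev_add act_sc gev_sc algebra_simps)

section \<open>Translation of cochains and differentials\<close>

definition vtx :: "('a, 'k) cochain \<Rightarrow> 'a list \<Rightarrow> 'k list \<Rightarrow> 'k" where
  "vtx \<phi> xs ys = poly (\<phi> xs (diffs ys)) (hd ys)"

definition unvtx :: "nat \<Rightarrow> ('a list \<Rightarrow> 'k list \<Rightarrow> 'k) \<Rightarrow> ('a, 'k) cochain" where
  "unvtx n \<Phi> xs ls = (if length xs = n \<and> length ls = n then pfun (\<lambda>t. \<Phi> xs (psums t ls)) else 0)"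

lemma vtx_psums: "vtx \<phi> xs (psums y ls) = poly (\<phi> xs ls) y"
  by (simp add: vtx_def)

lemma PF_psums:
  assumes "CC n \<Phi>" "length xs = n"
  shows "PF (Suc n) (\<lambda>ys. \<Phi> xs (psums (hd ys) (tl ys)))"
  by (rule PF_PL[OF _ PL_psums]) (use assms in \<open>simp add: CC_def\<close>)

lemma poly_unvtx:
  assumes "CC n \<Phi>" "length xs = n" "length ls = n"
  shows "poly (unvtx n \<Phi> xs ls) y = \<Phi> xs (psums y ls)"
  using poly_pfun_PF[OF PF_psums[OF assms(1,2)] assms(3), of y] assms(2,3) by (simp add: unvtx_def)

lemma vtx_unvtx:
  assumes "CC n \<Phi>" "length xs = n" "length ys = Suc n"
  shows "vtx (unvtx n \<Phi>) xs ys = \<Phi> xs ys"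
proof -
  have "ys \<noteq> []" using assms(3) by auto
  then show ?thesis using assms by (simp add: vtx_def poly_unvtx psums_diffs)
qed

lemma cochain_eqI:
  assumes "\<And>xs ls. length xs \<noteq> n \<or> length ls \<noteq> n \<Longrightarrow> \<phi> xs ls = \<psi> xs ls"
    "\<And>xs ys. length xs = n \<Longrightarrow> length ys = Suc n \<Longrightarrow> vtx \<phi> xs ys = vtx \<psi> xs ys"
  shows "\<phi> = \<psi>"
proof (intro ext)
  fix xs ls
  show "\<phi> xs ls = \<psi> xs ls"
  proof (cases "length xs = n \<and> length ls = n")
    case True
    then have "poly (\<phi> xs ls) y = poly (\<psi> xs ls) y" for y
      using assms(2)[of xs "psums y ls"] by (simp add: vtx_psums)
    then show ?thesis by (intro poly_eq_poly_eq_iff[THEN iffD1] ext)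
  qed (use assms(1) in auto)
qed

lemma CC_vtx:
  assumes "cochain sc dd n \<phi>"
  shows "CC n (vtx \<phi>)"
  unfolding CC_def mlin_iff
proof (intro conjI allI impI)
  fix xs :: "'a list" and ys :: "'k list" and i
  assume l: "length xs = n" "length ys = Suc n" "i < n"
  have 1: "\<phi> (xs[i := x + y]) ls = \<phi> (xs[i := x]) ls + \<phi> (xs[i := y]) ls"
    "\<phi> (xs[i := sc c x]) ls = smult c (\<phi> (xs[i := x]) ls)"
    "\<phi> (xs[i := dd (xs ! i)]) ls = - smult (ls ! i) (\<phi> xs ls)"
    if "length xs = n" "length ls = n" for xs ls x y c
    using assms l(3) that unfolding cochain_def by blast+
  show "slot (ys ! i) (ys ! Suc i) (\<lambda>x. vtx \<phi> (xs[i := x]) ys)"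
  proof (rule slotI)
    fix x
    have "\<phi> (xs[i := dd x]) (diffs ys) = - smult (diffs ys ! i) (\<phi> (xs[i := x]) (diffs ys))"
      using 1(3)[of "xs[i := x]" "diffs ys"] l by simp
    then show "vtx \<phi> (xs[i := dd x]) ys = (ys ! i - ys ! Suc i) * vtx \<phi> (xs[i := x]) ys"
      using l by (simp add: vtx_def nth_diffs algebra_simps)
  qed (use 1(1,2)[of xs "diffs ys"] l in \<open>simp_all add: vtx_def\<close>)
next
  fix xs :: "'a list" assume "length xs = n"
  then have "PFP n (\<phi> xs)" using assms by (simp add: cochain_def poly_fun_iff)
  then show "PF (Suc n) (vtx \<phi> xs)"
    unfolding vtx_def by (rule PFP_poly[OF PFP_PL[OF _ PL_diffs] PF_hd])
qed

lemma cochain_unvtx: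
  assumes "CC n \<Phi>"
  shows "cochain sc dd n (unvtx n \<Phi>)"
  unfolding cochain_def
proof (intro conjI allI impI)
  fix xs :: "'a list" assume l: "length xs = n"
  have "PFP n (\<lambda>ls. pfun (\<lambda>t. \<Phi> xs (psums t ls)))"
    using PFP_pfun[OF PF_psums[OF assms l]] by simp
  then show "poly_fun n (unvtx n \<Phi> xs)"
    unfolding poly_fun_iff by (rule PFP_cong) (simp add: unvtx_def l)
next
  fix xs :: "'a list" and ls :: "'k list" and i
  assume *: "length xs = n \<and> length ls = n \<and> i < n"
  have s: "slot (psums t ls ! i) (psums t ls ! Suc i) (\<lambda>x. \<Phi> (xs[i := x]) (psums t ls))" for t
    using assms * unfolding CC_def mlin_iff by simp
  note p = poly_unvtx[OF assms]
  show "unvtx n \<Phi> (xs[i := x + y]) ls = unvtx n \<Phi> (xs[i := x]) ls + unvtx n \<Phi> (xs[i := y]) ls" for x y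
    by (rule poly_eq_poly_eq_iff[THEN iffD1], rule ext) (simp add: p * slotD(1)[OF s])
  show "unvtx n \<Phi> (xs[i := sc c x]) ls = smult c (unvtx n \<Phi> (xs[i := x]) ls)" for x c
    by (rule poly_eq_poly_eq_iff[THEN iffD1], rule ext) (simp add: p * slotD(2)[OF s])
  have "psums t ls ! Suc i - psums t ls ! i = ls ! i" for t
    using nth_diffs[of i "psums t ls"] * by simp
  then have "psums t ls ! i - psums t ls ! Suc i = - ls ! i" for t
    by (metis minus_diff_eq)
  then show "unvtx n \<Phi> (xs[i := dd (xs ! i)]) ls = - smult (ls ! i) (unvtx n \<Phi> xs ls)"
    by (intro poly_eq_poly_eq_iff[THEN iffD1] ext) (simp add: p * slotD(3)[OF s])
qed (auto simp: unvtx_def)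

lemma vtx_cdel: "ys \<noteq> [] \<Longrightarrow> vtx (cdel \<phi>) xs ys = last ys * vtx \<phi> xs ys"
  using last_psums[of "hd ys" "diffs ys"] by (simp add: vtx_def cdel_def poly_dM psums_diffs algebra_simps)

lemma vtx_hdiff:
  assumes l: "length xs = Suc n" "length ys = Suc (Suc n)"
  shows "vtx (hdiff sc pr ma n \<phi>) xs ys = dm r0 (vtx \<phi>) xs ys"
proof -
  let ?a = "\<lambda>i. take (i - 1) xs @ [mul (diffs ys ! (i - 1)) (xs ! (i - 1)) (xs ! i)] @ drop (i + 1) xs"
  have "dl (vtx \<phi>) xs ys = (\<Sum>i\<in>{1..n}. (-1) ^ i * vtx \<phi> (?a i) (take i ys @ drop (Suc i) ys))"
    by (rule dl_eq_sum[OF l])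
  also have "\<dots> = (\<Sum>i\<in>{1..n}. (-1) ^ i * poly (\<phi> (?a i)
    (take (i - 1) (diffs ys) @ [diffs ys ! (i - 1) + diffs ys ! i] @ drop (i + 1) (diffs ys))) (hd ys))"
  proof (rule sum.cong)
    fix i assume i: "i \<in> {1..n}"
    then have "diffs (take i ys @ drop (Suc i) ys)
      = take (i - 1) (diffs ys) @ [diffs ys ! (i - 1) + diffs ys ! i] @ drop (Suc i) (diffs ys)"
      by (intro diffs_merge) (use l in auto)
    \<comment> \<open>Merges start at \<open>i = 1\<close>, so the first vertex, which stands for
      \<partial>, is always kept.\<close>
    moreover have "hd (take i ys @ drop (Suc i) ys) = hd ys" using i l by (cases ys; cases i) auto
    ultimately show "(-1) ^ i * vtx \<phi> (?a i) (take i ys @ drop (Suc i) ys) = (-1) ^ i * poly (\<phi> (?a i)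
      (take (i - 1) (diffs ys) @ [diffs ys ! (i - 1) + diffs ys ! i] @ drop (i + 1) (diffs ys))) (hd ys)"
      by (simp add: vtx_def)
  qed simp
  moreover have "poly (act (diffs ys ! 0) (xs ! 0) (\<phi> (tl xs) (tl (diffs ys)))) (hd ys) = cup r0 (vtx \<phi>) xs ys"
    using l by (auto simp: length_Suc_conv poly_act cup_def r0_def vtx_def tl_diffs[symmetric])
  ultimately show ?thesis
    using l unfolding dm_def by (simp add: vtx_def hdiff_def act_def[symmetric] mul_def[symmetric] poly_sum)
qed

section \<open>Bases of the reduced cohomology\<close>

abbreviation comb :: "'k \<Rightarrow> ('a, 'k) cochain \<Rightarrow> 'k \<Rightarrow> ('a, 'k) cochain \<Rightarrow> ('a, 'k) cochain" where
  "comb a \<phi> b \<psi> \<equiv> (\<lambda>xs ls. smult a (\<phi> xs ls)) + (\<lambda>xs ls. smult b (\<psi> xs ls))"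

abbreviation W :: "nat \<Rightarrow> ('a, 'k) cochain" where "W n \<equiv> unvtx n (cw n)"
abbreviation U :: "nat \<Rightarrow> ('a, 'k) cochain" where "U n \<equiv> unvtx n (cu n)"
abbreviation Z :: "nat \<Rightarrow> ('a, 'k) cochain set" where "Z \<equiv> red_cocycles sc dd pr ma"
abbreviation B :: "nat \<Rightarrow> ('a, 'k) cochain set" where "B \<equiv> red_coboundaries sc dd pr ma"

lemma cdel_eq_0: "\<phi> xs ls = 0 \<Longrightarrow> cdel \<phi> xs ls = 0"
  by (simp add: cdel_def dM_def)

lemma cochain_zero: "cochain sc dd n (\<lambda>_ _. 0)"
  by (simp add: cochain_def poly_fun_0)

lemma W_in_Z: "W n \<in> Z n" and U_in_Z: "U n \<in> Z n"
proof -
  have "hdiff sc pr ma n (W n) = cdel (\<lambda>_ _. 0)"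
  proof (rule cochain_eqI[of "Suc n"])
    fix xs :: "'a list" and ys :: "'k list" assume l: "length xs = Suc n" "length ys = Suc (Suc n)"
    have "dm r0 (vtx (W n)) xs ys = dm r0 (cw n) xs ys"
      by (rule dm_eq[OF _ l(1)]) (use l in \<open>simp_all add: vtx_unvtx CC_cw\<close>)
    then show "vtx (hdiff sc pr ma n (W n)) xs ys = vtx (cdel (\<lambda>_ _. 0)) xs ys"
      using l by (simp add: vtx_hdiff dm_cw) (simp add: vtx_def cdel_eq_0)
  qed (auto simp: hdiff_def cdel_eq_0)
  then show "W n \<in> Z n" unfolding red_cocycles_def using cochain_zero cochain_unvtx[OF CC_cw] by blast
  have "hdiff sc pr ma n (U n) = cdel (W (Suc n))"
  proof (rule cochain_eqI[of "Suc n"])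
    fix xs :: "'a list" and ys :: "'k list" assume l: "length xs = Suc n" "length ys = Suc (Suc n)"
    have "dm r0 (vtx (U n)) xs ys = dm r0 (cu n) xs ys"
      by (rule dm_eq[OF _ l(1)]) (use l in \<open>simp_all add: vtx_unvtx CC_cu\<close>)
    moreover have "ys \<noteq> []" using l by auto
    ultimately show "vtx (hdiff sc pr ma n (U n)) xs ys = vtx (cdel (W (Suc n))) xs ys"
      using l by (simp add: vtx_hdiff vtx_cdel vtx_unvtx[OF CC_cw] dm_cu)
  qed (auto simp: hdiff_def unvtx_def cdel_eq_0)
  then show "U n \<in> Z n" unfolding red_cocycles_def using cochain_unvtx[OF CC_cw] cochain_unvtx[OF CC_cu] by blast
qed

lemma Z_decompose:
  assumes "\<phi> \<in> Z (Suc m)"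
  shows "\<exists>a b \<beta>. \<beta> \<in> B (Suc m) \<and> \<phi> = comb a (W (Suc m)) b (U (Suc m)) + \<beta>"
proof -
  obtain \<chi> where \<phi>: "cochain sc dd (Suc m) \<phi>" and \<chi>: "cochain sc dd (Suc (Suc m)) \<chi>"
    and d: "hdiff sc pr ma (Suc m) \<phi> = cdel \<chi>"
    using assms by (auto simp: red_cocycles_def)
  have "dm r0 (vtx \<phi>) xs ys = last ys * vtx \<chi> xs ys"
    if l: "length xs = Suc (Suc m)" "length ys = Suc (Suc (Suc m))" for xs ys
  proof -
    have "ys \<noteq> []" using l by auto
    then show ?thesis using vtx_hdiff[OF l, of \<phi>] vtx_cdel[of ys \<chi> xs] d by simp
  qed
  from reduced_cocycle[OF CC_vtx[OF \<phi>] CC_vtx[OF \<chi>] this] obtain a b \<psi> \<theta> where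
    \<psi>: "CC m \<psi>" and \<theta>: "CC (Suc m) \<theta>" and e: "\<And>xs ys. length xs = Suc m \<Longrightarrow> length ys = Suc (Suc m) \<Longrightarrow>
      vtx \<phi> xs ys = a * cw (Suc m) xs ys + b * cu (Suc m) xs ys + (dm r0 \<psi> xs ys + last ys * \<theta> xs ys)"
    by blast
  let ?\<beta> = "hdiff sc pr ma m (unvtx m \<psi>) + cdel (unvtx (Suc m) \<theta>)"
  have "?\<beta> \<in> B (Suc m)"
    unfolding red_coboundaries_def using cochain_unvtx[OF \<psi>] cochain_unvtx[OF \<theta>] by auto
  moreover have "\<phi> = comb a (W (Suc m)) b (U (Suc m)) + ?\<beta>"
  proof (rule cochain_eqI[of "Suc m"])
    fix xs :: "'a list" and ls :: "'k list" assume "length xs \<noteq> Suc m \<or> length ls \<noteq> Suc m"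
    then show "\<phi> xs ls = (comb a (W (Suc m)) b (U (Suc m)) + ?\<beta>) xs ls"
      using \<phi> by (auto simp: cochain_def unvtx_def hdiff_def cdel_def dM_def)
  next
    fix xs :: "'a list" and ys :: "'k list" assume l: "length xs = Suc m" "length ys = Suc (Suc m)"
    have "dm r0 (vtx (unvtx m \<psi>)) xs ys = dm r0 \<psi> xs ys"
      by (rule dm_eq[OF _ l(1)]) (use l \<psi> in \<open>simp_all add: vtx_unvtx\<close>)
    moreover have "vtx (hdiff sc pr ma m (unvtx m \<psi>)) xs ys = dm r0 (vtx (unvtx m \<psi>)) xs ys"
      by (rule vtx_hdiff[OF l])
    moreover have "vtx (cdel (unvtx (Suc m) \<theta>)) xs ys = last ys * \<theta> xs ys"
      using l by (subst vtx_cdel) (auto simp: vtx_unvtx \<theta>)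
    moreover have "vtx (comb a (W (Suc m)) b (U (Suc m)) + ?\<beta>) xs ys
      = a * vtx (W (Suc m)) xs ys + b * vtx (U (Suc m)) xs ys
        + (vtx (hdiff sc pr ma m (unvtx m \<psi>)) xs ys + vtx (cdel (unvtx (Suc m) \<theta>)) xs ys)"
      by (simp add: vtx_def)
    ultimately show "vtx \<phi> xs ys = vtx (comb a (W (Suc m)) b (U (Suc m)) + ?\<beta>) xs ys"
      using e[OF l] l by (simp add: vtx_unvtx CC_cw CC_cu)
  qed
  ultimately show ?thesis by blast
qed

lemma B_independent:
  assumes "comb a (W (Suc m)) b (U (Suc m)) \<in> B (Suc m)"
  shows "(a = 0 \<or> m \<notin> {1, 2}) \<and> (b = 0 \<or> m \<notin> {0, 1})"
proof -
  obtain \<psi> \<theta> where \<psi>: "cochain sc dd m \<psi>" and \<theta>: "cochain sc dd (Suc m) \<theta>"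
    and e: "comb a (W (Suc m)) b (U (Suc m)) = hdiff sc pr ma m \<psi> + cdel \<theta>"
    using assms by (auto simp: red_coboundaries_def)
  show ?thesis
  proof (rule reduced_coboundary[OF CC_vtx[OF \<psi>] CC_vtx[OF \<theta>]])
    fix xs :: "'a list" and ys :: "'k list" assume l: "length xs = Suc m" "length ys = Suc (Suc m)"
    have "a * vtx (W (Suc m)) xs ys + b * vtx (U (Suc m)) xs ys = vtx (hdiff sc pr ma m \<psi>) xs ys + vtx (cdel \<theta>) xs ys"
      using arg_cong[OF e, of "\<lambda>\<phi>. vtx \<phi> xs ys"] by (simp add: vtx_def)
    moreover have "ys \<noteq> []" using l by auto
    ultimately show "a * cw (Suc m) xs ys + b * cu (Suc m) xs ys = dm r0 (vtx \<psi>) xs ys + last ys * vtx \<theta> xs ys"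
      using l by (simp add: vtx_unvtx CC_cw CC_cu vtx_hdiff vtx_cdel)
  qed
qed

lemma W_eq_0: "n \<notin> {2, 3} \<Longrightarrow> smult c (W n xs ls) = 0" and U_eq_0: "n \<notin> {1, 2} \<Longrightarrow> smult c (U n xs ls) = 0"
  by (auto simp: unvtx_def cw_def cu_def intro!: pfun_eqI)

lemma dim_H_0: "n \<ge> 4 \<Longrightarrow> dim_H_eq sc dd pr ma n 0"
proof -
  assume n: "n \<ge> 4"
  have "\<phi> \<in> B n" if z: "\<phi> \<in> Z n" for \<phi>
  proof -
    obtain m where "n = Suc m" using n by (cases n) auto
    then obtain a b \<beta> where "\<beta> \<in> B n" "\<phi> = comb a (W n) b (U n) + \<beta>" using Z_decompose z by blast
    then show ?thesis using n by (simp add: W_eq_0 U_eq_0 fun_eq_iff[symmetric] zero_fun_def[symmetric])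
  qed
  then show ?thesis unfolding dim_H_eq_def quot_dim_eq_def by (intro exI[of _ "{}"]) simp
qed

lemma dim_H_1: "dim_H_eq sc dd pr ma 1 1"
proof -
  have "\<exists>f \<beta>. \<beta> \<in> B 1 \<and> \<phi> = (\<lambda>xs ls. smult (f (U 1)) (U 1 xs ls)) + \<beta>" if z: "\<phi> \<in> Z 1" for \<phi>
  proof -
    obtain a b \<beta> where "\<beta> \<in> B 1" "\<phi> = comb a (W 1) b (U 1) + \<beta>" using Z_decompose[of \<phi> 0] z by auto
    moreover have "comb a (W 1) b (U 1) = (\<lambda>xs ls. smult b (U 1 xs ls))" by (intro ext) (simp add: W_eq_0)
    ultimately show ?thesis by (intro exI[of _ "\<lambda>_. b"] exI[of _ \<beta>]) simp
  qed
  moreover have "b = 0" if z: "(\<lambda>xs ls. smult b (U 1 xs ls)) \<in> B 1" for b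
  proof -
    have "(\<lambda>xs ls. smult b (U 1 xs ls)) = comb 0 (W 1) b (U 1)" by (intro ext) simp
    then show ?thesis using B_independent[of 0 0 b] z by simp
  qed
  ultimately show ?thesis unfolding dim_H_eq_def quot_dim_eq_def
    using U_in_Z[of 1] by (intro exI[of _ "{U 1}"]) auto
qed

lemma dim_H_3: "dim_H_eq sc dd pr ma 3 1"
proof -
  have "\<exists>f \<beta>. \<beta> \<in> B 3 \<and> \<phi> = (\<lambda>xs ls. smult (f (W 3)) (W 3 xs ls)) + \<beta>" if z: "\<phi> \<in> Z 3" for \<phi>
  proof -
    obtain a b \<beta> where "\<beta> \<in> B 3" "\<phi> = comb a (W 3) b (U 3) + \<beta>"
      using Z_decompose[of \<phi> 2] z by (auto simp: numeral_3_eq_3 numeral_2_eq_2)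
    moreover have "comb a (W 3) b (U 3) = (\<lambda>xs ls. smult a (W 3 xs ls))" by (intro ext) (simp add: U_eq_0)
    ultimately show ?thesis by (intro exI[of _ "\<lambda>_. a"] exI[of _ \<beta>]) simp
  qed
  moreover have "a = 0" if z: "(\<lambda>xs ls. smult a (W 3 xs ls)) \<in> B 3" for a
  proof -
    have "(\<lambda>xs ls. smult a (W 3 xs ls)) = comb a (W 3) 0 (U 3)" by (intro ext) simp
    then have "comb a (W (Suc 2)) 0 (U (Suc 2)) \<in> B (Suc 2)" using z by (simp add: eval_nat_numeral)
    then show ?thesis using B_independent[of a 2 0] by simp
  qed
  ultimately show ?thesis unfolding dim_H_eq_def quot_dim_eq_def
    using W_in_Z[of 3] by (intro exI[of _ "{W 3}"]) auto
qed

text \<open>Besides independence, the set \<open>{W 2, U 2}\<close> must really have two elements.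
  Equality would make their difference, which is then 0, a coboundary with nonzero coefficients,
  contradicting independence.\<close>

lemma dim_H_2: "dim_H_eq sc dd pr ma 2 2"
proof -
  have ind: "a = 0 \<and> b = 0" if "comb a (W 2) b (U 2) \<in> B 2" for a b
    using B_independent[of a 1 b] that by (simp add: numeral_2_eq_2)
  have ne: "W 2 \<noteq> U 2"
  proof
    assume "W 2 = U 2"
    then have "comb 1 (W 2) (- 1) (U 2) = hdiff sc pr ma 1 (\<lambda>_ _. 0) + cdel (\<lambda>_ _. 0)"
      by (intro ext) (simp add: hdiff_def cdel_eq_0 act_def[symmetric] act_sc(2)[of _ _ 0 0, simplified])
    then have "comb 1 (W 2) (- 1) (U 2) \<in> B 2" unfolding red_coboundaries_def
      using cochain_zero[of 1] cochain_zero[of 2] by force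
    then show False using ind[of 1 "- 1"] by simp
  qed
  have "\<exists>f \<beta>. \<beta> \<in> B 2 \<and> \<phi> = comb (f (W 2)) (W 2) (f (U 2)) (U 2) + \<beta>" if z: "\<phi> \<in> Z 2" for \<phi>
  proof -
    obtain a b \<beta> where "\<beta> \<in> B 2" "\<phi> = comb a (W 2) b (U 2) + \<beta>"
      using Z_decompose[of \<phi> 1] z by (auto simp: numeral_2_eq_2)
    then show ?thesis using ne by (intro exI[of _ "\<lambda>\<phi>. if \<phi> = W 2 then a else b"] exI[of _ \<beta>]) simp
  qed
  then show ?thesis unfolding dim_H_eq_def quot_dim_eq_def
    using W_in_Z[of 2] U_in_Z[of 2] ne ind by (intro exI[of _ "{W 2, U 2}"]) (auto simp: add.assoc)
qed

end

theorem theorem4p6: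
  fixes sc :: "'k::field_char_0 \<Rightarrow> 'a \<Rightarrow> 'a::ab_group_add"
    and dd :: "'a \<Rightarrow> 'a" and pr :: "nat \<Rightarrow> 'a \<Rightarrow> 'a \<Rightarrow> 'a" and v :: 'a
    and ma :: "nat \<Rightarrow> 'a \<Rightarrow> 'k poly \<Rightarrow> 'k poly"
  assumes "is_U3 sc dd pr v"
    and "conf_module sc dd pr ma"
    and "\<forall>l. lam_ev smult ma v 1 l = dM 1"
  shows "dim_H_eq sc dd pr ma 1 1 \<and> dim_H_eq sc dd pr ma 2 2 \<and> dim_H_eq sc dd pr ma 3 1
       \<and> (\<forall>n\<ge>4. dim_H_eq sc dd pr ma n 0)"
proof -
  interpret u3_module sc dd pr v ma
    using assms by unfold_locales
  show ?thesis using dim_H_0 dim_H_1 dim_H_2 dim_H_3 by blast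
qed

end
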